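(* Assuming the Unique Games Conjecture, for every constant $C\ge1$ it is NP-hard to approximate the non-uniform versions of BalancedEdge-Separator and of SparsestCut within factor $C$.
   Context: Unique Games: an instance $(G(V,E),[N],\{\pi_e\},{\rm wt})$ consists of a graph, bijections $\pi_e:[N]\to[N]$ on edges $e\{v,w\}$ and weights ${\rm wt}(e)>0$ summing to 1; a labeling $\lambda:V\to[N]$ satisfies $e\{v,w\}$ if $\lambda(v)=\pi_e(\lambda(w))$, and ${\rm opt}$ is the maximum weight of satisfied edges. Unique Games Conjecture: for every $\eta,\zeta>0$ there is $N=N(\eta,\zeta)$ such that it is NP-hard to distinguish instances with label set $[N]$ having ${\rm opt}\ge1-\eta$ from those with ${\rm opt}\le\zeta$. SparsestCut (non-uniform): given a complete graph on $V$ with weights ${\rm wt}(e)\ge0$ and demands ${\rm dem}(e)\ge0$, minimize the sparsity $\sum_{e\in E(S,\overline S)}{\rm wt}(e)/\sum_{e\in E(S,\overline S)}{\rm dem}(e)$ over non-trivial cuts, where $E(S,\overline S)$ is the set of edges with exactly one endpoint in $S$; approximating within $C$ means outputting a cut whose sparsity is at most $C$ times the minimum. BalancedEdge-Separator (non-uniform): same graph data plus a balance parameter $B$ with $D/6\le B\le D/2$, $D=\sum_e{\rm dem}(e)$; a cut is $B'$-balanced if the demand of its crossing edges is at least $B'$; approximating within $C$ means outputting a $B/3$-balanced cut whose crossing weight is at most $C$ times the minimum crossing weight of a $B$-balanced cut. *)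

theory Defs
  imports Complex_Main "HOL-Library.FuncSet" "HOL-Computational_Algebra.Polynomial"
begin

section \<open>Polynomial time with an oracle\<close>

text \<open>
  The machine model is a multi-stack machine with structured control: registers hold bit strings,
  and every elementary step reads, pushes or pops one bit at the front of one register. A Turing
  machine tape is a pair of such registers (the parts left and right of the head), so running times
  agree with those of multi-tape oracle Turing machines up to polynomials.
\<close>

datatype prog =
    Skip
  | Push nat bool
  | Pop nat
  | Query nat nat
  | Seq prog prog
  | Branch nat prog prog prog
  | While nat prog

type_synonym store = "nat \<Rightarrow> bool list"

text \<open>
  \<open>exec f P s t s'\<close>: with oracle \<open>f\<close>, program \<open>P\<close> started in \<open>s\<close> halts in \<open>s'\<close> after \<open>t\<close> steps.
  A query is charged the length of the query string (the cost of writing it on a query tape);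
  the answer is free until it is read. \<open>Branch\<close> distinguishes an empty register, a leading
  \<open>True\<close> and a leading \<open>False\<close>.
\<close>

inductive exec :: "(bool list \<Rightarrow> bool list) \<Rightarrow> prog \<Rightarrow> store \<Rightarrow> nat \<Rightarrow> store \<Rightarrow> bool"
  for f :: "bool list \<Rightarrow> bool list" where
  Skip: "exec f Skip s 1 s"
| Push: "exec f (Push r b) s 1 (s(r := b # s r))"
| Pop: "exec f (Pop r) s 1 (s(r := tl (s r)))"
| Query: "exec f (Query r r') s (Suc (length (s r))) (s(r' := f (s r)))"
| Seq: "exec f P s t s' \<Longrightarrow> exec f Q s' t' s'' \<Longrightarrow> exec f (Seq P Q) s (t + t') s''"
| Branch: "exec f (case s r of [] \<Rightarrow> P | b # _ \<Rightarrow> if b then Q else R) s t s' \<Longrightarrow>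
    exec f (Branch r P Q R) s (Suc t) s'"
| While_end: "s r = [] \<Longrightarrow> exec f (While r P) s 1 s"
| While_step: "s r \<noteq> [] \<Longrightarrow> exec f P s t s' \<Longrightarrow> exec f (While r P) s' t' s'' \<Longrightarrow>
    exec f (While r P) s (Suc (t + t')) s''"

definition init_store :: "bool list list \<Rightarrow> store" where
  "init_store xs = (\<lambda>i. if i < length xs then xs ! i else [])"

definition outputs_within ::
  "(bool list \<Rightarrow> bool list) \<Rightarrow> prog \<Rightarrow> bool list list \<Rightarrow> nat \<Rightarrow> bool list \<Rightarrow> bool" where
  "outputs_within f P xs T y \<longleftrightarrow> (\<exists>t s. t \<le> T \<and> exec f P (init_store xs) t s \<and> s 0 = y)"


section \<open>NP and NP-hardness\<close>

text \<open>
  NP via verifiers that receive input and certificate in two registers. The oracle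
  \<open>\<lambda>_. []\<close> gives no information, so the verifier is an ordinary polynomial-time program.
\<close>

definition in_NP :: "bool list set \<Rightarrow> bool" where
  "in_NP L \<longleftrightarrow> (\<exists>V R (p :: nat poly) (q :: nat poly).
     (\<forall>x w. length w \<le> poly q (length x) \<longrightarrow>
        outputs_within (\<lambda>_. []) V [x, w] (poly p (length x)) [R x w]) \<and>
     (\<forall>x. x \<in> L \<longleftrightarrow> (\<exists>w. length w \<le> poly q (length x) \<and> R x w)))"

text \<open>
  A computational problem assigns to every input string its set of acceptable answers. Strings
  that do not encode an instance, or that encode an instance outside the promise, get \<open>UNIV\<close>.
  This covers both promise (gap) problems and search problems such as approximation problems.
\<close>

type_synonym problem = "bool list \<Rightarrow> bool list set"

definition solves :: "(bool list \<Rightarrow> bool list) \<Rightarrow> problem \<Rightarrow> bool" where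
  "solves f A \<longleftrightarrow> (\<forall>x. f x \<in> A x)"

text \<open>
  NP-hardness under polynomial-time Turing reductions, the usual notion for search problems: one
  program and one time bound decide \<open>L\<close> for every oracle that solves \<open>A\<close>.
\<close>

definition NP_hard :: "problem \<Rightarrow> bool" where
  "NP_hard A \<longleftrightarrow> (\<forall>L. in_NP L \<longrightarrow>
     (\<exists>M (p :: nat poly). \<forall>f. solves f A \<longrightarrow>
        (\<forall>x. outputs_within f M [x] (poly p (length x)) [x \<in> L])))"


section \<open>Encodings\<close>

text \<open>
  All codes are self-delimiting, hence codes can be concatenated. Vertex and edge counts are
  written in unary, so that the length of an instance is at least its number of vertices and edges;
  all other numbers are written in binary.
\<close>

definition enc_unary :: "nat \<Rightarrow> bool list" where
  "enc_unary n = replicate n True @ [False]"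

fun enc_nat :: "nat \<Rightarrow> bool list" where
  "enc_nat n = (if n = 0 then [False] else True # odd n # enc_nat (n div 2))"

declare enc_nat.simps [simp del]

text \<open>Only used for nonnegative rationals; \<^const>\<open>quotient_of\<close> gives the reduced fraction.\<close>

definition enc_rat :: "rat \<Rightarrow> bool list" where
  "enc_rat r = enc_nat (nat (fst (quotient_of r))) @ enc_nat (nat (snd (quotient_of r)))"


section \<open>Unique Games\<close>

text \<open>
  The vertices are \<open>{..<ug_verts U}\<close>, the edges \<open>{..<ug_edges U}\<close> (parallel edges are allowed) and
  the label set \<open>[N]\<close> is \<open>{..<N}\<close>. Edge \<open>e\<close> joins \<open>v = ug_left U e\<close> and \<open>w = ug_right U e\<close>; the
  bijection \<open>ug_perm U e\<close> maps labels of \<open>w\<close> to labels of \<open>v\<close>.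
\<close>

record unique_game =
  ug_verts :: nat
  ug_edges :: nat
  ug_left :: "nat \<Rightarrow> nat"
  ug_right :: "nat \<Rightarrow> nat"
  ug_perm :: "nat \<Rightarrow> nat \<Rightarrow> nat"
  ug_wt :: "nat \<Rightarrow> rat"

definition is_unique_game :: "nat \<Rightarrow> unique_game \<Rightarrow> bool" where
  "is_unique_game N U \<longleftrightarrow>
     (\<forall>e < ug_edges U.
        ug_left U e < ug_verts U \<and> ug_right U e < ug_verts U \<and> ug_left U e \<noteq> ug_right U e \<and>
        bij_betw (ug_perm U e) {..<N} {..<N} \<and> ug_wt U e > 0) \<and>
     (\<Sum>e<ug_edges U. ug_wt U e) = 1"

definition ug_value :: "unique_game \<Rightarrow> (nat \<Rightarrow> nat) \<Rightarrow> rat" where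
  "ug_value U l =
     (\<Sum>e | e < ug_edges U \<and> l (ug_left U e) = ug_perm U e (l (ug_right U e)). ug_wt U e)"

definition ug_opt :: "nat \<Rightarrow> unique_game \<Rightarrow> rat" where
  "ug_opt N U = Max (ug_value U ` ({..<ug_verts U} \<rightarrow>\<^sub>E {..<N}))"

definition enc_ug :: "nat \<Rightarrow> unique_game \<Rightarrow> bool list" where
  "enc_ug N U = enc_unary (ug_verts U) @ enc_unary (ug_edges U) @
     concat (map (\<lambda>e. enc_nat (ug_left U e) @ enc_nat (ug_right U e) @
       concat (map (\<lambda>i. enc_nat (ug_perm U e i)) [0..<N]) @ enc_rat (ug_wt U e))
       [0..<ug_edges U])"

definition gap_unique_games :: "nat \<Rightarrow> real \<Rightarrow> real \<Rightarrow> problem" where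
  "gap_unique_games N \<eta> \<zeta> x = {y. \<forall>U. is_unique_game N U \<and> x = enc_ug N U \<longrightarrow>
     (of_rat (ug_opt N U) \<ge> 1 - \<eta> \<longrightarrow> y = [True]) \<and>
     (of_rat (ug_opt N U) \<le> \<zeta> \<longrightarrow> y = [False])}"

definition unique_games_conjecture :: bool where
  "unique_games_conjecture \<longleftrightarrow>
     (\<forall>\<eta> > 0. \<forall>\<zeta> > 0. \<exists>N > 0. NP_hard (gap_unique_games N \<eta> \<zeta>))"


section \<open>Cuts in complete graphs with weights and demands\<close>

text \<open>The vertex set is \<open>{..<cg_verts I}\<close>; an edge is a two-element set of vertices.\<close>

record cut_graph =
  cg_verts :: nat
  cg_wt :: "nat set \<Rightarrow> rat"
  cg_dem :: "nat set \<Rightarrow> rat"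

definition cg_edges :: "cut_graph \<Rightarrow> nat set set" where
  "cg_edges I = {e. e \<subseteq> {..<cg_verts I} \<and> card e = 2}"

definition is_cut_graph :: "cut_graph \<Rightarrow> bool" where
  "is_cut_graph I \<longleftrightarrow> cg_verts I \<ge> 2 \<and> (\<forall>e \<in> cg_edges I. cg_wt I e \<ge> 0 \<and> cg_dem I e \<ge> 0)"

definition total_dem :: "cut_graph \<Rightarrow> rat" where
  "total_dem I = (\<Sum>e \<in> cg_edges I. cg_dem I e)"

definition cuts :: "cut_graph \<Rightarrow> nat set set" where
  "cuts I = {S. S \<subseteq> {..<cg_verts I} \<and> S \<noteq> {} \<and> S \<noteq> {..<cg_verts I}}"

definition crossing :: "cut_graph \<Rightarrow> nat set \<Rightarrow> nat set set" where
  "crossing I S = {e \<in> cg_edges I. card (e \<inter> S) = 1}"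

definition cut_wt :: "cut_graph \<Rightarrow> nat set \<Rightarrow> rat" where
  "cut_wt I S = (\<Sum>e \<in> crossing I S. cg_wt I e)"

definition cut_dem :: "cut_graph \<Rightarrow> nat set \<Rightarrow> rat" where
  "cut_dem I S = (\<Sum>e \<in> crossing I S. cg_dem I e)"

definition enc_cut_graph :: "cut_graph \<Rightarrow> bool list" where
  "enc_cut_graph I = enc_unary (cg_verts I) @
     concat (map (\<lambda>j. concat (map (\<lambda>i. enc_rat (cg_wt I {i, j}) @ enc_rat (cg_dem I {i, j})) [0..<j]))
       [0..<cg_verts I])"

definition enc_cut :: "cut_graph \<Rightarrow> nat set \<Rightarrow> bool list" where
  "enc_cut I S = map (\<lambda>v. v \<in> S) [0..<cg_verts I]"


subsection \<open>Non-uniform Sparsest Cut\<close>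

text \<open>
  A cut has a sparsity only if its demand is nonzero (in HOL, \<open>x / 0 = 0\<close>), so the minimum ranges
  over these cuts. At least one exists if and only if the total demand is positive.
\<close>

definition sparsity :: "cut_graph \<Rightarrow> nat set \<Rightarrow> rat" where
  "sparsity I S = cut_wt I S / cut_dem I S"

definition sparsity_cuts :: "cut_graph \<Rightarrow> nat set set" where
  "sparsity_cuts I = {S \<in> cuts I. cut_dem I S > 0}"

definition approx_sparsest_cut :: "real \<Rightarrow> problem" where
  "approx_sparsest_cut C x = {y. \<forall>I. is_cut_graph I \<and> total_dem I > 0 \<and> x = enc_cut_graph I \<longrightarrow>
     (\<exists>S \<in> sparsity_cuts I. y = enc_cut I S \<and>
        of_rat (sparsity I S) \<le> C * of_rat (Min (sparsity I ` sparsity_cuts I)))}"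


subsection \<open>Non-uniform Balanced Edge-Separator\<close>

definition balanced_cuts :: "cut_graph \<Rightarrow> rat \<Rightarrow> nat set set" where
  "balanced_cuts I B = {S \<in> cuts I. cut_dem I S \<ge> B}"

text \<open>
  Since \<open>B \<le> D / 2\<close>, a \<open>B\<close>-balanced cut always exists: a uniformly random cut separates half of the
  demand in expectation.
\<close>

definition approx_balanced_edge_separator :: "real \<Rightarrow> problem" where
  "approx_balanced_edge_separator C x = {y. \<forall>I B.
     is_cut_graph I \<and> total_dem I / 6 \<le> B \<and> B \<le> total_dem I / 2 \<and>
     x = enc_cut_graph I @ enc_rat B \<longrightarrow>
     (\<exists>S \<in> balanced_cuts I (B / 3). y = enc_cut I S \<and>
        of_rat (cut_wt I S) \<le> C * of_rat (Min (cut_wt I ` balanced_cuts I B)))}"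

end

theory Submission imports Defs begin

text \<open>
  Proof idea. Replace every vertex and every edge of a unique game with label set \<open>[N]\<close> by a copy of
  the hypercube \<open>{0,1}^N\<close>. The copy of an edge \<open>e\<close> carries the hypercube edges, and demands between
  antipodal points; it is tied by \<open>\<Lambda>\<close> times heavier edges to the copies of its two endpoints,
  after permuting coordinates by the constraint. A labeling gives the cut that is the dictator of
  its label on each copy; it separates all demands and costs \<open>1 + \<Lambda> \<eta>\<close> up to constants. Conversely,
  a cut that is cheap and separates a constant fraction of the demands has bounded total influence
  and nonnegligible variance on many copies, hence by Kahn, Kalai and Linial an influential
  coordinate, with a bound that does not depend on \<open>N\<close>. If \<open>\<Lambda>\<close> is large compared to this bound, tied
  copies share influential coordinates, and a random choice among them is a labeling of value
  bounded below.

  Weights are rounded to powers of two, and one extra pair of vertices is added whose separation has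
  an intermediate cost: whether the oracle separates it tells the two cases apart without any
  arithmetic. A sparse cut may concentrate on a small part of the game, so for Sparsest Cut the
  oracle is called repeatedly, each time removing the demands already separated; a combination of
  the cuts found by symmetric differences separates half of the removed demand at a cost that is at
  most the sum of their costs.
\<close>

section \<open>Polynomial bounds and running times\<close>

text \<open>The order in which the parameters are fixed shapes the proof. The factor
  \<open>C\<close> determines the cost \<open>2 ^ w\<close> of separating the deciding pair.
  \<open>C\<close> and \<open>w\<close> determine the cost that every substantial cut must exceed in
  the unsatisfiable case, and this determines the tie factor \<Lambda> and the soundness threshold
  \<zeta>. The completeness defect \<eta> is then chosen as small as \<Lambda> demands. Only now
  does the conjecture supply \<open>N\<close>, so none of the earlier constants may depend on it,
  which is why a bound free of the dimension is indispensable. In return \<open>N\<close> is a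
  constant of the reduction, and replacing a vertex by \<open>2 ^ N\<close> points costs a constant
  factor only. Antipodal demands are suited to the task from both sides: a dictator separates all
  antipodal pairs at the cost of a single direction, and a function separating many of them cannot
  be nearly constant. The hardness notion concerns search problems: nothing is known about an answer
  beyond its guarantee, and on meaningless queries not even its length. The reductions therefore
  read one prescribed bit pattern and must keep the simulation polynomial whatever the oracle
  writes.\<close>

definition poly_bounded :: "(nat \<Rightarrow> nat) \<Rightarrow> bool" where
  "poly_bounded g \<longleftrightarrow> (\<exists>c. \<forall>x. g x \<le> (x + 2) ^ c)"

lemma pb_mono: "poly_bounded h \<Longrightarrow> (\<And>x. g x \<le> h x) \<Longrightarrow> poly_bounded g"
  unfolding poly_bounded_def by (meson order_trans)

text \<open>The base \<open>x + 2\<close> is at least 2 even for \<open>x = 0\<close>; hence a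
  constant \<open>k\<close> is absorbed by the exponent \<open>k\<close>, and adding two bounds
  costs only one more in the exponent.\<close>

lemma pb_const: "poly_bounded (\<lambda>x. k)"
proof -
  have "k \<le> (x + 2) ^ k" for x :: nat
  proof -
    have "k \<le> 2 ^ k" by (simp add: less_imp_le)
    also have "\<dots> \<le> (x + 2) ^ k" by (intro power_mono) auto
    finally show ?thesis .
  qed
  then show ?thesis unfolding poly_bounded_def by blast
qed

lemma pb_id: "poly_bounded (\<lambda>x. x)"
  unfolding poly_bounded_def by (intro exI[of _ 1]) auto

lemma pb_add: assumes "poly_bounded g" "poly_bounded h" shows "poly_bounded (\<lambda>x. g x + h x)"
proof -
  obtain c d where c: "\<And>x. g x \<le> (x + 2) ^ c" and d: "\<And>x. h x \<le> (x + 2) ^ d"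
    using assms unfolding poly_bounded_def by blast
  have "g x + h x \<le> (x + 2) ^ Suc (c + d)" for x
  proof -
    have "g x \<le> (x + 2) ^ (c + d)"
      by (rule order_trans[OF c]) (rule power_increasing; simp)
    moreover have "h x \<le> (x + 2) ^ (c + d)"
      by (rule order_trans[OF d]) (rule power_increasing; simp)
    moreover have "(x + 2) ^ Suc (c + d) = (x + 2) ^ (c + d) + (x + 2) ^ (c + d) + x * (x + 2) ^ (c + d)"
      by (simp add: algebra_simps)
    ultimately show ?thesis by linarith
  qed
  then show ?thesis unfolding poly_bounded_def by blast
qed

lemma pb_mult: assumes "poly_bounded g" "poly_bounded h" shows "poly_bounded (\<lambda>x. g x * h x)"
proof -
  obtain c d where c: "\<And>x. g x \<le> (x + 2) ^ c" and d: "\<And>x. h x \<le> (x + 2) ^ d"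
    using assms unfolding poly_bounded_def by blast
  have "g x * h x \<le> (x + 2) ^ (c + d)" for x
    unfolding power_add by (intro mult_mono c d) auto
  then show ?thesis unfolding poly_bounded_def by blast
qed

lemma pb_power: "poly_bounded g \<Longrightarrow> poly_bounded (\<lambda>x. g x ^ k)"
  by (induction k) (auto intro: pb_const pb_mult)

lemma pb_comp: assumes "poly_bounded g" "poly_bounded h" shows "poly_bounded (\<lambda>x. g (h x))"
proof -
  obtain c where c: "\<And>x. g x \<le> (x + 2) ^ c" using assms unfolding poly_bounded_def by blast
  have "poly_bounded (\<lambda>x. (h x + 2) ^ c)" by (intro pb_power pb_add assms pb_const)
  then show ?thesis by (rule pb_mono) (rule c)
qed

lemma pb_Suc: "poly_bounded g \<Longrightarrow> poly_bounded (\<lambda>x. Suc (g x))"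
  using pb_add[OF _ pb_const[of 1]] by simp

lemma pb_poly: "poly_bounded (poly (p :: nat poly))"
  by (induction p) (auto simp: pCons_0_0 intro!: pb_const pb_add pb_mult pb_id)

lemma pb_sum: "(\<And>i. i \<in> A \<Longrightarrow> poly_bounded (g i)) \<Longrightarrow> poly_bounded (\<lambda>x. \<Sum>i\<in>A. g i x)"
  by (induction A rule: infinite_finite_induct) (auto intro: pb_const pb_add)

lemmas pb_intros = pb_const pb_id pb_add pb_mult pb_power pb_Suc pb_sum pb_poly

lemma pb_imp_poly: "poly_bounded g \<Longrightarrow> \<exists>p :: nat poly. \<forall>x. g x \<le> poly p x"
proof -
  assume "poly_bounded g"
  then obtain c where "\<And>x. g x \<le> (x + 2) ^ c" unfolding poly_bounded_def by blast
  then show ?thesis by (intro exI[of _ "[:2, 1:] ^ c"]) (simp add: poly_power add.commute)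
qed

text \<open>An upper bound replaces the exact step count of \<open>exec\<close>, so that bounds can
  be weakened freely and need not agree between the branches of a program.\<close>

definition runs :: "(bool list \<Rightarrow> bool list) \<Rightarrow> prog \<Rightarrow> store \<Rightarrow> nat \<Rightarrow> store \<Rightarrow> bool" where
  "runs f P s T s' \<longleftrightarrow> (\<exists>t\<le>T. exec f P s t s')"

lemma runs_exec: "exec f P s t s' \<Longrightarrow> runs f P s t s'"
  unfolding runs_def by blast

lemma runs_mono: "runs f P s T s' \<Longrightarrow> T \<le> T' \<Longrightarrow> runs f P s T' s'"
  unfolding runs_def by (meson order_trans)

lemma runs_Seq: "runs f P s T s' \<Longrightarrow> runs f Q s' T' s'' \<Longrightarrow> runs f (Seq P Q) s (T + T') s''"
  unfolding runs_def by (meson add_mono exec.Seq)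

lemma runs_Branch:
  "runs f (case s r of [] \<Rightarrow> P | b # _ \<Rightarrow> if b then Q else R) s t s' \<Longrightarrow>
    runs f (Branch r P Q R) s (Suc t) s'"
  unfolding runs_def using exec.Branch[where f = f and s = s and r = r] by (metis Suc_le_mono)

lemma runs_While_end: "s r = [] \<Longrightarrow> runs f (While r P) s 1 s"
  by (intro runs_exec exec.While_end)

lemma runs_While_step: "s r \<noteq> [] \<Longrightarrow> runs f P s t s' \<Longrightarrow> runs f (While r P) s' t' s'' \<Longrightarrow>
    runs f (While r P) s (Suc (t + t')) s''"
  unfolding runs_def by (meson Suc_le_mono add_mono exec.While_step)

lemma runs_Skip: "runs f Skip s 1 s"
  by (intro runs_exec exec.Skip)

lemma runs_Push: "runs f (Push r b) s 1 (s(r := b # s r))"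
  by (intro runs_exec exec.Push)

lemma runs_Pop: "runs f (Pop r) s 1 (s(r := tl (s r)))"
  by (intro runs_exec exec.Pop)

section \<open>Clearing, moving and copying registers\<close>

definition clear :: "nat \<Rightarrow> prog" where
  "clear a = While a (Pop a)"

lemma runs_clear: "runs f (clear a) s (Suc (2 * length (s a))) (s(a := []))"
proof (induction "length (s a)" arbitrary: s)
  case 0
  then show ?case unfolding clear_def using runs_While_end[of s a f "Pop a"] by (simp add: fun_upd_idem)
next
  case (Suc l)
  have "runs f (clear a) (s(a := tl (s a))) (Suc (2 * length ((s(a := tl (s a))) a))) ((s(a := tl (s a)))(a := []))"
    by (rule Suc(1)) (use Suc(2) in simp)
  from runs_While_step[OF _ runs_Pop this[unfolded clear_def]] Suc(2)[symmetric]
  show ?case unfolding clear_def by (auto simp: length_Suc_conv)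
qed

definition moveto :: "nat \<Rightarrow> nat \<Rightarrow> prog" where
  "moveto a b = While a (Branch a Skip (Seq (Push b True) (Pop a)) (Seq (Push b False) (Pop a)))"

lemma runs_moveto:
  assumes "a \<noteq> b"
  shows "runs f (moveto a b) s (Suc (4 * length (s a))) (s(a := [], b := rev (s a) @ s b))"
proof (induction "s a" arbitrary: s)
  case Nil
  then show ?case
    using runs_While_end[of s a f] assms unfolding moveto_def
    by (metis append_Nil fun_upd_triv list.size(3) mult_0_right One_nat_def rev.simps(1))
next
  case (Cons c cs)
  let ?B = "Branch a Skip (Seq (Push b True) (Pop a)) (Seq (Push b False) (Pop a))"
  let ?s = "s(b := c # s b, a := cs)"
  have "runs f (Seq (Push b c) (Pop a)) s (1 + 1) ((s(b := c # s b))(a := tl ((s(b := c # s b)) a)))"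
    by (rule runs_Seq[OF runs_Push runs_Pop])
  then have "runs f (Seq (Push b c) (Pop a)) s 2 ?s"
    using assms Cons(2)[symmetric] by (simp add: numeral_2_eq_2)
  then have "runs f ?B s (Suc 2) ?s"
    using Cons(2)[symmetric] by (intro runs_Branch) (cases c; simp)
  moreover have "runs f (moveto a b) ?s (Suc (4 * length (?s a))) (?s(a := [], b := rev (?s a) @ ?s b))"
    by (rule Cons(1)) simp
  ultimately have "runs f (moveto a b) s (Suc (Suc 2 + Suc (4 * length (?s a)))) (?s(a := [], b := rev (?s a) @ ?s b))"
    unfolding moveto_def using Cons(2)[symmetric] by (intro runs_While_step) auto
  then show ?case using Cons(2)[symmetric] assms by (simp add: fun_upd_twist)
qed

text \<open>Registers are stacks, so one move reverses the string; a second move through the scratch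
  register \<open>c\<close> restores its order.\<close>

lemma moveto_twice:
  assumes "a \<noteq> b" "a \<noteq> c" "b \<noteq> c" "s b = []" "s c = []"
  shows "runs f (Seq (moveto a c) (moveto c b)) s (8 * length (s a) + 2) (s(a := [], b := s a))"
proof -
  have "runs f (moveto a c) s (Suc (4 * length (s a))) (s(a := [], c := rev (s a) @ s c))"
    by (rule runs_moveto) (use assms in auto)
  moreover have "runs f (moveto c b) (s(a := [], c := rev (s a) @ s c)) (Suc (4 * length (s a))) (s(a := [], b := s a))"
  proof -
    have *: "(s(a := [], c := rev (s a) @ s c)) (c := [], b := rev ((s(a := [], c := rev (s a) @ s c)) c) @ (s(a := [], c := rev (s a) @ s c)) b)
       = s(a := [], b := s a)" using assms by (auto simp: fun_eq_iff)
    show ?thesis using runs_moveto[of c b f "s(a := [], c := rev (s a) @ s c)"] assms unfolding * by simp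
  qed
  ultimately show ?thesis using runs_Seq by (fastforce intro: runs_mono)
qed

text \<open>Reading a register destroys it. The string is parked in \<open>c\<close>, and the pass
  that brings it back to \<open>a\<close> pushes each bit onto \<open>b\<close> as well.\<close>

definition copyto :: "nat \<Rightarrow> nat \<Rightarrow> nat \<Rightarrow> prog" where
  "copyto a b c = Seq (moveto a c) (While c (Branch c Skip
     (Seq (Push a True) (Seq (Push b True) (Pop c))) (Seq (Push a False) (Seq (Push b False) (Pop c)))))"

lemma runs_copyto:
  assumes "a \<noteq> b" "a \<noteq> c" "b \<noteq> c" "s b = []" "s c = []"
  shows "runs f (copyto a b c) s (9 * length (s a) + 2) (s(b := s a))"
proof -
  let ?B = "Branch c Skip
     (Seq (Push a True) (Seq (Push b True) (Pop c))) (Seq (Push a False) (Seq (Push b False) (Pop c)))"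
  have loop: "runs f (While c ?B) s (Suc (5 * length (s c)))
     (s(c := [], a := rev (s c) @ s a, b := rev (s c) @ s b))" for s
  proof (induction "s c" arbitrary: s)
    case Nil
    then show ?case using runs_While_end[of s c f ?B]
      by (metis append_Nil fun_upd_triv list.size(3) mult_0_right One_nat_def rev.simps(1))
  next
    case (Cons x xs)
    let ?s = "s(a := x # s a, b := x # s b, c := xs)"
    have "runs f (Seq (Push a x) (Seq (Push b x) (Pop c))) s (1 + (1 + 1)) ?s"
    proof -
      have "runs f (Seq (Push a x) (Seq (Push b x) (Pop c))) s (1 + (1 + 1))
        (((s(a := x # s a))(b := x # (s(a := x # s a)) b))
           (c := tl (((s(a := x # s a))(b := x # (s(a := x # s a)) b)) c)))"
        by (rule runs_Seq[OF runs_Push runs_Seq[OF runs_Push runs_Pop]])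
      then show ?thesis using assms Cons(2)[symmetric] by simp
    qed
    then have "runs f ?B s (Suc 3) ?s"
      using Cons(2)[symmetric] by (intro runs_Branch) (cases x; simp add: eval_nat_numeral)
    moreover have "runs f (While c ?B) ?s (Suc (5 * length (?s c)))
       (?s(c := [], a := rev (?s c) @ ?s a, b := rev (?s c) @ ?s b))"
      by (rule Cons(1)) simp
    ultimately have "runs f (While c ?B) s (Suc (Suc 3 + Suc (5 * length (?s c))))
       (?s(c := [], a := rev (?s c) @ ?s a, b := rev (?s c) @ ?s b))"
      using Cons(2)[symmetric] by (intro runs_While_step) auto
    then show ?case using Cons(2)[symmetric] assms by (simp add: fun_upd_twist)
  qed
  let ?s = "s(a := [], c := rev (s a) @ s c)"
  have "runs f (moveto a c) s (Suc (4 * length (s a))) ?s"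
    by (rule runs_moveto) (use assms in auto)
  from runs_Seq[OF this loop]
  have "runs f (copyto a b c) s (Suc (4 * length (s a)) + Suc (5 * length (?s c))) (?s(c := [], a := rev (?s c) @ ?s a, b := rev (?s c) @ ?s b))"
    unfolding copyto_def .
  moreover have "(?s(c := [], a := rev (?s c) @ ?s a, b := rev (?s c) @ ?s b)) = s(b := s a)"
    using assms by (auto simp: fun_eq_iff)
  ultimately show ?thesis using assms by simp
qed

section \<open>Functions computable in polynomial time\<close>

definition env_size :: "nat \<Rightarrow> store \<Rightarrow> nat" where
  "env_size n e = (\<Sum>i<n. length (e i))"

lemma length_le_env_size: "i < n \<Longrightarrow> length (e i) \<le> env_size n e"
  unfolding env_size_def by (rule member_le_sum) auto

lemma env_size_Suc: "env_size (Suc n) e = env_size n e + length (e n)"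
  by (simp add: env_size_def)

lemma env_size_cong: "(\<And>i. i < n \<Longrightarrow> e i = e' i) \<Longrightarrow> env_size n e = env_size n e'"
  by (simp add: env_size_def)

text \<open>The location \<open>\<rho>\<close> of the arguments and the base \<open>d\<close> of the work space are parameters, so that
  programs can be composed without renaming registers.\<close>

definition poly_time :: "nat \<Rightarrow> (store \<Rightarrow> bool list) \<Rightarrow> bool" where
  "poly_time n F \<longleftrightarrow> (\<forall>e e'. (\<forall>i<n. e i = e' i) \<longrightarrow> F e = F e') \<and>
    (\<exists>g. poly_bounded g \<and> mono g \<and> (\<forall>\<rho> d. (\<forall>i<n. \<rho> i < d) \<longrightarrow> (\<exists>P. \<forall>f s. (\<forall>i\<ge>d. s i = []) \<longrightarrow>
       runs f P s (g (env_size n (\<lambda>i. s (\<rho> i)))) (s(d := F (\<lambda>i. s (\<rho> i)))))))"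

lemma pb_obtain_mono: assumes "poly_bounded g" obtains h where "poly_bounded h" "mono h" "\<And>x. g x \<le> h x"
proof -
  obtain c where "\<And>x. g x \<le> (x + 2) ^ c" using assms unfolding poly_bounded_def by blast
  moreover have "poly_bounded (\<lambda>x. (x + 2) ^ c)" by (intro pb_intros)
  moreover have "mono (\<lambda>x::nat. (x + 2) ^ c)" by (auto intro!: monoI power_mono)
  ultimately show thesis using that by blast
qed

lemma pfI:
  assumes "\<And>e e'. (\<And>i. i < n \<Longrightarrow> e i = e' i) \<Longrightarrow> F e = F e'"
    and "poly_bounded g"
    and "\<And>\<rho> d. (\<And>i. i < n \<Longrightarrow> \<rho> i < d) \<Longrightarrow> \<exists>P. \<forall>f s. (\<forall>i\<ge>d. s i = []) \<longrightarrow>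
       runs f P s (g (env_size n (\<lambda>i. s (\<rho> i)))) (s(d := F (\<lambda>i. s (\<rho> i))))"
  shows "poly_time n F"
proof -
  obtain h where "poly_bounded h" "mono h" "\<And>x. g x \<le> h x" using pb_obtain_mono[OF assms(2)] by blast
  then have "poly_bounded h \<and> mono h \<and> (\<forall>\<rho> d. (\<forall>i<n. \<rho> i < d) \<longrightarrow> (\<exists>P. \<forall>f s. (\<forall>i\<ge>d. s i = []) \<longrightarrow>
       runs f P s (h (env_size n (\<lambda>i. s (\<rho> i)))) (s(d := F (\<lambda>i. s (\<rho> i))))))"
    using assms(3) by (meson runs_mono)
  then show ?thesis unfolding poly_time_def using assms(1) by blast
qed

lemma pf_dep: "poly_time n F \<Longrightarrow> (\<And>i. i < n \<Longrightarrow> e i = e' i) \<Longrightarrow> F e = F e'"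
  unfolding poly_time_def by blast

lemma exec_length: "exec f P s t s' \<Longrightarrow> f = (\<lambda>_. []) \<Longrightarrow> length (s' r) \<le> length (s r) + t"
  by (induction rule: exec.induct) auto

text \<open>The programs in \<open>poly_time\<close> work for every oracle, in particular for the
  one that always answers \<open>[]\<close>. With that oracle a register grows by at most one bit
  per step, so the running time bounds the length of the value.\<close>

lemma pf_size: assumes "poly_time n F" shows "\<exists>h. poly_bounded h \<and> mono h \<and> (\<forall>e. length (F e) \<le> h (env_size n e))"
proof -
  obtain g where g: "poly_bounded g" "mono g" and P: "\<And>\<rho> d. (\<forall>i<n. \<rho> i < d) \<Longrightarrow> (\<exists>P. \<forall>f s. (\<forall>i\<ge>d. s i = []) \<longrightarrow>
       runs f P s (g (env_size n (\<lambda>i. s (\<rho> i)))) (s(d := F (\<lambda>i. s (\<rho> i)))))"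
    using assms unfolding poly_time_def by blast
  obtain P where P: "\<And>f s. (\<forall>i\<ge>n. s i = []) \<Longrightarrow> runs f P s (g (env_size n s)) (s(n := F s))"
    using P[of id n] by auto
  have "length (F e) \<le> g (env_size n e)" for e
  proof -
    define s where "s = (\<lambda>i. if i < n then e i else [])"
    have [simp]: "env_size n s = env_size n e" "F s = F e"
      by (auto simp: s_def intro!: env_size_cong pf_dep[OF assms])
    obtain t where "t \<le> g (env_size n e)" "exec (\<lambda>_. []) P s t (s(n := F e))"
      using P[of s "\<lambda>_. []"] unfolding runs_def \<open>env_size n s = env_size n e\<close> \<open>F s = F e\<close> by (auto simp: s_def)
    from exec_length[OF this(2), of n] this(1) show ?thesis by (simp add: s_def)
  qed
  then show ?thesis using g by blast
qed

lemma pf_rename: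
  assumes "poly_time m F" "\<And>i. i < m \<Longrightarrow> \<theta> i < n"
  shows "poly_time n (\<lambda>e. F (\<lambda>i. e (\<theta> i)))"
proof -
  obtain g where g: "poly_bounded g" "mono g" and P: "\<And>\<rho> d. (\<forall>i<m. \<rho> i < d) \<Longrightarrow> (\<exists>P. \<forall>f s. (\<forall>i\<ge>d. s i = []) \<longrightarrow>
       runs f P s (g (env_size m (\<lambda>i. s (\<rho> i)))) (s(d := F (\<lambda>i. s (\<rho> i)))))"
    using assms unfolding poly_time_def by blast
  have env_size: "env_size m (\<lambda>i. e (\<theta> i)) \<le> m * env_size n e" for e
  proof -
    have "env_size m (\<lambda>i. e (\<theta> i)) \<le> (\<Sum>i<m. env_size n e)"
      unfolding env_size_def[of m] by (intro sum_mono length_le_env_size) (use assms in auto)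
    then show ?thesis by simp
  qed
  show ?thesis
  proof (rule pfI)
    show "poly_bounded (\<lambda>x. g (m * x))" by (rule pb_comp[OF g(1)]) (intro pb_intros)
    fix \<rho> d assume "\<And>i. i < n \<Longrightarrow> \<rho> i < (d::nat)"
    then have "\<forall>i<m. \<rho> (\<theta> i) < d" using assms by auto
    from P[OF this] obtain P where P: "\<And>f s. (\<forall>i\<ge>d. s i = []) \<Longrightarrow>
       runs f P s (g (env_size m (\<lambda>i. s (\<rho> (\<theta> i))))) (s(d := F (\<lambda>i. s (\<rho> (\<theta> i)))))" by meson
    have "runs f P s (g (m * env_size n (\<lambda>i. s (\<rho> i)))) (s(d := F (\<lambda>i. s (\<rho> (\<theta> i)))))"
      if "\<forall>i\<ge>d. s i = []" for f s
      by (rule runs_mono[OF P[OF that] monoD[OF g(2) env_size[of "\<lambda>i. s (\<rho> i)"]]])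
    then show "\<exists>P. \<forall>f s. (\<forall>i\<ge>d. s i = []) \<longrightarrow>
       runs f P s (g (m * env_size n (\<lambda>i. s (\<rho> i)))) (s(d := F (\<lambda>i. s (\<rho> (\<theta> i)))))"
      by blast
  qed (auto intro!: pf_dep[OF assms(1)] assms(2))
qed

lemma pf_Nil: "poly_time n (\<lambda>e. [])"
proof (rule pfI[OF _ pb_const[of 1]])
  fix \<rho> :: "nat \<Rightarrow> nat" and d
  have "runs f Skip s 1 (s(d := []))" if "\<forall>i\<ge>d. s i = []" for f s
    using runs_Skip[of f s] that by (simp add: fun_upd_idem)
  then show "\<exists>P. \<forall>f s. (\<forall>i\<ge>d. s i = []) \<longrightarrow> runs f P s 1 (s(d := []))" by blast
qed auto

lemma pf_var: assumes "i < n" shows "poly_time n (\<lambda>e. e i)"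
proof (rule pfI)
  show "poly_bounded (\<lambda>x. 9 * x + 2)" by (intro pb_intros)
  fix \<rho> :: "nat \<Rightarrow> nat" and d assume \<rho>: "\<And>i. i < n \<Longrightarrow> \<rho> i < d"
  have "runs f (copyto (\<rho> i) d (Suc d)) s (9 * env_size n (\<lambda>i. s (\<rho> i)) + 2) (s(d := s (\<rho> i)))"
    if "\<forall>i\<ge>d. s i = []" for f s
    by (rule runs_mono[OF runs_copyto])
      (use that \<rho>[OF assms] length_le_env_size[OF assms, of "\<lambda>i. s (\<rho> i)"] in auto)
  then show "\<exists>P. \<forall>f s. (\<forall>i\<ge>d. s i = []) \<longrightarrow> runs f P s (9 * env_size n (\<lambda>i. s (\<rho> i)) + 2) (s(d := s (\<rho> i)))"
    by blast
qed (use assms in auto)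

lemma pf_post:
  assumes "poly_time n F" and Q: "\<And>d. \<exists>Q. \<forall>f s. runs f Q s 1 (s(d := h (s d)))"
  shows "poly_time n (\<lambda>e. h (F e))"
proof -
  obtain g where g: "poly_bounded g" "mono g" and P: "\<And>\<rho> d. (\<forall>i<n. \<rho> i < d) \<Longrightarrow> (\<exists>P. \<forall>f s. (\<forall>i\<ge>d. s i = []) \<longrightarrow>
       runs f P s (g (env_size n (\<lambda>i. s (\<rho> i)))) (s(d := F (\<lambda>i. s (\<rho> i)))))"
    using assms unfolding poly_time_def by blast
  show ?thesis
  proof (rule pfI)
    show "poly_bounded (\<lambda>x. g x + 1)" by (intro pb_intros g)
    fix \<rho> d assume "\<And>i. i < n \<Longrightarrow> \<rho> i < (d::nat)"
    then obtain P where P: "\<And>f s. (\<forall>i\<ge>d. s i = []) \<Longrightarrow>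
       runs f P s (g (env_size n (\<lambda>i. s (\<rho> i)))) (s(d := F (\<lambda>i. s (\<rho> i))))" using P by meson
    obtain Q where Q: "\<And>f s. runs f Q s 1 (s(d := h (s d)))" using Q by meson
    have "runs f (Seq P Q) s (g (env_size n (\<lambda>i. s (\<rho> i))) + 1) (s(d := h (F (\<lambda>i. s (\<rho> i)))))"
      if "\<forall>i\<ge>d. s i = []" for f s
      using runs_Seq[OF P[OF that] Q] by simp
    then show "\<exists>P. \<forall>f s. (\<forall>i\<ge>d. s i = []) \<longrightarrow>
       runs f P s (g (env_size n (\<lambda>i. s (\<rho> i))) + 1) (s(d := h (F (\<lambda>i. s (\<rho> i)))))" by blast
  qed (use pf_dep[OF assms(1)] in metis)
qed

lemma pf_Cons: "poly_time n F \<Longrightarrow> poly_time n (\<lambda>e. b # F e)"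
  by (erule pf_post[of n F "(#) b"]) (use runs_Push in blast)

lemma pf_tl: "poly_time n F \<Longrightarrow> poly_time n (\<lambda>e. tl (F e))"
  by (erule pf_post[of n F tl]) (use runs_Pop in blast)

text \<open>The arguments are evaluated one after the other. The work space of the next one begins
  just above the values already stored, which is possible because the base is a parameter of
  \<open>poly_time\<close>.\<close>

lemma runs_args:
  assumes "\<And>i. i < m \<Longrightarrow> poly_time n (F i)"
  shows "\<exists>g. poly_bounded g \<and> mono g \<and> (\<forall>\<rho> d. (\<forall>i<n. \<rho> i < d) \<longrightarrow> (\<exists>P. \<forall>f s. (\<forall>i\<ge>d. s i = []) \<longrightarrow>
       runs f P s (g (env_size n (\<lambda>i. s (\<rho> i))))
         (\<lambda>j. if d \<le> j \<and> j < d + m then F (j - d) (\<lambda>i. s (\<rho> i)) else s j)))"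
  using assms
proof (induction m)
  case 0
  have "runs f Skip s 1 (\<lambda>j. if d \<le> j \<and> j < d then F (j - d) (\<lambda>i. s (\<rho> i)) else s j)" for f s d \<rho>
  proof -
    have "(\<lambda>j. if d \<le> j \<and> j < d then F (j - d) (\<lambda>i. s (\<rho> i)) else s j) = s" by (auto simp: fun_eq_iff)
    then show ?thesis using runs_Skip[of f s] by simp
  qed
  then have "\<forall>\<rho> d. (\<forall>i<n. \<rho> i < d) \<longrightarrow> (\<exists>P. \<forall>f s. (\<forall>i\<ge>d. s i = []) \<longrightarrow>
       runs f P s 1 (\<lambda>j. if d \<le> j \<and> j < d + 0 then F (j - d) (\<lambda>i. s (\<rho> i)) else s j))"
    unfolding add_0_right by blast
  then show ?case by (intro exI[of _ "\<lambda>_. 1"]) (auto intro: pb_const monoI)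
next
  case (Suc m)
  obtain g where g: "poly_bounded g" "mono g" and P: "\<And>\<rho> d. (\<forall>i<n. \<rho> i < d) \<Longrightarrow> (\<exists>P. \<forall>f s. (\<forall>i\<ge>d. s i = []) \<longrightarrow>
       runs f P s (g (env_size n (\<lambda>i. s (\<rho> i))))
         (\<lambda>j. if d \<le> j \<and> j < d + m then F (j - d) (\<lambda>i. s (\<rho> i)) else s j))"
    using Suc by (auto 0 3 simp: less_SucI)
  have "poly_time n (F m)" using Suc by auto
  then obtain h where h: "poly_bounded h" "mono h" and Q: "\<And>\<rho> d. (\<forall>i<n. \<rho> i < d) \<Longrightarrow> (\<exists>P. \<forall>f s. (\<forall>i\<ge>d. s i = []) \<longrightarrow>
       runs f P s (h (env_size n (\<lambda>i. s (\<rho> i)))) (s(d := F m (\<lambda>i. s (\<rho> i)))))"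
    unfolding poly_time_def by blast
  have "\<exists>P. \<forall>f s. (\<forall>i\<ge>d. s i = []) \<longrightarrow>
       runs f P s (g (env_size n (\<lambda>i. s (\<rho> i))) + h (env_size n (\<lambda>i. s (\<rho> i))))
         (\<lambda>j. if d \<le> j \<and> j < d + Suc m then F (j - d) (\<lambda>i. s (\<rho> i)) else s j)"
    if \<rho>: "\<forall>i<n. \<rho> i < d" for \<rho> d
  proof -
    obtain P where P: "\<And>f s. (\<forall>i\<ge>d. s i = []) \<Longrightarrow>
       runs f P s (g (env_size n (\<lambda>i. s (\<rho> i))))
         (\<lambda>j. if d \<le> j \<and> j < d + m then F (j - d) (\<lambda>i. s (\<rho> i)) else s j)"
      using P[OF \<rho>] by meson
    have "\<forall>i<n. \<rho> i < d + m" using \<rho> by auto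
    from Q[OF this] obtain Q where Q: "\<And>f s. (\<forall>i\<ge>d+m. s i = []) \<Longrightarrow>
       runs f Q s (h (env_size n (\<lambda>i. s (\<rho> i)))) (s(d + m := F m (\<lambda>i. s (\<rho> i))))" by meson
    have "runs f (Seq P Q) s (g (env_size n (\<lambda>i. s (\<rho> i))) + h (env_size n (\<lambda>i. s (\<rho> i))))
         (\<lambda>j. if d \<le> j \<and> j < d + Suc m then F (j - d) (\<lambda>i. s (\<rho> i)) else s j)"
      if s: "\<forall>i\<ge>d. s i = []" for f s
    proof -
      let ?s = "\<lambda>j. if d \<le> j \<and> j < d + m then F (j - d) (\<lambda>i. s (\<rho> i)) else s j"
      have eq: "env_size n (\<lambda>i. ?s (\<rho> i)) = env_size n (\<lambda>i. s (\<rho> i))"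
        by (rule env_size_cong) (use \<rho> in auto)
      have eqF: "F m (\<lambda>i. ?s (\<rho> i)) = F m (\<lambda>i. s (\<rho> i))"
        by (rule pf_dep[OF \<open>poly_time n (F m)\<close>]) (use \<rho> in auto)
      have Q1: "runs f Q ?s (h (env_size n (\<lambda>i. s (\<rho> i)))) (?s(d + m := F m (\<lambda>i. s (\<rho> i))))"
        using Q[of ?s f] s unfolding eq eqF by simp
      have eqS: "?s(d + m := F m (\<lambda>i. s (\<rho> i))) = (\<lambda>j. if d \<le> j \<and> j < d + Suc m then F (j - d) (\<lambda>i. s (\<rho> i)) else s j)"
        by (auto simp: fun_eq_iff)
      from runs_Seq[OF P[OF s] Q1] show ?thesis unfolding eqS .
    qed
    then show ?thesis by blast
  qed
  moreover have "poly_bounded (\<lambda>x. g x + h x)" "mono (\<lambda>x. g x + h x)"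
    using g h by (auto intro!: pb_intros monoI add_mono dest: monoD)
  ultimately show ?case by (intro exI[of _ "\<lambda>x. g x + h x"] conjI allI impI)
qed

lemma runs_clear_range:
  "\<exists>P. \<forall>f s. runs f P s (1 + m + 2 * (\<Sum>i<m. length (s (d + i)))) (\<lambda>j. if d \<le> j \<and> j < d + m then [] else s j)"
proof (induction m)
  case 0
  have "runs f Skip s 1 (\<lambda>j. if d \<le> j \<and> j < d then [] else s j)" for f s
  proof -
    have "(\<lambda>j. if d \<le> j \<and> j < d then [] else s j) = s" by (auto simp: fun_eq_iff)
    then show ?thesis using runs_Skip[of f s] by simp
  qed
  then show ?case by auto
next
  case (Suc m)
  then obtain P where P: "\<And>f s. runs f P s (1 + m + 2 * (\<Sum>i<m. length (s (d + i)))) (\<lambda>j. if d \<le> j \<and> j < d + m then [] else s j)"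
    by meson
  have "runs f (Seq P (clear (d + m))) s (1 + Suc m + 2 * (\<Sum>i<Suc m. length (s (d + i)))) (\<lambda>j. if d \<le> j \<and> j < d + Suc m then [] else s j)" for f s
  proof -
    let ?s = "\<lambda>j. if d \<le> j \<and> j < d + m then [] else s j"
    have "?s(d + m := []) = (\<lambda>j. if d \<le> j \<and> j < d + Suc m then [] else s j)" by (auto simp: fun_eq_iff)
    then show ?thesis
      using runs_Seq[OF P[where s = s] runs_clear[of f "d + m" ?s]] by (auto elim!: runs_mono)
  qed
  then show ?case by blast
qed

lemma pf_comp:
  assumes G: "poly_time m G" and F: "\<And>i. i < m \<Longrightarrow> poly_time n (F i)"
  shows "poly_time n (\<lambda>e. G (\<lambda>i. F i e))"
proof -
  obtain g where g: "poly_bounded g" "mono g" and P: "\<And>\<rho> d. (\<forall>i<n. \<rho> i < d) \<Longrightarrow> (\<exists>P. \<forall>f s. (\<forall>i\<ge>d. s i = []) \<longrightarrow>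
       runs f P s (g (env_size n (\<lambda>i. s (\<rho> i))))
         (\<lambda>j. if d \<le> j \<and> j < d + m then F (j - d) (\<lambda>i. s (\<rho> i)) else s j))"
    using runs_args[of m n F] F by blast
  obtain h where h: "poly_bounded h" "mono h" and Q: "\<And>\<rho> d. (\<forall>i<m. \<rho> i < d) \<Longrightarrow> (\<exists>P. \<forall>f s. (\<forall>i\<ge>d. s i = []) \<longrightarrow>
       runs f P s (h (env_size m (\<lambda>i. s (\<rho> i)))) (s(d := G (\<lambda>i. s (\<rho> i)))))"
    using G unfolding poly_time_def by blast
  have "\<exists>h. poly_bounded h \<and> mono h \<and> (\<forall>e. env_size m (\<lambda>i. F i e) \<le> h (env_size n e))"
  proof -
    have "\<forall>i\<in>{..<m}. \<exists>h. poly_bounded h \<and> mono h \<and> (\<forall>e. length (F i e) \<le> h (env_size n e))"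
      using pf_size F by auto
    then obtain k where k: "\<And>i. i < m \<Longrightarrow> poly_bounded (k i) \<and> mono (k i) \<and> (\<forall>e. length (F i e) \<le> k i (env_size n e))"
      by (auto dest!: bchoice)
    then show ?thesis
      by (intro exI[of _ "\<lambda>x. \<Sum>i<m. k i x"])
        (auto intro!: pb_intros monoI sum_mono simp: env_size_def dest: monoD)
  qed
  then obtain k where k: "poly_bounded k" "mono k" "\<And>e. env_size m (\<lambda>i. F i e) \<le> k (env_size n e)" by blast
  obtain l where l: "poly_bounded l" "mono l" "\<And>e. length (G e) \<le> l (env_size m e)" using pf_size[OF G] by blast
  show ?thesis
  proof (rule pfI)
    show "poly_bounded (\<lambda>x. g x + (h (k x) + ((1 + m + 2 * k x) + (8 * l (k x) + 2))))"
      by (intro pb_intros g k pb_comp[OF h(1) k(1)] pb_comp[OF l(1) k(1)])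
    fix \<rho> d assume \<rho>: "\<And>i. i < n \<Longrightarrow> \<rho> i < (d::nat)"
    then obtain P where P: "\<And>f s. (\<forall>i\<ge>d. s i = []) \<Longrightarrow>
       runs f P s (g (env_size n (\<lambda>i. s (\<rho> i))))
         (\<lambda>j. if d \<le> j \<and> j < d + m then F (j - d) (\<lambda>i. s (\<rho> i)) else s j)"
      using P by meson
    \<comment> \<open>The value is computed in \<open>Suc (d + m)\<close> rather than
      \<open>d + m\<close>, so that its register differs from the target \<open>d\<close> even when
      \<open>m = 0\<close>; the final move needs two different registers.\<close>
    obtain Q where Q: "\<And>f s. (\<forall>i\<ge>Suc (d + m). s i = []) \<Longrightarrow>
       runs f Q s (h (env_size m (\<lambda>i. s (d + i)))) (s(Suc (d + m) := G (\<lambda>i. s (d + i))))"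
      using Q[of "\<lambda>i. d + i" "Suc (d + m)"] by auto
    obtain R where R: "\<And>f s. runs f R s (1 + m + 2 * (\<Sum>i<m. length (s (d + i)))) (\<lambda>j. if d \<le> j \<and> j < d + m then [] else s j)"
      using runs_clear_range by meson
    let ?M = "Seq (moveto (Suc (d + m)) (d + m + 2)) (moveto (d + m + 2) d)"
    have "runs f (Seq P (Seq Q (Seq R ?M))) s
       ((\<lambda>x. g x + (h (k x) + ((1 + m + 2 * k x) + (8 * l (k x) + 2)))) (env_size n (\<lambda>i. s (\<rho> i)))) (s(d := G (\<lambda>i. F i (\<lambda>i. s (\<rho> i)))))"
      if s: "\<forall>i\<ge>d. s i = []" for f s
    proof -
      let ?e = "\<lambda>i. s (\<rho> i)"
      let ?x = "env_size n ?e"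
      define s1 where "s1 = (\<lambda>j. if d \<le> j \<and> j < d + m then F (j - d) ?e else s j)"
      define s2 where "s2 = s1(Suc (d + m) := G (\<lambda>i. F i ?e))"
      define s3 where "s3 = (\<lambda>j. if d \<le> j \<and> j < d + m then [] else s2 j)"
      have 1: "runs f P s (g ?x) s1" unfolding s1_def using P[OF s] .
      have sz1: "env_size m (\<lambda>i. s1 (d + i)) = env_size m (\<lambda>i. F i ?e)"
        by (rule env_size_cong) (auto simp: s1_def)
      have G1: "G (\<lambda>i. s1 (d + i)) = G (\<lambda>i. F i ?e)"
        by (rule pf_dep[OF G]) (auto simp: s1_def)
      have 2: "runs f Q s1 (h (k ?x)) s2"
        unfolding s2_def G1[symmetric]
      proof (rule runs_mono[OF Q])
        show "\<forall>i\<ge>Suc (d + m). s1 i = []" using s by (simp add: s1_def)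
        show "h (env_size m (\<lambda>i. s1 (d + i))) \<le> h (k ?x)" unfolding sz1 by (rule monoD[OF h(2) k(3)])
      qed
      have 3: "runs f R s2 (1 + m + 2 * k ?x) s3"
        unfolding s3_def
      proof (rule runs_mono[OF R])
        have "(\<Sum>i<m. length (s2 (d + i))) = env_size m (\<lambda>i. F i ?e)"
          by (auto simp: s2_def s1_def env_size_def)
        then show "1 + m + 2 * (\<Sum>i<m. length (s2 (d + i))) \<le> 1 + m + 2 * k ?x" using k(3)[of ?e] by simp
      qed
      have "length (G (\<lambda>i. F i ?e)) \<le> l (k ?x)"
        using l(3) monoD[OF l(2) k(3)] order_trans by blast
      then have 4: "runs f ?M s3 (8 * l (k ?x) + 2) (s3(Suc (d + m) := [], d := s3 (Suc (d + m))))"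
        by (intro runs_mono[OF moveto_twice]) (use s in \<open>auto simp: s3_def s2_def s1_def\<close>)
      have "s3(Suc (d + m) := [], d := s3 (Suc (d + m))) = s(d := G (\<lambda>i. F i ?e))"
        using s by (auto simp: fun_eq_iff s3_def s2_def s1_def)
      from runs_Seq[OF 1 runs_Seq[OF 2 runs_Seq[OF 3 4[unfolded this]]]] show ?thesis by simp
    qed
    then show "\<exists>P. \<forall>f s. (\<forall>i\<ge>d. s i = []) \<longrightarrow>
       runs f P s ((\<lambda>x. g x + (h (k x) + ((1 + m + 2 * k x) + (8 * l (k x) + 2)))) (env_size n (\<lambda>i. s (\<rho> i)))) (s(d := G (\<lambda>i. F i (\<lambda>i. s (\<rho> i)))))"
      by blast
  qed (auto intro!: pf_dep[OF G] pf_dep[OF F])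
qed

definition lcase :: "bool list \<Rightarrow> 'a \<Rightarrow> 'a \<Rightarrow> 'a \<Rightarrow> 'a" where
  "lcase xs u v w = (case xs of [] \<Rightarrow> u | b # _ \<Rightarrow> if b then v else w)"

lemma lcase_simps [simp]: "lcase [] u v w = u" "lcase (True # xs) u v w = v" "lcase (False # xs) u v w = w"
  "lcase (b # xs) u v w = (if b then v else w)"
  by (auto simp: lcase_def)

lemma pf_lcase4: "poly_time 4 (\<lambda>e. lcase (e 0) (e 1) (e 2) (e 3))"
proof (rule pfI)
  show "poly_bounded (\<lambda>x. Suc (9 * x + 2))" by (intro pb_intros)
  fix \<rho> :: "nat \<Rightarrow> nat" and d assume \<rho>: "\<And>i. i < 4 \<Longrightarrow> \<rho> i < d"
  let ?P = "Branch (\<rho> 0) (copyto (\<rho> 1) d (Suc d)) (copyto (\<rho> 2) d (Suc d)) (copyto (\<rho> 3) d (Suc d))"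
  let ?F = "\<lambda>e. lcase (e (0::nat)) (e 1) (e 2) (e 3)"
  have "runs f ?P s (Suc (9 * env_size 4 (\<lambda>i. s (\<rho> i)) + 2)) (s(d := ?F (\<lambda>i. s (\<rho> i))))"
    if "\<forall>i\<ge>d. s i = []" for f s
  proof -
    have "runs f (copyto (\<rho> i) d (Suc d)) s (9 * env_size 4 (\<lambda>i. s (\<rho> i)) + 2) (s(d := s (\<rho> i)))" if "i < 4" for i
      by (rule runs_mono[OF runs_copyto])
        (use that \<rho>[OF that] \<open>\<forall>i\<ge>d. s i = []\<close> length_le_env_size[OF that, of "\<lambda>i. s (\<rho> i)"] in auto)
    then show ?thesis by (intro runs_Branch) (auto simp: lcase_def split: list.split)
  qed
  then show "\<exists>P. \<forall>f s. (\<forall>i\<ge>d. s i = []) \<longrightarrow> runs f P s (Suc (9 * env_size 4 (\<lambda>i. s (\<rho> i)) + 2)) (s(d := ?F (\<lambda>i. s (\<rho> i))))"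
    by blast
qed simp

lemma pf_lcase:
  assumes "poly_time n F" "poly_time n G0" "poly_time n G1" "poly_time n G2"
  shows "poly_time n (\<lambda>e. lcase (F e) (G0 e) (G1 e) (G2 e))"
  using pf_comp[OF pf_lcase4, of n "\<lambda>i. if i = 0 then F else if i = 1 then G0 else if i = 2 then G1 else G2"] assms
  by simp

text \<open>Bounded recursion on notation, the scheme of Cobham's description of polynomial time.
  The bound \<open>k\<close> on all values is essential: iterating a polynomial-time step may
  otherwise produce strings of exponential length.\<close>

lemma pf_rec:
  assumes A: "poly_time n A" and I: "poly_time n I" and B: "\<And>b. poly_time (n + 2) (B b)"
    and R0: "\<And>e. R e [] = I e"
    and R1: "\<And>e b xs. R e (b # xs) = B b (e(n := xs, Suc n := R e xs))"
    and k: "poly_bounded k" "\<And>e xs. length (R e xs) \<le> k (env_size n e + length xs)"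
  shows "poly_time n (\<lambda>e. R e (A e))"
proof -
  obtain g where g: "poly_bounded g" "mono g" and PA: "\<And>\<rho> d. (\<forall>i<n. \<rho> i < d) \<Longrightarrow> (\<exists>P. \<forall>f s. (\<forall>i\<ge>d. s i = []) \<longrightarrow>
       runs f P s (g (env_size n (\<lambda>i. s (\<rho> i)))) (s(d := A (\<lambda>i. s (\<rho> i)))))"
    using A unfolding poly_time_def by blast
  obtain h where h: "poly_bounded h" "mono h" and PI: "\<And>\<rho> d. (\<forall>i<n. \<rho> i < d) \<Longrightarrow> (\<exists>P. \<forall>f s. (\<forall>i\<ge>d. s i = []) \<longrightarrow>
       runs f P s (h (env_size n (\<lambda>i. s (\<rho> i)))) (s(d := I (\<lambda>i. s (\<rho> i)))))"
    using I unfolding poly_time_def by blast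
  have "\<exists>h. poly_bounded h \<and> mono h \<and> (\<forall>\<rho> d. (\<forall>i<n+2. \<rho> i < d) \<longrightarrow> (\<exists>P. \<forall>f s. (\<forall>i\<ge>d. s i = []) \<longrightarrow>
       runs f P s (h (env_size (n+2) (\<lambda>i. s (\<rho> i)))) (s(d := B b (\<lambda>i. s (\<rho> i))))))" for b
    using B[of b] unfolding poly_time_def by blast
  then obtain q where q: "\<And>b. poly_bounded (q b)" "\<And>b. mono (q b)" and PB: "\<And>b \<rho> d. (\<forall>i<n+2. \<rho> i < d) \<Longrightarrow> (\<exists>P. \<forall>f s. (\<forall>i\<ge>d. s i = []) \<longrightarrow>
       runs f P s (q b (env_size (n+2) (\<lambda>i. s (\<rho> i)))) (s(d := B b (\<lambda>i. s (\<rho> i)))))"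
    by metis
  obtain a where a: "poly_bounded a" "mono a" "\<And>e. length (A e) \<le> a (env_size n e)" using pf_size[OF A] by blast
  obtain k' where k': "poly_bounded k'" "mono k'" "\<And>x. k x \<le> k' x" using pb_obtain_mono[OF k(1)] by blast
  have len: "length (R e xs) \<le> k' (env_size n e + length xs)" for e xs
    using k(2) k'(3) order_trans by blast
  have dep: "R e xs = R e' xs" if "\<And>i. i < n \<Longrightarrow> e i = e' i" for e e' xs
  proof (induction xs)
    case Nil
    then show ?case using pf_dep[OF I that] by (simp add: R0)
  next
    case (Cons b xs)
    show ?case unfolding R1 Cons by (rule pf_dep[OF B]) (use that in auto)
  qed
  define T where "T y = 8 + (q True (y + k' y) + q False (y + k' y)) + 2 * k' y + 8 * k' y" for y
  have T: "poly_bounded T"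
    unfolding T_def by (intro pb_intros k' pb_comp[OF q(1)])
  have T': "mono T"
    unfolding T_def by (auto intro!: monoI add_mono mult_mono monoD[OF q(2)] monoD[OF k'(2)])
  define TT where "TT x = g x + ((1 + 4 * a x) + (h x + ((8 * k' x + 2) + ((1 + a x * T (x + a x)) + (1 + 2 * a x)))))" for x
  have TT: "poly_bounded TT" unfolding TT_def by (intro pb_intros g a h k' pb_comp[OF T])
  show ?thesis
  proof (rule pfI[OF _ TT])
    fix e e' :: "nat \<Rightarrow> bool list" assume "\<And>i. i < n \<Longrightarrow> e i = e' i"
    then show "R e (A e) = R e' (A e')" using pf_dep[OF A] dep by metis
  next
    fix \<rho> d assume \<rho>: "\<And>i. i < n \<Longrightarrow> \<rho> i < (d::nat)"
    then obtain PA where PA: "\<And>f s. (\<forall>i\<ge>d. s i = []) \<Longrightarrow>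
       runs f PA s (g (env_size n (\<lambda>i. s (\<rho> i)))) (s(d := A (\<lambda>i. s (\<rho> i))))" using PA by meson
    have \<rho>3: "\<forall>i<n. \<rho> i < d + 3" using \<rho> by fastforce
    then obtain PI where PI: "\<And>f s. (\<forall>i\<ge>d + 3. s i = []) \<Longrightarrow>
       runs f PI s (h (env_size n (\<lambda>i. s (\<rho> i)))) (s(d + 3 := I (\<lambda>i. s (\<rho> i))))" using PI by meson
    \<comment> \<open>Register layout: \<open>d\<close> holds the value at the processed suffix,
      \<open>d + 2\<close> that suffix, and \<open>d + 1\<close> the unread bits in reverse order,
      so that the last bit of the argument is consumed first.\<close>
    let ?\<rho> = "\<rho>(n := d + 2, Suc n := d)"
    have "\<forall>i<n+2. ?\<rho> i < d + 3" using \<rho>3 by (auto simp: less_Suc_eq)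
    from PB[OF this] have "\<exists>P. \<forall>f s. (\<forall>i\<ge>d + 3. s i = []) \<longrightarrow>
       runs f P s (q b (env_size (n+2) (\<lambda>i. s (?\<rho> i)))) (s(d + 3 := B b (\<lambda>i. s (?\<rho> i))))" for b .
    then obtain PB where PB: "\<And>b f s. (\<forall>i\<ge>d + 3. s i = []) \<Longrightarrow>
       runs f (PB b) s (q b (env_size (n+2) (\<lambda>i. s (?\<rho> i)))) (s(d + 3 := B b (\<lambda>i. s (?\<rho> i))))"
      by metis
    define MT where "MT = Seq (moveto (d + 3) (d + 4)) (moveto (d + 4) d)"
    define Body where "Body b = Seq (Pop (d + 1)) (Seq (PB b) (Seq (clear d) (Seq MT (Push (d + 2) b))))" for b
    define L where "L = While (d + 1) (Branch (d + 1) Skip (Body True) (Body False))"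
    have "runs f (Seq PA (Seq (moveto d (d + 1)) (Seq PI (Seq MT (Seq L (clear (d + 2))))))) s
       (TT (env_size n (\<lambda>i. s (\<rho> i)))) (s(d := R (\<lambda>i. s (\<rho> i)) (A (\<lambda>i. s (\<rho> i)))))"
      if s: "\<forall>i\<ge>d. s i = []" for f s
    proof -
      define e where "e = (\<lambda>i. s (\<rho> i))"
      define x where "x = env_size n e"
      define st where "st l suf = s(d := R e suf, d + 1 := l, d + 2 := suf)" for l suf
      have st_rho: "st l suf (\<rho> i) = e i" if "i < n" for l suf i
        using \<rho>[OF that] by (simp add: st_def e_def)
      have loop: "runs f L (st l suf) (1 + length l * T (x + a x)) (st [] (rev l @ suf))"
        if "length l + length suf \<le> a x" for l suf
        using that
      proof (induction l arbitrary: suf)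
        case Nil
        have "st [] suf (d + 1) = []" by (simp add: st_def)
        then show ?case unfolding L_def using runs_While_end by simp
      next
        case (Cons b l)
        let ?s0 = "st (b # l) suf"
        let ?s1 = "st l suf"
        let ?e = "e(n := suf, Suc n := R e suf)"
        let ?y = "x + a x"
        have Rlen: "length (R e suf) \<le> k' ?y" "length (R e (b # suf)) \<le> k' ?y"
          using Cons(2) len[of e suf] len[of e "b # suf"] monoD[OF k'(2), of "x + length suf" ?y]
            monoD[OF k'(2), of "x + length (b # suf)" ?y] unfolding x_def[symmetric] by auto
        have e_eq: "B b (\<lambda>i. ?s1 (?\<rho> i)) = R e (b # suf)"
          unfolding R1
        proof (rule pf_dep[OF B])
          fix i assume "i < n + 2"
          then consider "i < n" | "i = n" | "i = Suc n" by linarith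
          then show "?s1 (?\<rho> i) = ?e i" by cases (simp add: st_rho, simp_all add: st_def)
        qed
        have "env_size (n + 2) (\<lambda>i. ?s1 (?\<rho> i)) = env_size n (\<lambda>i. ?s1 (?\<rho> i)) + length suf + length (R e suf)"
          by (simp add: env_size_Suc) (simp add: st_def)
        also have "env_size n (\<lambda>i. ?s1 (?\<rho> i)) = x"
          unfolding x_def by (rule env_size_cong) (use st_rho in auto)
        finally have "env_size (n + 2) (\<lambda>i. ?s1 (?\<rho> i)) = x + length suf + length (R e suf)" .
        moreover have "length suf \<le> a x" using Cons(2) by simp
        ultimately have sz_eq: "env_size (n + 2) (\<lambda>i. ?s1 (?\<rho> i)) \<le> ?y + k' ?y"
          using Rlen(1) by linarith
        have "runs f (Pop (d + 1)) ?s0 1 ?s1"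
          using runs_Pop[of f "d + 1" ?s0] by (simp add: st_def fun_upd_twist)
        moreover have "runs f (PB b) ?s1 (q b (?y + k' ?y)) (?s1(d + 3 := R e (b # suf)))"
          unfolding e_eq[symmetric]
          by (rule runs_mono[OF PB]) (use s monoD[OF q(2) sz_eq] in \<open>auto simp: st_def\<close>)
        moreover have "runs f (clear d) (?s1(d + 3 := R e (b # suf))) (1 + 2 * k' ?y) (?s1(d + 3 := R e (b # suf), d := []))"
          by (rule runs_mono[OF runs_clear]) (use Rlen in \<open>auto simp: st_def\<close>)
        moreover have "runs f MT (?s1(d + 3 := R e (b # suf), d := [])) (8 * k' ?y + 2) (?s1(d := R e (b # suf)))"
        proof -
          let ?s2 = "?s1(d + 3 := R e (b # suf), d := [])"
          have "?s2(d + 3 := [], d := ?s2 (d + 3)) = ?s1(d := R e (b # suf))"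
            using s by (auto simp: fun_eq_iff st_def)
          moreover have "runs f MT ?s2 (8 * k' ?y + 2) (?s2(d + 3 := [], d := ?s2 (d + 3)))"
            unfolding MT_def
            by (rule runs_mono[OF moveto_twice]) (use Rlen s in \<open>auto simp: st_def\<close>)
          ultimately show ?thesis by simp
        qed
        moreover have "runs f (Push (d + 2) b) (?s1(d := R e (b # suf))) 1 (st l (b # suf))"
          using runs_Push[of f "d + 2" b "?s1(d := R e (b # suf))"] by (simp add: st_def fun_upd_twist)
        ultimately have "runs f (Body b) ?s0 (1 + (q b (?y + k' ?y) + ((1 + 2 * k' ?y) + ((8 * k' ?y + 2) + 1)))) (st l (b # suf))"
          unfolding Body_def by (intro runs_Seq)
        then have "runs f (Branch (d + 1) Skip (Body True) (Body False)) ?s0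
            (Suc (1 + (q b (?y + k' ?y) + ((1 + 2 * k' ?y) + ((8 * k' ?y + 2) + 1))))) (st l (b # suf))"
          by (intro runs_Branch) (cases b; simp add: st_def)
        moreover have "runs f L (st l (b # suf)) (1 + length l * T ?y) (st [] (rev l @ b # suf))"
          using Cons(1)[of "b # suf"] Cons(2) by simp
        moreover have "?s0 (d + 1) \<noteq> []" by (simp add: st_def)
        ultimately have "runs f L ?s0 (Suc (Suc (1 + (q b (?y + k' ?y) + ((1 + 2 * k' ?y) + ((8 * k' ?y + 2) + 1))))
           + (1 + length l * T ?y))) (st [] (rev l @ b # suf))"
          unfolding L_def by (intro runs_While_step)
        then have "runs f L ?s0 (1 + length (b # l) * T ?y) (st [] (rev l @ b # suf))"
          by (rule runs_mono) (cases b; simp add: T_def)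
        then show ?case by simp
      qed
      have Alen: "length (A e) \<le> a x" unfolding x_def by (rule a(3))
      have "runs f PA s (g x) (s(d := A e))"
        using PA[OF s, of f] by (simp add: e_def x_def)
      moreover have "runs f (moveto d (d + 1)) (s(d := A e)) (1 + 4 * a x) (s(d + 1 := rev (A e)))"
      proof -
        let ?s = "s(d := A e)"
        have "?s(d := [], d + 1 := rev (?s d) @ ?s (d + 1)) = s(d + 1 := rev (A e))"
          using s by (auto simp: fun_eq_iff)
        moreover have "runs f (moveto d (d + 1)) ?s (1 + 4 * a x) (?s(d := [], d + 1 := rev (?s d) @ ?s (d + 1)))"
          by (rule runs_mono[OF runs_moveto]) (use Alen in auto)
        ultimately show ?thesis by simp
      qed
      moreover have "runs f PI (s(d + 1 := rev (A e))) (h x) (s(d + 1 := rev (A e), d + 3 := I e))"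
      proof -
        let ?s = "s(d + 1 := rev (A e))"
        have r: "?s (\<rho> i) = e i" if "i < n" for i using \<rho>[OF that] by (simp add: e_def)
        have "env_size n (\<lambda>i. ?s (\<rho> i)) = x" unfolding x_def by (rule env_size_cong) (rule r)
        moreover have "I (\<lambda>i. ?s (\<rho> i)) = I e" by (rule pf_dep[OF I]) (rule r)
        ultimately show ?thesis using PI[of ?s f] s by simp
      qed
      moreover have "runs f MT (s(d + 1 := rev (A e), d + 3 := I e)) (8 * k' x + 2) (st (rev (A e)) [])"
      proof -
        let ?s2 = "s(d + 1 := rev (A e), d + 3 := I e)"
        have "?s2(d + 3 := [], d := ?s2 (d + 3)) = st (rev (A e)) []"
          using s by (auto simp: fun_eq_iff st_def R0)
        moreover have "length (I e) \<le> k' x" using len[of e "[]"] by (simp add: R0 x_def)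
        then have "runs f MT ?s2 (8 * k' x + 2) (?s2(d + 3 := [], d := ?s2 (d + 3)))"
          unfolding MT_def by (intro runs_mono[OF moveto_twice]) (use s in auto)
        ultimately show ?thesis by simp
      qed
      moreover have "runs f L (st (rev (A e)) []) (1 + a x * T (x + a x)) (st [] (A e))"
        using loop[of "rev (A e)" "[]"] Alen by (auto elim!: runs_mono)
      moreover have "runs f (clear (d + 2)) (st [] (A e)) (1 + 2 * a x) (s(d := R e (A e)))"
      proof -
        have "(st [] (A e))(d + 2 := []) = s(d := R e (A e))"
          using s by (auto simp: fun_eq_iff st_def)
        then show ?thesis using runs_clear[of f "d + 2" "st [] (A e)"] Alen
          by (auto elim!: runs_mono simp: st_def)
      qed
      ultimately show ?thesis unfolding TT_def e_def[symmetric] x_def[symmetric]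
        by (intro runs_Seq)
    qed
    then show "\<exists>P. \<forall>f s. (\<forall>i\<ge>d. s i = []) \<longrightarrow> runs f P s (TT (env_size n (\<lambda>i. s (\<rho> i))))
       (s(d := R (\<lambda>i. s (\<rho> i)) (A (\<lambda>i. s (\<rho> i)))))" by blast
  qed
qed

lemma pf1: "poly_time 1 (\<lambda>e. g (e 0)) \<Longrightarrow> poly_time n F \<Longrightarrow> poly_time n (\<lambda>e. g (F e))"
  using pf_comp[of 1 "\<lambda>e. g (e 0)" n "\<lambda>_. F"] by simp

lemma pf2: "poly_time 2 (\<lambda>e. g (e 0) (e 1)) \<Longrightarrow> poly_time n F0 \<Longrightarrow> poly_time n F1 \<Longrightarrow> poly_time n (\<lambda>e. g (F0 e) (F1 e))"
  using pf_comp[of 2 "\<lambda>e. g (e 0) (e 1)" n "\<lambda>i. if i = 0 then F0 else F1"] by simp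

lemma pf_const: "poly_time n (\<lambda>e. xs)"
  by (induction xs) (auto intro: pf_Nil pf_Cons)

text \<open>If the growth in each step is bounded in terms of the inputs alone, not of the value
  reached so far, the growths add up instead of compounding, and the total stays polynomial.\<close>

lemma pf_rec_grow:
  assumes A: "poly_time n A" and I: "poly_time n I" and B: "\<And>b. poly_time (n + 2) (B b)"
    and R0: "\<And>e. R e [] = I e"
    and R1: "\<And>e b xs. R e (b # xs) = B b (e(n := xs, Suc n := R e xs))"
    and k: "poly_bounded k" "\<And>e b xs. length (R e (b # xs)) \<le> length (R e xs) + k (env_size n e + length xs)"
  shows "poly_time n (\<lambda>e. R e (A e))"
proof -
  obtain h where h: "poly_bounded h" "mono h" "\<And>e. length (I e) \<le> h (env_size n e)" using pf_size[OF I] by blast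
  obtain k' where k': "poly_bounded k'" "mono k'" "\<And>x. k x \<le> k' x" using pb_obtain_mono[OF k(1)] by blast
  have "length (R e xs) \<le> h (env_size n e + length xs) + length xs * k' (env_size n e + length xs)" for e xs
  proof (induction xs)
    case Nil
    then show ?case by (simp add: R0 h)
  next
    case (Cons b xs)
    let ?y = "env_size n e + length xs" and ?z = "env_size n e + length (b # xs)"
    have "length (R e (b # xs)) \<le> (h ?y + length xs * k' ?y) + k' ?y"
      using k(2)[of e b xs] k'(3)[of ?y] Cons by linarith
    also have "\<dots> \<le> (h ?z + length xs * k' ?z) + k' ?z"
      by (intro add_mono mult_mono monoD[OF h(2)] monoD[OF k'(2)]) auto
    finally show ?case by simp
  qed
  also have "h (env_size n e + length xs) + length xs * k' (env_size n e + length xs)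
     \<le> h (env_size n e + length xs) + (env_size n e + length xs) * k' (env_size n e + length xs)" for e :: store and xs :: "bool list"
    by simp
  finally show ?thesis
    by (intro pf_rec[where k = "\<lambda>y. h y + y * k' y", OF A I B R0 R1]) (auto intro!: pb_intros h k')
qed

lemma pf_If: "poly_time n F \<Longrightarrow> poly_time n G \<Longrightarrow> poly_time n (\<lambda>e. if c then F e else G e)"
  by (cases c) auto

lemmas pf_basic = pf_var pf_Nil pf_Cons pf_tl pf_lcase pf_const pf_If

section \<open>String functions and loops in polynomial time\<close>

lemma pf_append:
  assumes "poly_time n F" "poly_time n G" shows "poly_time n (\<lambda>e. F e @ G e)"
proof (rule pf2[where g = append, OF _ assms])
  show "poly_time 2 (\<lambda>e. e 0 @ e 1)"
    by (rule pf_rec_grow[where n = 2 and A = "\<lambda>e. e 0" and R = "\<lambda>e xs. xs @ e 1" and I = "\<lambda>e. e 1"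
          and B = "\<lambda>b e. b # e 3" and k = "\<lambda>_. 1"])
      (auto intro!: pf_var pf_Cons pb_const simp: numeral_eq_Suc)
qed

definition to_unary :: "bool list \<Rightarrow> bool list" where
  "to_unary xs = replicate (length xs) True"

lemma pf_to_unary: assumes "poly_time n F" shows "poly_time n (\<lambda>e. to_unary (F e))"
proof (rule pf1[where g = to_unary, OF _ assms])
  show "poly_time 1 (\<lambda>e. to_unary (e 0))"
    by (rule pf_rec_grow[where n = 1 and A = "\<lambda>e. e 0" and R = "\<lambda>e xs. to_unary xs" and I = "\<lambda>e. []"
          and B = "\<lambda>b e. True # e 2" and k = "\<lambda>_. 1"])
      (auto intro!: pf_var pf_Cons pf_Nil pb_const simp: numeral_eq_Suc to_unary_def)
qed

lemma pf_takeWhile: assumes "poly_time n F" shows "poly_time n (\<lambda>e. takeWhile id (F e))"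
proof (rule pf1[where g = "takeWhile id", OF _ assms])
  show "poly_time 1 (\<lambda>e. takeWhile id (e 0))"
  proof (rule pf_rec_grow[where n = 1 and A = "\<lambda>e. e 0" and R = "\<lambda>e xs. takeWhile id xs" and I = "\<lambda>e. []"
          and B = "\<lambda>b e. if b then True # e 2 else []" and k = "\<lambda>_. 1"])
    show "poly_time (1 + 2) (\<lambda>e. if b then True # e 2 else [])" for b :: bool
      by (intro pf_basic) auto
  qed (auto intro: pf_basic pb_const simp: numeral_eq_Suc)
qed

lemma pf_dropWhile: assumes "poly_time n F" shows "poly_time n (\<lambda>e. dropWhile id (F e))"
proof (rule pf1[where g = "dropWhile id", OF _ assms])
  show "poly_time 1 (\<lambda>e. dropWhile id (e 0))"
  proof (rule pf_rec[where n = 1 and A = "\<lambda>e. e 0" and R = "\<lambda>e xs. dropWhile id xs" and I = "\<lambda>e. []"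
          and B = "\<lambda>b e. if b then e 2 else False # e 1" and k = "\<lambda>x. x"])
    show "poly_time (1 + 2) (\<lambda>e. if b then e 2 else False # e 1)" for b :: bool
      by (intro pf_basic) auto
  qed (auto intro: pf_basic pb_id simp: numeral_eq_Suc trans_le_add2 length_dropWhile_le)
qed

lemma pf_iter:
  assumes A: "poly_time n A" and I: "poly_time n I" and B: "poly_time (Suc n) B"
    and k: "poly_bounded k" "\<And>e. length (B e) \<le> length (e n) + k (env_size n e)"
  shows "poly_time n (\<lambda>e. ((\<lambda>r. B (e(n := r))) ^^ length (A e)) (I e))"
proof -
  obtain k' where k': "poly_bounded k'" "mono k'" "\<And>x. k x \<le> k' x" using pb_obtain_mono[OF k(1)] by blast
  show ?thesis
  proof (rule pf_rec_grow[where R = "\<lambda>e xs. ((\<lambda>r. B (e(n := r))) ^^ length xs) (I e)"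
      and B = "\<lambda>b e. B (\<lambda>i. e ((id(n := Suc n)) i))" and k = k', OF A I _ _ _ k'(1)])
    show "poly_time (n + 2) (\<lambda>e. B (\<lambda>i. e ((id(n := Suc n)) i)))" for b :: bool
      by (rule pf_rename[OF B]) auto
    fix e b and xs :: "bool list"
    let ?r = "((\<lambda>r. B (e(n := r))) ^^ length xs) (I e)"
    show "((\<lambda>r. B (e(n := r))) ^^ length (b # xs)) (I e) =
         B (\<lambda>i. (e(n := xs, Suc n := ?r)) ((id(n := Suc n)) i))"
      by simp (rule pf_dep[OF B], auto)
    have "env_size n (e(n := ?r)) = env_size n e" by (rule env_size_cong) auto
    then have "length (B (e(n := ?r))) \<le> length ?r + k' (env_size n e)"
      using k(2)[of "e(n := ?r)"] k'(3)[of "env_size n e"] by simp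
    also have "\<dots> \<le> length ?r + k' (env_size n e + length xs)"
      using monoD[OF k'(2)] by simp
    finally show "length (((\<lambda>r. B (e(n := r))) ^^ length (b # xs)) (I e)) \<le> length ?r + k' (env_size n e + length xs)"
      by simp
  qed simp
qed

text \<open>A counting loop. Only the length of \<open>A e\<close> matters; the suffix that the
  recursion offers to the body is turned into a unary loop counter by
  \<open>to_unary\<close>.\<close>

lemma pf_loop:
  assumes A: "poly_time n A" and I: "poly_time n I" and B: "poly_time (n + 2) B"
    and k: "poly_bounded k" "\<And>e. length (B e) \<le> length (e (Suc n)) + k (env_size (Suc n) e)"
  shows "poly_time n (\<lambda>e. rec_nat (I e) (\<lambda>i r. B (e(n := replicate i True, Suc n := r))) (length (A e)))"
proof (rule pf_rec_grow[where R = "\<lambda>e xs. rec_nat (I e) (\<lambda>i r. B (e(n := replicate i True, Suc n := r))) (length xs)"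
      and B = "\<lambda>b e. B (\<lambda>i. (\<lambda>e. if i = n then to_unary (e n) else e i) e)", OF A I _ _ _ k(1)])
  show "poly_time (n + 2) (\<lambda>e. B (\<lambda>i. (if i = n then to_unary (e n) else e i)))" for b :: bool
    by (rule pf_comp[OF B]) (auto intro!: pf_If pf_to_unary pf_var)
  fix e b and xs :: "bool list"
  let ?r = "\<lambda>xs. rec_nat (I e) (\<lambda>i r. B (e(n := replicate i True, Suc n := r))) (length xs)"
  show "?r (b # xs) = B (\<lambda>i. (\<lambda>e. if i = n then to_unary (e n) else e i) (e(n := xs, Suc n := ?r xs)))"
    by simp (rule pf_dep[OF B], auto simp: to_unary_def)
  have "env_size (Suc n) (e(n := to_unary xs, Suc n := ?r xs)) = env_size n e + length xs"
    by (auto simp: env_size_Suc to_unary_def intro!: env_size_cong)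
  then show "length (?r (b # xs)) \<le> length (?r xs) + k (env_size n e + length xs)"
    using k(2)[of "e(n := to_unary xs, Suc n := ?r xs)"] by (simp add: to_unary_def)
qed simp

text \<open>The loop that emits output of variable length. Each round appends a block that does not
  depend on the output so far, so the growth condition of \<open>pf_loop\<close> is met.\<close>

lemma pf_concat:
  assumes A: "poly_time n A" and W: "poly_time (Suc n) W"
  shows "poly_time n (\<lambda>e. concat (map (\<lambda>i. W (e(n := replicate i True))) [0..<length (A e)]))"
proof -
  obtain w where w: "poly_bounded w" "\<And>e. length (W e) \<le> w (env_size (Suc n) e)" using pf_size[OF W] by blast
  have "poly_time n (\<lambda>e. rec_nat [] (\<lambda>i r. (\<lambda>e. e (Suc n) @ W e) (e(n := replicate i True, Suc n := r))) (length (A e)))"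
  proof (rule pf_loop[OF A pf_Nil _ w(1)])
    show "poly_time (n + 2) (\<lambda>e. e (Suc n) @ W e)"
      by (intro pf_append pf_var) (use pf_rename[OF W, of id "n + 2"] in auto)
  qed (use w in auto)
  moreover have "rec_nat [] (\<lambda>i r. (\<lambda>e. e (Suc n) @ W e) (e(n := replicate i True, Suc n := r))) m =
     concat (map (\<lambda>i. W (e(n := replicate i True))) [0..<m])" for e m
    by (induction m) (auto intro!: pf_dep[OF W])
  ultimately show ?thesis by simp
qed

lemma pf_concat_const:
  assumes "\<And>x. x \<in> set L \<Longrightarrow> poly_time n (F x)"
  shows "poly_time n (\<lambda>e. concat (map (\<lambda>x. F x e) L))"
  using assms by (induction L) (auto intro!: pf_Nil pf_append)

lemma drop_Suc_tl: "drop (Suc c) ys = tl (drop c ys)"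
  by (simp add: drop_Suc tl_drop)

lemma pf_drop_const: "poly_time n F \<Longrightarrow> poly_time n (\<lambda>e. drop c (F e))"
  by (induction c) (simp_all add: drop_Suc_tl pf_tl)

lemma funpow_drop: "(drop c ^^ k) ys = drop (k * c) ys"
  by (induction k) (auto simp: add.commute)

lemma funpow_length_le:
  fixes g :: "'a list \<Rightarrow> 'a list"
  assumes "\<And>y. length (g y) \<le> length y"
  shows "length ((g ^^ k) y) \<le> length y"
proof (induction k)
  case (Suc k)
  then show ?case using assms[of "(g ^^ k) y"] by simp
qed simp

lemma pf_funpow:
  assumes "poly_time n A" "poly_time n F" "poly_time 1 (\<lambda>e. g (e 0))" "\<And>y. length (g y) \<le> length y"
  shows "poly_time n (\<lambda>e. (g ^^ length (A e)) (F e))"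
proof -
  have "poly_time (Suc n) (\<lambda>e. g (e n))" by (rule pf1[OF assms(3)]) (auto intro: pf_var)
  from pf_iter[OF assms(1,2) this pb_const[of 0]] show ?thesis using assms(4) by simp
qed

lemma pf_funpow_const: "poly_time 1 (\<lambda>e. g (e 0)) \<Longrightarrow> poly_time n F \<Longrightarrow> poly_time n (\<lambda>e. (g ^^ k) (F e))"
  by (induction k) (auto intro: pf1[of g])

lemma pf_drop:
  assumes "poly_time n A" "poly_time n F"
  shows "poly_time n (\<lambda>e. drop (length (A e)) (F e))"
proof -
  have "poly_time n (\<lambda>e. (drop 1 ^^ length (A e)) (F e))"
    by (rule pf_funpow[OF assms]) (auto intro!: pf_drop_const pf_var)
  then show ?thesis by (simp add: funpow_drop del: drop.simps)
qed

lemma pf_drop_mult: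
  assumes "poly_time n A" "poly_time n F"
  shows "poly_time n (\<lambda>e. drop (length (A e) * c) (F e))"
proof -
  have "poly_time n (\<lambda>e. (drop c ^^ length (A e)) (F e))"
    by (rule pf_funpow[OF assms]) (auto intro!: pf_drop_const pf_var)
  then show ?thesis by (simp add: funpow_drop)
qed

text \<open>The prefix is emitted bit by bit, each bit being read as the head of what
  \<open>drop\<close> leaves; past the end nothing is emitted.\<close>

lemma pf_take:
  assumes "poly_time n A" "poly_time n F"
  shows "poly_time n (\<lambda>e. take (length (A e)) (F e))"
proof (rule pf2[where g = "\<lambda>x y. take (length x) y", OF _ assms])
  have "poly_time 2 (\<lambda>e. concat (map (\<lambda>i. (\<lambda>e. (\<lambda>x. lcase x [] [True] [False]) (drop (length (e 2)) (e 1))) (e(2 := replicate i True))) [0..<length (e 0)]))"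
    by (rule pf_concat) (intro pf_basic pf_drop; simp)+
  moreover have "concat (map (\<lambda>i. lcase (drop i y) [] [True] [False]) [0..<k]) = take k y" for k and y :: "bool list"
  proof (induction k)
    case (Suc k)
    then show ?case by (cases "k < length y") (auto simp: take_Suc_conv_app_nth Cons_nth_drop_Suc[symmetric])
  qed simp
  ultimately show "poly_time 2 (\<lambda>e. take (length (e 0)) (e 1))" by simp
qed

section \<open>Codes and binary numbers\<close>

fun bits :: "nat \<Rightarrow> bool list" where
  "bits a = (if a = 0 then [] else odd a # bits (a div 2))"

declare bits.simps [simp del]

lemma bits_0 [simp]: "bits 0 = []" by (simp add: bits.simps)

definition code :: "bool list \<Rightarrow> bool list" where
  "code bs = concat (map (\<lambda>b. [True, b]) bs) @ [False]"

lemma enc_nat_code: "enc_nat a = code (bits a)"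
  by (induction a rule: bits.induct) (subst enc_nat.simps, subst bits.simps, auto simp: code_def)

fun val :: "bool list \<Rightarrow> nat" where
  "val [] = 0"
| "val (b # bs) = of_bool b + 2 * val bs"

lemma val_bits [simp]: "val (bits a) = a"
  by (induction a rule: bits.induct) (subst bits.simps, auto simp: odd_two_times_div_two_succ)

lemma bits_inject [simp]: "bits a = bits b \<longleftrightarrow> a = b"
  by (metis val_bits)

lemma length_bits: "a > 0 \<Longrightarrow> 2 ^ length (bits a) \<le> 2 * a \<and> a < 2 ^ length (bits a)"
proof (induction a rule: bits.induct)
  case (1 a)
  show ?case
  proof (cases "a div 2 = 0")
    case True
    then have "a = 1" using 1(2) by linarith
    then show ?thesis by (simp add: bits.simps)
  next
    case False
    then have "bits a = odd a # bits (a div 2)" by (subst bits.simps) simp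
    then show ?thesis using 1 False by simp linarith
  qed
qed

text \<open>Passes one marked digit \<open>[True, b]\<close> of a \<open>code\<close> and stays put
  on the terminator \<open>False\<close>. Iterating too often therefore does no harm, and the length
  of the whole string can serve as the number of iterations.\<close>

definition advance :: "bool list \<Rightarrow> bool list" where
  "advance y = lcase y y (tl (tl y)) y"

lemma pf_advance: "poly_time n F \<Longrightarrow> poly_time n (\<lambda>e. advance (F e))"
  unfolding advance_def by (intro pf_basic)

lemma length_advance: "length (advance y) \<le> length y"
  by (cases y) (auto simp: advance_def)

lemma advance_code: "(advance ^^ k) (code bs @ z) = code (drop k bs) @ z"
proof (induction k)
  case (Suc k)
  then show ?case
    by (cases "drop k bs") (auto simp: advance_def code_def drop_Suc tl_drop[symmetric])
qed simp

lemma pf_advance_pow: "poly_time n A \<Longrightarrow> poly_time n F \<Longrightarrow> poly_time n (\<lambda>e. (advance ^^ length (A e)) (F e))"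
  by (intro pf_funpow pf_advance pf_var length_advance) auto

definition skip :: "bool list \<Rightarrow> bool list" where
  "skip y = tl ((advance ^^ length y) y)"

lemma pf_skip: "poly_time n F \<Longrightarrow> poly_time n (\<lambda>e. skip (F e))"
  unfolding skip_def by (intro pf_tl pf_advance_pow)

lemma length_skip: "length (skip y) \<le> length y"
  using funpow_length_le[where g = advance and y = y and k = "length y", OF length_advance] unfolding skip_def by simp

lemma skip_code: "skip (code bs @ z) = z"
proof -
  have "length bs \<le> length (code bs @ z)" by (induction bs) (auto simp: code_def)
  then show ?thesis by (simp add: skip_def advance_code) (simp add: code_def)
qed

definition decode :: "bool list \<Rightarrow> bool list" where
  "decode y = concat (map (\<lambda>i. lcase ((advance ^^ i) y) [] (lcase (tl ((advance ^^ i) y)) [] [True] [False]) []) [0..<length y])"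

lemma pf_decode: assumes "poly_time n F" shows "poly_time n (\<lambda>e. decode (F e))"
proof (rule pf1[where g = decode, OF _ assms])
  have "poly_time 1 (\<lambda>e. concat (map (\<lambda>i. (\<lambda>e. lcase ((advance ^^ length (e 1)) (e 0)) [] (lcase (tl ((advance ^^ length (e 1)) (e 0))) [] [True] [False]) [])
      (e(1 := replicate i True))) [0..<length (e 0)]))"
    by (rule pf_concat) (intro pf_basic pf_advance_pow; simp)+
  then show "poly_time 1 (\<lambda>e. decode (e 0))" by (simp add: decode_def)
qed

lemma decode_code: "decode (code bs @ z) = bs"
proof -
  let ?h = "\<lambda>i. lcase (code (drop i bs) @ z) [] (lcase (tl (code (drop i bs) @ z)) [] [True] [False]) []"
  have len: "length bs \<le> length (code bs @ z)" by (induction bs) (auto simp: code_def)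
  have 1: "?h i = [bs ! i]" if "i < length bs" for i
    using that by (auto simp: Cons_nth_drop_Suc[symmetric] code_def)
  have 2: "?h i = []" if "i \<ge> length bs" for i
    using that by (auto simp: code_def)
  have "concat (map ?h [0..<length bs]) = concat (map (\<lambda>i. [bs ! i]) [0..<length bs])"
    by (intro arg_cong[where f = concat] map_cong) (use 1 in auto)
  also have "\<dots> = bs" using map_nth[of bs] by (simp add: concat_map_singleton)
  finally have "concat (map ?h [0..<length bs + k]) = bs" for k
    by (induction k) (use 2 in auto)
  from this[of "length (code bs @ z) - length bs"] len show ?thesis
    unfolding decode_def advance_code by simp
qed

section \<open>Binary increment, equality test and comparison with powers of two\<close>

fun increment :: "bool list \<Rightarrow> bool list" where
  "increment [] = [True]"
| "increment (b # xs) = (if b then False # increment xs else True # xs)"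

lemma length_increment: "length (increment xs) \<le> Suc (length xs)" by (induction xs) auto

lemma pf_increment: assumes "poly_time n F" shows "poly_time n (\<lambda>e. increment (F e))"
proof (rule pf1[where g = increment, OF _ assms])
  show "poly_time 1 (\<lambda>e. increment (e 0))"
  proof (rule pf_rec[where n = 1 and A = "\<lambda>e. e 0" and R = "\<lambda>e xs. increment xs" and I = "\<lambda>e. [True]"
          and B = "\<lambda>b e. if b then False # e 2 else True # e 1" and k = Suc])
    show "poly_time (1 + 2) (\<lambda>e. if b then False # e 2 else True # e 1)" for b :: bool
      by (intro pf_basic) auto
    show "length (increment xs) \<le> Suc (env_size 1 e + length xs)" for e xs using length_increment[of xs] by simp
  qed (auto intro: pf_basic pb_intros simp: numeral_eq_Suc)
qed

lemma val_increment [simp]: "val (increment xs) = Suc (val xs)"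
  by (induction xs) auto

lemma increment_bits: "increment (bits a) = bits (Suc a)"
proof (induction a rule: bits.induct)
  case (1 a)
  show ?case
  proof (cases "a = 0")
    case True then show ?thesis by (simp add: bits.simps)
  next
    case False
    then have "bits a = odd a # bits (a div 2)" "bits (Suc a) = even a # bits (Suc a div 2)"
      by (subst bits.simps; simp)+
    then show ?thesis using 1 False by auto
  qed
qed

definition unary_to_bits :: "bool list \<Rightarrow> bool list" where
  "unary_to_bits u = (increment ^^ length u) []"

lemma unary_to_bits: "unary_to_bits u = bits (length u)"
proof -
  have "(increment ^^ k) [] = bits k" for k by (induction k) (auto simp: increment_bits)
  then show ?thesis by (simp add: unary_to_bits_def)
qed

lemma pf_unary_to_bits: assumes "poly_time n F" shows "poly_time n (\<lambda>e. unary_to_bits (F e))"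
proof (rule pf1[where g = unary_to_bits, OF _ assms])
  have "poly_time 2 (\<lambda>e. increment (e 1))" by (intro pf_increment pf_var) simp
  from pf_iter[OF _ _ this[folded Suc_1] pb_const[of 1], of "\<lambda>e. e 0" "\<lambda>e. []"]
  show "poly_time 1 (\<lambda>e. unary_to_bits (e 0))" unfolding unary_to_bits_def by (auto intro: pf_basic simp: length_increment)
qed

text \<open>The recursion sees only suffixes of \<open>X\<close>. The matching position in
  \<open>Y\<close> is recovered from lengths: dropping as many bits from \<open>X\<close> as the
  suffix has leaves a string as long as the prefix already passed.\<close>

fun eq_suffix :: "bool list \<Rightarrow> bool list \<Rightarrow> bool list \<Rightarrow> bool list" where
  "eq_suffix X Y [] = lcase (drop (length X) Y) [True] [] []"
| "eq_suffix X Y (b # xs) = (let z = drop (length (drop (length (b # xs)) X)) Y in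
     lcase z [] (if b then eq_suffix X Y xs else []) (if b then [] else eq_suffix X Y xs))"

lemma eq_suffix: "X = p @ xs \<Longrightarrow> eq_suffix X Y xs = (if drop (length p) Y = xs then [True] else [])"
proof (induction xs arbitrary: p)
  case Nil
  then show ?case by (cases "drop (length X) Y") auto
next
  case (Cons b xs)
  then have "eq_suffix X Y xs = (if drop (length (p @ [b])) Y = xs then [True] else [])" by simp
  moreover have "drop (length (p @ [b])) Y = tl (drop (length p) Y)" by (simp add: drop_Suc_tl)
  moreover have "length (drop (length (b # xs)) X) = length p" using Cons(2) by simp
  ultimately show ?case unfolding eq_suffix.simps by (cases "drop (length p) Y") (auto simp: Let_def)
qed

lemma length_eq_suffix_Cons: "length (eq_suffix X Y (b # xs)) \<le> length (eq_suffix X Y xs)"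
  by (auto simp: Let_def lcase_def split: list.split)

lemma pf_eq_suffix: "poly_time 2 (\<lambda>e. eq_suffix (e 0) (e 1) (e 0))"
proof (rule pf_rec_grow[where n = 2 and A = "\<lambda>e. e 0" and R = "\<lambda>e xs. eq_suffix (e 0) (e 1) xs"
      and I = "\<lambda>e. lcase (drop (length (e 0)) (e 1)) [True] [] []" and k = "\<lambda>_. 0"
      and B = "\<lambda>b e. lcase (drop (length (drop (length (b # e 2)) (e 0))) (e 1)) [] (if b then e 3 else []) (if b then [] else e 3)"])
  show "poly_time (2 + 2) (\<lambda>e. lcase (drop (length (drop (length (b # e 2)) (e 0))) (e 1)) [] (if b then e 3 else []) (if b then [] else e 3))" for b
    by (intro pf_basic pf_drop) auto
  show "length (eq_suffix (e 0) (e 1) (b # xs)) \<le> length (eq_suffix (e 0) (e 1) xs) + 0" for e b xs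
    using length_eq_suffix_Cons by simp
qed (auto intro!: pf_basic pf_drop pb_const simp: numeral_eq_Suc Let_def)

lemma pf_If_eq:
  assumes "poly_time n F" "poly_time n G" "poly_time n H" "poly_time n K"
  shows "poly_time n (\<lambda>e. if F e = G e then H e else K e)"
proof -
  have "poly_time n (\<lambda>e. lcase (eq_suffix (F e) (G e) (F e)) (K e) (H e) (H e))"
    by (rule pf_lcase[OF pf2[of "\<lambda>x y. eq_suffix x y x", OF pf_eq_suffix assms(1,2)] assms(4,3,3)])
  then show ?thesis by (simp add: eq_suffix[of _ "[]"] if_distrib[of "\<lambda>x. lcase x _ _ _"] eq_commute cong: if_cong)
qed

lemma pf_replicate_False: assumes "poly_time n F" shows "poly_time n (\<lambda>e. replicate (length (F e)) False)"
proof (rule pf1[where g = "\<lambda>x. replicate (length x) False", OF _ assms])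
  show "poly_time 1 (\<lambda>e. replicate (length (e 0)) False)"
    by (rule pf_rec_grow[where n = 1 and A = "\<lambda>e. e 0" and R = "\<lambda>e xs. replicate (length xs) False" and I = "\<lambda>e. []"
          and B = "\<lambda>b e. False # e 2" and k = "\<lambda>_. 1"])
      (auto intro!: pf_var pf_Cons pf_Nil pb_const simp: numeral_eq_Suc)
qed

text \<open>All numbers that have to be summed are powers of two. Adding \<open>2 ^ length k\<close>
  is an increment above the low \<open>length k\<close> bits, after padding with zeros if the
  accumulator is too short.\<close>

definition add_pow :: "bool list \<Rightarrow> bool list \<Rightarrow> bool list" where
  "add_pow k acc = (let acc' = acc @ replicate (length (drop (length acc) k)) False in
     take (length k) acc' @ increment (drop (length k) acc'))"

lemma pf_add_pow: "poly_time n F \<Longrightarrow> poly_time n G \<Longrightarrow> poly_time n (\<lambda>e. add_pow (F e) (G e))"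
  unfolding add_pow_def Let_def
  by (intro pf_append pf_take pf_increment pf_drop pf_replicate_False)

lemma length_add_pow: "length (add_pow k acc) \<le> length acc + length k + 1"
  using length_increment[of "drop (length k) (acc @ replicate (length k - length acc) False)"]
  by (auto simp: add_pow_def Let_def)

lemma val_append: "val (xs @ ys) = val xs + 2 ^ length xs * val ys"
  by (induction xs) auto

lemma val_replicate_False [simp]: "val (replicate k False) = 0"
  by (induction k) auto

lemma val_take_drop: "val xs = val (take k xs) + 2 ^ min (length xs) k * val (drop k xs)"
  by (metis append_take_drop_id length_take val_append)

lemma val_add_pow: "val (add_pow k acc) = val acc + 2 ^ length k"
proof -
  define acc' where "acc' = acc @ replicate (length k - length acc) False"
  have l: "length k \<le> length acc'" by (simp add: acc'_def)
  have "val (add_pow k acc) = val (take (length k) acc') + 2 ^ length k * Suc (val (drop (length k) acc'))"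
    using l by (simp add: add_pow_def Let_def val_append acc'_def[symmetric])
  also have "val acc' = val (take (length k) acc') + 2 ^ length k * val (drop (length k) acc')"
    using val_take_drop[of acc' "length k"] l by (simp only: min.absorb2)
  then have "val (take (length k) acc') + 2 ^ length k * Suc (val (drop (length k) acc')) = val acc' + 2 ^ length k"
    by simp
  finally show ?thesis by (simp add: acc'_def val_append)
qed

lemma val_less: "val xs < 2 ^ length xs"
  by (induction xs) (auto simp: of_bool_def)

lemma val_eq_0: "val xs = 0 \<longleftrightarrow> True \<notin> set xs"
  by (induction xs) auto

definition has_True :: "bool list \<Rightarrow> bool list" where
  "has_True xs = (if True \<in> set xs then [True] else [])"

lemma pf_has_True: assumes "poly_time n F" shows "poly_time n (\<lambda>e. has_True (F e))"
proof (rule pf1[where g = has_True, OF _ assms])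
  show "poly_time 1 (\<lambda>e. has_True (e 0))"
  proof (rule pf_rec[where n = 1 and A = "\<lambda>e. e 0" and R = "\<lambda>e xs. has_True xs" and I = "\<lambda>e. []"
          and B = "\<lambda>b e. if b then [True] else e 2" and k = "\<lambda>_. 1"])
    show "poly_time (1 + 2) (\<lambda>e. if b then [True] else e 2)" for b :: bool
      by (intro pf_basic) auto
  qed (auto intro: pf_basic pb_intros simp: numeral_eq_Suc has_True_def)
qed

text \<open>The threshold is a power of two as well, so the comparison only asks for a set bit at
  position \<open>k\<close> or higher.\<close>

lemma ge_pow_iff: "2 ^ k \<le> val xs \<longleftrightarrow> True \<in> set (drop k xs)"
proof (cases "k \<le> length xs")
  case True
  have "val (take k xs) < 2 ^ k" using val_less[of "take k xs"] True by (simp add: min.absorb2)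
  moreover have "val xs = val (take k xs) + 2 ^ k * val (drop k xs)"
    using val_take_drop[of xs k] True by (simp only: min.absorb2)
  ultimately have "2 ^ k \<le> val xs \<longleftrightarrow> val (drop k xs) > 0"
    by (cases "val (drop k xs)") auto
  then show ?thesis using val_eq_0[of "drop k xs"] by auto
next
  case False
  then have "2 ^ length xs \<le> (2 :: nat) ^ k" by (intro power_increasing) auto
  then have "val xs < 2 ^ k" using val_less[of xs] by linarith
  then show ?thesis using False by auto
qed

fun pow_code :: "bool list \<Rightarrow> bool list" where
  "pow_code [] = [True, True, False]"
| "pow_code (b # xs) = True # False # pow_code xs"

lemma pow_code: "pow_code xs = enc_nat (2 ^ length xs)"
proof (induction xs)
  case Nil
  show ?case by (simp add: enc_nat.simps)
next
  case (Cons b xs)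
  then show ?case by (subst enc_nat.simps) simp
qed

lemma pf_pow_code: assumes "poly_time n F" shows "poly_time n (\<lambda>e. pow_code (F e))"
proof (rule pf1[where g = pow_code, OF _ assms])
  show "poly_time 1 (\<lambda>e. pow_code (e 0))"
    by (rule pf_rec_grow[where n = 1 and A = "\<lambda>e. e 0" and R = "\<lambda>e xs. pow_code xs" and I = "\<lambda>e. [True, True, False]"
          and B = "\<lambda>b e. True # False # e 2" and k = "\<lambda>_. 2"])
      (auto intro!: pf_var pf_Cons pf_Nil pb_const simp: numeral_eq_Suc)
qed

section \<open>Turing reductions\<close>

fun reg_bound :: "prog \<Rightarrow> nat" where
  "reg_bound Skip = 0"
| "reg_bound (Push r b) = Suc r"
| "reg_bound (Pop r) = Suc r"
| "reg_bound (Query r r') = max (Suc r) (Suc r')"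
| "reg_bound (Seq P Q) = max (reg_bound P) (reg_bound Q)"
| "reg_bound (Branch r P Q R) = max (Suc r) (max (reg_bound P) (max (reg_bound Q) (reg_bound R)))"
| "reg_bound (While r P) = max (Suc r) (reg_bound P)"

fun subst_query :: "(nat \<Rightarrow> nat \<Rightarrow> prog) \<Rightarrow> prog \<Rightarrow> prog" where
  "subst_query q (Query r r') = q r r'"
| "subst_query q (Seq P Q) = Seq (subst_query q P) (subst_query q Q)"
| "subst_query q (Branch r P Q R) = Branch r (subst_query q P) (subst_query q Q) (subst_query q R)"
| "subst_query q (While r P) = While r (subst_query q P)"
| "subst_query q P = P"

lemma exec_length_le: "exec f P s t s' \<Longrightarrow> \<forall>x. length (f x) \<le> 1 \<Longrightarrow> length (s' r) \<le> length (s r) + t"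
proof (induction rule: exec.induct)
  case (Query r1 r' s)
  then have "length (f (s r1)) \<le> 1" by blast
  then show ?case by simp
qed auto

text \<open>The simulating store \<open>u\<close> agrees with \<open>s\<close> below
  \<open>K\<close>, while register \<open>K\<close> may keep garbage: the unread rest of an oracle
  answer, which can be too long to be erased in polynomial time. Since the answers of
  \<open>h\<close> have at most one bit, no register of the simulated run exceeds \<open>T\<close>,
  so each step is simulated at cost \<open>g (2 * T)\<close>.\<close>

lemma exec_subst_query:
  assumes q: "\<And>r r' s. r < K \<Longrightarrow> r' < K \<Longrightarrow> (\<forall>i>K. s i = []) \<Longrightarrow>
      \<exists>z. runs f (q r r') s (g (length (s r) + length (s r'))) (s(r' := h (s r), K := z))"
    and g: "mono g" "g (2 * T) \<ge> 1"
    and h: "\<forall>x. length (h x) \<le> 1"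
    and "exec h P s t s'" "reg_bound P \<le> K" "\<And>i. i < K \<Longrightarrow> u i = s i" "\<And>i. i > K \<Longrightarrow> u i = []"
    "\<And>i. length (s i) + t \<le> T"
  shows "\<exists>u'. runs f (subst_query q P) u (t * g (2 * T)) u' \<and> (\<forall>i<K. u' i = s' i) \<and> (\<forall>i>K. u' i = [])"
  using assms(5-)
proof (induction arbitrary: u rule: exec.induct)
  case (Skip s)
  then show ?case using g(2) by (auto intro!: exI[of _ u] runs_mono[OF runs_Skip])
next
  case (Push r b s)
  have "runs f (subst_query q (Push r b)) u (1 * g (2 * T)) (u(r := b # u r))"
    unfolding subst_query.simps by (rule runs_mono[OF runs_Push]) (use g(2) in simp)
  moreover have "(u(r := b # u r)) i = (s(r := b # s r)) i" if "i < K" for i using Push that by auto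
  moreover have "(u(r := b # u r)) i = []" if "i > K" for i using Push that by auto
  ultimately show ?case by blast
next
  case (Pop r s)
  have "runs f (subst_query q (Pop r)) u (1 * g (2 * T)) (u(r := tl (u r)))"
    unfolding subst_query.simps by (rule runs_mono[OF runs_Pop]) (use g(2) in simp)
  moreover have "(u(r := tl (u r))) i = (s(r := tl (s r))) i" if "i < K" for i using Pop that by auto
  moreover have "(u(r := tl (u r))) i = []" if "i > K" for i using Pop that by auto
  ultimately show ?case by blast
next
  case (Query r r' s)
  then have r: "r < K" "r' < K" by auto
  obtain z where z: "runs f (q r r') u (g (length (u r) + length (u r'))) (u(r' := h (u r), K := z))"
    using q[OF r, of u] Query by blast
  have "length (s r) \<le> T" "length (s r') \<le> T" using Query(4)[of r] Query(4)[of r'] by auto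
  then have "g (length (u r) + length (u r')) \<le> g (2 * T)"
    using Query(2)[OF r(1)] Query(2)[OF r(2)] by (intro monoD[OF g(1)]) simp
  also have "\<dots> \<le> Suc (length (s r)) * g (2 * T)" by simp
  finally have "runs f (subst_query q (Query r r')) u (Suc (length (s r)) * g (2 * T)) (u(r' := h (u r), K := z))"
    using z by (auto elim: runs_mono simp del: fun_upd_apply)
  moreover have "(u(r' := h (u r), K := z)) i = (s(r' := h (s r))) i" if "i < K" for i using Query r that by auto
  moreover have "(u(r' := h (u r), K := z)) i = []" if "i > K" for i using Query r that by auto
  ultimately show ?case by blast
next
  case (Seq P s t s' Q t' s'')
  have 1: "length (s i) + t \<le> T" for i using Seq.prems(4)[of i] by simp
  have 2: "length (s' i) + t' \<le> T" for i
    using Seq.prems(4)[of i] exec_length_le[OF Seq.hyps(1) h, of i] by simp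
  obtain u' where u': "runs f (subst_query q P) u (t * g (2 * T)) u'" "\<forall>i<K. u' i = s' i" "\<forall>i>K. u' i = []"
    using Seq.IH(1)[of u] Seq.prems 1 by auto
  obtain u'' where u'': "runs f (subst_query q Q) u' (t' * g (2 * T)) u''" "\<forall>i<K. u'' i = s'' i" "\<forall>i>K. u'' i = []"
    using Seq.IH(2)[of u'] Seq.prems 2 u' by auto
  show ?case using runs_Seq[OF u'(1) u''(1)] u'' by (auto simp: add_mult_distrib)
next
  case (Branch s r P Q R t s')
  have 1: "length (s i) + t \<le> T" for i using Branch.prems(4)[of i] by simp
  have r: "u r = s r" using Branch.prems by auto
  let ?C = "case s r of [] \<Rightarrow> P | b # _ \<Rightarrow> if b then Q else R"
  have "reg_bound ?C \<le> K" using Branch.prems by (auto split: list.split)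
  then obtain u' where u': "runs f (subst_query q ?C) u (t * g (2 * T)) u'" "\<forall>i<K. u' i = s' i" "\<forall>i>K. u' i = []"
    using Branch.IH[of u] Branch.prems 1 by auto
  have "subst_query q ?C = (case u r of [] \<Rightarrow> subst_query q P | b # _ \<Rightarrow> if b then subst_query q Q else subst_query q R)"
    unfolding r by (auto split: list.split)
  with u'(1) have "runs f (subst_query q (Branch r P Q R)) u (Suc (t * g (2 * T))) u'"
    by (auto intro: runs_Branch)
  then have "runs f (subst_query q (Branch r P Q R)) u (Suc t * g (2 * T)) u'"
    by (rule runs_mono) (use g(2) in simp)
  then show ?case using u' by blast
next
  case (While_end s r P)
  then have "u r = []" by auto
  then show ?case using g(2) While_end
    by (auto intro!: exI[of _ u] runs_mono[OF runs_While_end])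
next
  case (While_step s r P t s' t' s'')
  have 1: "length (s i) + t \<le> T" for i using While_step.prems(4)[of i] by simp
  have 2: "length (s' i) + t' \<le> T" for i
    using While_step.prems(4)[of i] exec_length_le[OF While_step.hyps(2) h, of i] by simp
  obtain u' where u': "runs f (subst_query q P) u (t * g (2 * T)) u'" "\<forall>i<K. u' i = s' i" "\<forall>i>K. u' i = []"
    using While_step.IH(1)[of u] While_step.prems 1 by auto
  obtain u'' where u'': "runs f (subst_query q (While r P)) u' (t' * g (2 * T)) u''" "\<forall>i<K. u'' i = s'' i" "\<forall>i>K. u'' i = []"
    using While_step.IH(2)[of u'] While_step.prems 2 u' by auto
  have "u r \<noteq> []" using While_step by auto
  from runs_While_step[where P = "subst_query q P", OF this u'(1) u''(1)[simplified]]
  have "runs f (subst_query q (While r P)) u (Suc (t + t') * g (2 * T)) u''"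
    using g(2) by (auto elim!: runs_mono simp: add_mult_distrib)
  then show ?case using u'' by blast
qed

text \<open>Answers are truncated because the oracle may answer meaningless queries by arbitrarily long strings.\<close>

definition oracle_iter ::
  "(bool list \<Rightarrow> bool list \<Rightarrow> bool list) \<Rightarrow> (bool list \<Rightarrow> bool list) \<Rightarrow> (bool list \<Rightarrow> bool list \<Rightarrow> bool list \<Rightarrow> bool list) \<Rightarrow>
   (bool list \<Rightarrow> bool list \<Rightarrow> bool list) \<Rightarrow> (bool list \<Rightarrow> bool list) \<Rightarrow> bool list \<Rightarrow> bool list" where
  "oracle_iter build cnt upd out f X =
     out X (((\<lambda>R. upd X R (take (length (build X R)) (f (build X R)))) ^^ length (cnt X)) [])"

text \<open>The query string acts as a clock: one bit of the answer is read per bit of the query.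
  The time therefore does not depend on the length of the answer, whose rest stays in
  \<open>a\<close>.\<close>

lemma runs_take_answer:
  assumes "a \<noteq> q" "a \<noteq> d" "q \<noteq> d"
  shows "runs f (While q (Seq (Pop q) (Branch a Skip (Seq (Push d True) (Pop a)) (Seq (Push d False) (Pop a))))) s
    (1 + 5 * length (s q)) (s(q := [], d := rev (take (length (s q)) (s a)) @ s d, a := drop (length (s q)) (s a)))"
proof (induction "s q" arbitrary: s)
  case Nil
  have eq: "s(q := [], d := rev (take (length (s q)) (s a)) @ s d, a := drop (length (s q)) (s a)) = s"
    using Nil by (auto simp: fun_eq_iff)
  show ?case unfolding eq by (rule runs_mono[OF runs_While_end]) (use Nil in auto)
next
  case (Cons c cs)
  let ?B = "Branch a Skip (Seq (Push d True) (Pop a)) (Seq (Push d False) (Pop a))"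
  let ?s1 = "s(q := cs)"
  let ?s2 = "?s1(d := rev (take 1 (s a)) @ s d, a := tl (s a))"
  have "runs f (Pop q) s 1 ?s1" using runs_Pop[of f q s] Cons(2)[symmetric] by simp
  moreover have "runs f ?B ?s1 3 ?s2"
  proof (cases "s a")
    case Nil
    then have "?s2 = ?s1" using assms by (auto simp: fun_eq_iff)
    then show ?thesis using Nil assms runs_Branch[where f = f and s = ?s1 and r = a and P = Skip and Q = "Seq (Push d True) (Pop a)"
        and R = "Seq (Push d False) (Pop a)" and t = 1 and s' = ?s1] runs_Skip[of f ?s1]
      by (auto elim!: runs_mono)
  next
    case (Cons x xs)
    have "runs f (Seq (Push d x) (Pop a)) ?s1 2 ?s2"
      using runs_Seq[OF runs_Push[of f d x ?s1] runs_Pop[of f a]] Cons assms by (simp add: numeral_2_eq_2)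
    then show ?thesis using Cons assms
      by (auto simp: eval_nat_numeral intro!: runs_Branch split: if_splits)
  qed
  ultimately have body: "runs f (Seq (Pop q) ?B) s (1 + 3) ?s2" by (rule runs_Seq)
  have rest: "runs f (While q (Seq (Pop q) ?B)) ?s2 (1 + 5 * length (?s2 q))
      (?s2(q := [], d := rev (take (length (?s2 q)) (?s2 a)) @ ?s2 d, a := drop (length (?s2 q)) (?s2 a)))"
    by (rule Cons(1)) (use assms in auto)
  have ne: "s q \<noteq> []" using Cons(2) by auto
  have eq: "?s2(q := [], d := rev (take (length (?s2 q)) (?s2 a)) @ ?s2 d, a := drop (length (?s2 q)) (?s2 a))
     = s(q := [], d := rev (take (length (s q)) (s a)) @ s d, a := drop (length (s q)) (s a))"
    using assms Cons(2)[symmetric] by (cases "s a") (auto simp: fun_eq_iff)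
  from runs_While_step[where P = "Seq (Pop q) ?B", OF ne body rest[unfolded eq]]
  show ?case by (rule runs_mono) (use Cons(2)[symmetric] assms in simp)
qed

lemma env_size_numeral: "env_size 1 e = length (e 0)" "env_size 2 e = length (e 0) + length (e 1)"
  "env_size 3 e = length (e 0) + length (e 1) + length (e 2)"
  by (simp_all add: env_size_def eval_nat_numeral)

text \<open>Here the target may hold an old value and even be one of the arguments, as happens for
  the loop state in \<open>oracle_iter\<close>; erasing the old value accounts for the term
  \<open>2 * length (s T)\<close>.\<close>

lemma pf_assign:
  assumes "poly_time n F"
  shows "\<exists>g. poly_bounded g \<and> mono g \<and> (\<forall>\<rho> d T. (\<forall>i<n. \<rho> i < d) \<longrightarrow> T < d \<longrightarrow> (\<exists>P. \<forall>f s. (\<forall>i\<ge>d. s i = []) \<longrightarrow>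
       runs f P s (g (env_size n (\<lambda>i. s (\<rho> i))) + 2 * length (s T)) (s(T := F (\<lambda>i. s (\<rho> i))))))"
proof -
  obtain g where g: "poly_bounded g" "mono g" and P: "\<And>\<rho> d. (\<forall>i<n. \<rho> i < d) \<Longrightarrow> (\<exists>P. \<forall>f s. (\<forall>i\<ge>d. s i = []) \<longrightarrow>
       runs f P s (g (env_size n (\<lambda>i. s (\<rho> i)))) (s(d := F (\<lambda>i. s (\<rho> i)))))"
    using assms unfolding poly_time_def by blast
  obtain h where h: "poly_bounded h" "mono h" "\<And>e. length (F e) \<le> h (env_size n e)" using pf_size[OF assms] by blast
  define G where "G x = g x + (1 + (8 * h x + 2))" for x
  have G: "poly_bounded G" "mono G"
    unfolding G_def using g h by (auto intro!: pb_intros monoI add_mono mult_mono dest: monoD)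
  have "\<exists>P. \<forall>f s. (\<forall>i\<ge>d. s i = []) \<longrightarrow>
       runs f P s (G (env_size n (\<lambda>i. s (\<rho> i))) + 2 * length (s T)) (s(T := F (\<lambda>i. s (\<rho> i))))"
    if \<rho>: "\<forall>i<n. \<rho> i < d" "T < d" for \<rho> d T
  proof -
    from P[OF \<rho>(1)] obtain P where P: "\<forall>f s. (\<forall>i\<ge>d. s i = []) \<longrightarrow>
       runs f P s (g (env_size n (\<lambda>i. s (\<rho> i)))) (s(d := F (\<lambda>i. s (\<rho> i))))" ..
    have "runs f (Seq P (Seq (clear T) (Seq (moveto d (d + 1)) (moveto (d + 1) T)))) s
       (G (env_size n (\<lambda>i. s (\<rho> i))) + 2 * length (s T)) (s(T := F (\<lambda>i. s (\<rho> i))))"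
      if s: "\<forall>i\<ge>d. s i = []" for f s
    proof -
      let ?e = "\<lambda>i. s (\<rho> i)"
      let ?s1 = "s(d := F ?e)"
      let ?s2 = "?s1(T := [])"
      have "runs f P s (g (env_size n ?e)) ?s1" using P s by blast
      moreover have "runs f (clear T) ?s1 (1 + 2 * length (s T)) ?s2"
        by (rule runs_mono[OF runs_clear]) (use \<rho>(2) in simp)
      moreover have "runs f (Seq (moveto d (d + 1)) (moveto (d + 1) T)) ?s2 (8 * h (env_size n ?e) + 2) (?s2(d := [], T := ?s2 d))"
        by (rule runs_mono[OF moveto_twice]) (use \<rho>(2) s h(3)[of ?e] in auto)
      moreover have "?s2(d := [], T := ?s2 d) = s(T := F ?e)"
        using s \<rho>(2) by (auto simp: fun_eq_iff)
      ultimately have "runs f (Seq P (Seq (clear T) (Seq (moveto d (d + 1)) (moveto (d + 1) T)))) s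
         (g (env_size n ?e) + ((1 + 2 * length (s T)) + (8 * h (env_size n ?e) + 2))) (s(T := F ?e))"
        by (metis runs_Seq)
      then show ?thesis by (rule runs_mono) (simp add: G_def)
    qed
    then show ?thesis by blast
  qed
  then show ?thesis using G by blast
qed

text \<open>The bound on \<open>upd\<close> depends on \<open>X\<close> alone, so the state does not
  grow with the number of rounds, and every query has length polynomial in that of
  \<open>X\<close>.\<close>

lemma oracle_iter_runs:
  assumes build: "poly_time 2 (\<lambda>e. build (e 0) (e 1))" and cnt: "poly_time 1 (\<lambda>e. cnt (e 0))"
    and upd: "poly_time 3 (\<lambda>e. upd (e 0) (e 1) (e 2))" and out: "poly_time 2 (\<lambda>e. out (e 0) (e 1))"
    and k: "poly_bounded k" "\<And>X R S. length (upd X R S) \<le> k (length X)"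
    and out1: "\<And>X R. length (out X R) \<le> 1"
  shows "\<exists>g. poly_bounded g \<and> mono g \<and> (\<forall>K. \<exists>q. \<forall>f r r' s. r < K \<longrightarrow> r' < K \<longrightarrow> (\<forall>i>K. s i = []) \<longrightarrow>
      (\<exists>z. runs f (q r r') s (g (length (s r) + length (s r'))) (s(r' := oracle_iter build cnt upd out f (s r), K := z))))"
proof -
  obtain gc where gc: "poly_bounded gc" "mono gc" and PC: "\<And>\<rho> d T. (\<forall>i<1. \<rho> i < d) \<Longrightarrow> T < d \<Longrightarrow> (\<exists>P. \<forall>f s. (\<forall>i\<ge>d. s i = []) \<longrightarrow>
       runs f P s (gc (env_size 1 (\<lambda>i. s (\<rho> i))) + 2 * length (s T)) (s(T := cnt (s (\<rho> 0)))))"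
    using pf_assign[OF cnt] by blast
  obtain gb where gb: "poly_bounded gb" "mono gb" and PB: "\<And>\<rho> d T. (\<forall>i<2. \<rho> i < d) \<Longrightarrow> T < d \<Longrightarrow> (\<exists>P. \<forall>f s. (\<forall>i\<ge>d. s i = []) \<longrightarrow>
       runs f P s (gb (env_size 2 (\<lambda>i. s (\<rho> i))) + 2 * length (s T)) (s(T := build (s (\<rho> 0)) (s (\<rho> 1)))))"
    using pf_assign[OF build] by blast
  obtain gu where gu: "poly_bounded gu" "mono gu" and PU: "\<And>\<rho> d T. (\<forall>i<3. \<rho> i < d) \<Longrightarrow> T < d \<Longrightarrow> (\<exists>P. \<forall>f s. (\<forall>i\<ge>d. s i = []) \<longrightarrow>
       runs f P s (gu (env_size 3 (\<lambda>i. s (\<rho> i))) + 2 * length (s T)) (s(T := upd (s (\<rho> 0)) (s (\<rho> 1)) (s (\<rho> 2)))))"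
    using pf_assign[OF upd] by blast
  obtain go where go: "poly_bounded go" "mono go" and PO: "\<And>\<rho> d T. (\<forall>i<2. \<rho> i < d) \<Longrightarrow> T < d \<Longrightarrow> (\<exists>P. \<forall>f s. (\<forall>i\<ge>d. s i = []) \<longrightarrow>
       runs f P s (go (env_size 2 (\<lambda>i. s (\<rho> i))) + 2 * length (s T)) (s(T := out (s (\<rho> 0)) (s (\<rho> 1)))))"
    using pf_assign[OF out] by blast
  obtain hb where hb: "poly_bounded hb" "mono hb" "\<And>e. length (build (e 0) (e 1)) \<le> hb (env_size 2 e)" using pf_size[OF build] by blast
  obtain hc where hc: "poly_bounded hc" "mono hc" "\<And>e. length (cnt (e 0)) \<le> hc (env_size 1 e)" using pf_size[OF cnt] by blast
  obtain k' where k': "poly_bounded k'" "mono k'" "\<And>x. k x \<le> k' x" using pb_obtain_mono[OF k(1)] by blast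
  define b where "b x = hb (x + k' x)" for x
  define T where "T x = 1 + (1 + (gb (x + k' x) + (Suc (b x) + ((1 + 5 * b x) + ((1 + 4 * b x) +
     ((gu (x + k' x + b x) + 2 * k' x) + (1 + 2 * b x)))))))" for x
  define G where "G x = gc x + ((1 + hc x * T x) + ((go (x + k' x) + 2 * x) + (1 + 2 * k' x)))" for x
  have b: "poly_bounded b" "mono b" unfolding b_def
    by (auto intro!: pb_comp[OF hb(1)] pb_intros k' monoI monoD[OF hb(2)] add_mono monoD[OF k'(2)])
  have T: "poly_bounded T" "mono T" unfolding T_def
    by (auto intro!: pb_comp[OF gb(1)] pb_comp[OF gu(1)] pb_intros k' b monoI monoD[OF gb(2)] monoD[OF gu(2)]
       add_mono mult_mono monoD[OF k'(2)] monoD[OF b(2)])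
  have G: "poly_bounded G" "mono G" unfolding G_def
    by (auto intro!: pb_comp[OF go(1)] pb_intros k' hc gc T monoI monoD[OF gc(2)] monoD[OF hc(2)] monoD[OF go(2)]
       add_mono mult_mono monoD[OF k'(2)] monoD[OF T(2)])
  have "\<exists>q. \<forall>f r r' s. r < K \<longrightarrow> r' < K \<longrightarrow> (\<forall>i>K. s i = []) \<longrightarrow>
      (\<exists>z. runs f (q r r') s (G (length (s r) + length (s r'))) (s(r' := oracle_iter build cnt upd out f (s r), K := z)))" for K
  proof -
    have "\<exists>P. \<forall>f s. r < K \<longrightarrow> r' < K \<longrightarrow> (\<forall>i>K. s i = []) \<longrightarrow>
      (\<exists>z. runs f P s (G (length (s r) + length (s r'))) (s(r' := oracle_iter build cnt upd out f (s r), K := z)))"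
      (is "?goal r r'") for r r'
    proof (cases "r < K \<and> r' < K")
      case True
      \<comment> \<open>Registers: \<open>K\<close> raw answer, \<open>K + 1\<close> query,
        \<open>K + 2\<close> truncated answer, \<open>K + 3\<close> state, \<open>K + 4\<close>
        round counter; the work space starts at \<open>d\<close>. Only \<open>K\<close> is left
        dirty.\<close>
      define d where "d = K + 5"
      have rd: "r < d" "r' < d" using True by (auto simp: d_def)
      obtain pc where pc: "\<forall>f s. (\<forall>i\<ge>d. s i = []) \<longrightarrow>
         runs f pc s (gc (env_size 1 (\<lambda>i. s r)) + 2 * length (s (K + 4))) (s(K + 4 := cnt (s r)))"
        using PC[of "\<lambda>_. r" d "K + 4"] rd by (auto simp: d_def)
      define \<rho> where "\<rho> i = (if i = 0 then r else if i = 1 then K + 3 else K + 2)" for i :: nat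
      have \<rho>: "\<rho> i < d" for i using rd by (auto simp: d_def \<rho>_def)
      have \<rho>s [simp]: "\<rho> 0 = r" "\<rho> 1 = K + 3" "\<rho> (Suc 0) = K + 3" "\<rho> 2 = K + 2" by (auto simp: \<rho>_def)
      obtain pbuild where pbuild: "\<forall>f s. (\<forall>i\<ge>d. s i = []) \<longrightarrow>
         runs f pbuild s (gb (env_size 2 (\<lambda>i. s (\<rho> i))) + 2 * length (s (K + 1))) (s(K + 1 := build (s r) (s (K + 3))))"
        using PB[of \<rho> d "K + 1"] \<rho> by (auto simp: d_def)
      obtain pu where pu: "\<forall>f s. (\<forall>i\<ge>d. s i = []) \<longrightarrow>
         runs f pu s (gu (env_size 3 (\<lambda>i. s (\<rho> i))) + 2 * length (s (K + 3))) (s(K + 3 := upd (s r) (s (K + 3)) (s (K + 2))))"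
        using PU[of \<rho> d "K + 3"] \<rho> by (auto simp: d_def)
      obtain po where po: "\<forall>f s. (\<forall>i\<ge>d. s i = []) \<longrightarrow>
         runs f po s (go (env_size 2 (\<lambda>i. s (\<rho> i))) + 2 * length (s r')) (s(r' := out (s r) (s (K + 3))))"
        using PO[of \<rho> d r'] \<rho> rd by auto
      define tr where "tr = While (K + 1) (Seq (Pop (K + 1)) (Branch K Skip (Seq (Push d True) (Pop K)) (Seq (Push d False) (Pop K))))"
      define body where "body = Seq (Pop (K + 4)) (Seq pbuild (Seq (Query (K + 1) K) (Seq tr (Seq (moveto d (K + 2)) (Seq pu (clear (K + 2)))))))"
      define lp where "lp = While (K + 4) body"
      have "\<exists>z. runs f (Seq pc (Seq lp (Seq po (clear (K + 3))))) s (G (length (s r) + length (s r'))) (s(r' := oracle_iter build cnt upd out f (s r), K := z))"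
        if s: "\<forall>i>K. s i = []" for f s
      proof -
        define X where "X = s r"
        define x where "x = length X"
        define step where "step R = upd X R (take (length (build X R)) (f (build X R)))" for R
        define W where "W j = (step ^^ j) []" for j
        have Wlen: "length (W j) \<le> k' x" for j
          using k(2) k'(3) order_trans unfolding W_def x_def by (cases j) (auto simp: step_def, blast)
        have blen: "length (build X (W j)) \<le> b x" for j
        proof -
          have "length (build X (W j)) \<le> hb (length X + length (W j))"
            using hb(3)[of "\<lambda>i. if i = 0 then X else W j"] by (simp add: env_size_def numeral_2_eq_2)
          also have "\<dots> \<le> b x" unfolding b_def x_def[symmetric] by (intro monoD[OF hb(2)]) (use Wlen in simp)
          finally show ?thesis .
        qed
        define st where "st c z j = s(K := z, K + 3 := W j, K + 4 := c)" for c z j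
        have loop: "\<exists>z'. runs f lp (st c z j) (1 + length c * T x) (st [] z' (j + length c))" for c z j
        proof (induction c arbitrary: z j)
          case Nil
          have "runs f lp (st [] z j) 1 (st [] z j)" unfolding lp_def by (rule runs_While_end) (simp add: st_def)
          then show ?case by auto
        next
          case (Cons c0 c)
          let ?b = "build X (W j)"
          let ?S = "take (length ?b) (f ?b)"
          let ?s1 = "st c z j"
          let ?s2 = "?s1(K + 1 := ?b)"
          let ?s3 = "?s2(K := f ?b)"
          let ?z = "drop (length ?b) (f ?b)"
          let ?s4 = "(st c ?z j)(d := rev ?S)"
          let ?s5 = "(st c ?z j)(K + 2 := ?S)"
          let ?s6 = "(st c ?z (Suc j))(K + 2 := ?S)"
          let ?s7 = "st c ?z (Suc j)"
          have rr: "st c z j r = X" "st c ?z j r = X" using True by (auto simp: st_def X_def)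
          have e1: "runs f (Pop (K + 4)) (st (c0 # c) z j) 1 ?s1"
            using runs_Pop[of f "K + 4" "st (c0 # c) z j"] by (simp add: st_def)
          have e2: "runs f pbuild ?s1 (gb (x + k' x)) ?s2"
          proof -
            have "runs f pbuild ?s1 (gb (env_size 2 (\<lambda>i. ?s1 (\<rho> i))) + 2 * length (?s1 (K + 1))) (?s1(K + 1 := build (?s1 r) (?s1 (K + 3))))"
              by (rule pbuild[rule_format]) (use s in \<open>simp add: st_def d_def\<close>)
            moreover have "?s1 (K + 1) = []" using s by (simp add: st_def)
            moreover have "?s1 (K + 3) = W j" by (simp add: st_def)
            moreover have "gb (env_size 2 (\<lambda>i. ?s1 (\<rho> i))) \<le> gb (x + k' x)"
              by (rule monoD[OF gb(2)]) (use Wlen[of j] \<open>?s1 (K + 3) = W j\<close> in \<open>simp add: env_size_def numeral_2_eq_2 rr x_def\<close>)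
            ultimately show ?thesis using rr by (auto elim: runs_mono)
          qed
          have e3: "runs f (Query (K + 1) K) ?s2 (Suc (b x)) ?s3"
          proof -
            have "runs f (Query (K + 1) K) ?s2 (Suc (length (?s2 (K + 1)))) (?s2(K := f (?s2 (K + 1))))"
              by (intro runs_exec exec.Query)
            then show ?thesis using blen[of j] by (auto elim: runs_mono)
          qed
          have e4: "runs f tr ?s3 (1 + 5 * b x) ?s4"
          proof -
            have "runs f tr ?s3 (1 + 5 * length (?s3 (K + 1)))
              (?s3(K + 1 := [], d := rev (take (length (?s3 (K + 1))) (?s3 K)) @ ?s3 d, K := drop (length (?s3 (K + 1))) (?s3 K)))"
              unfolding tr_def by (rule runs_take_answer) (auto simp: d_def)
            moreover have "(?s3(K + 1 := [], d := rev (take (length (?s3 (K + 1))) (?s3 K)) @ ?s3 d, K := drop (length (?s3 (K + 1))) (?s3 K))) = ?s4"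
              using s by (auto simp: fun_eq_iff st_def d_def)
            moreover have "length (?s3 (K + 1)) \<le> b x" using blen[of j] by simp
            ultimately show ?thesis by (auto elim: runs_mono)
          qed
          have Slen: "length ?S \<le> b x" using blen[of j] by simp
          have e5: "runs f (moveto d (K + 2)) ?s4 (1 + 4 * b x) ?s5"
          proof -
            have "runs f (moveto d (K + 2)) ?s4 (Suc (4 * length (?s4 d))) (?s4(d := [], K + 2 := rev (?s4 d) @ ?s4 (K + 2)))"
              by (rule runs_moveto) (simp add: d_def)
            moreover have "?s4(d := [], K + 2 := rev (?s4 d) @ ?s4 (K + 2)) = ?s5"
              using s by (auto simp: fun_eq_iff st_def d_def)
            ultimately show ?thesis using Slen by (auto elim: runs_mono)
          qed
          have e6: "runs f pu ?s5 (gu (x + k' x + b x) + 2 * k' x) ?s6"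
          proof -
            have "runs f pu ?s5 (gu (env_size 3 (\<lambda>i. ?s5 (\<rho> i))) + 2 * length (?s5 (K + 3))) (?s5(K + 3 := upd (?s5 r) (?s5 (K + 3)) (?s5 (K + 2))))"
              by (rule pu[rule_format]) (use s in \<open>simp add: st_def d_def\<close>)
            moreover have 1: "?s5 (K + 3) = W j" "?s5 (K + 2) = ?S" by (simp_all add: st_def)
            moreover have 2: "?s5 r = X" using rr True by simp
            moreover have 3: "gu (env_size 3 (\<lambda>i. ?s5 (\<rho> i))) \<le> gu (x + k' x + b x)"
              by (rule monoD[OF gu(2)], unfold env_size_numeral \<rho>s 1 2) (use Wlen[of j] Slen in \<open>simp add: x_def\<close>)
            moreover have 4: "?s5(K + 3 := upd X (W j) ?S) = ?s6"
              by (auto simp: fun_eq_iff st_def W_def step_def)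
            ultimately have "runs f pu ?s5 (gu (env_size 3 (\<lambda>i. ?s5 (\<rho> i))) + 2 * length (W j)) ?s6" by metis
            then show ?thesis by (rule runs_mono) (use Wlen[of j] 3 in linarith)
          qed
          have e7: "runs f (clear (K + 2)) ?s6 (1 + 2 * b x) ?s7"
          proof -
            have "?s6(K + 2 := []) = ?s7" using s by (auto simp: fun_eq_iff st_def)
            then show ?thesis using runs_clear[of f "K + 2" ?s6] Slen by (auto elim!: runs_mono)
          qed
          have "runs f body (st (c0 # c) z j) (1 + (gb (x + k' x) + (Suc (b x) + ((1 + 5 * b x) + ((1 + 4 * b x) +
             ((gu (x + k' x + b x) + 2 * k' x) + (1 + 2 * b x))))))) ?s7"
            unfolding body_def by (rule runs_Seq[OF e1 runs_Seq[OF e2 runs_Seq[OF e3 runs_Seq[OF e4 runs_Seq[OF e5 runs_Seq[OF e6 e7]]]]]])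
          moreover obtain z' where "runs f lp ?s7 (1 + length c * T x) (st [] z' (Suc j + length c))"
            using Cons by blast
          moreover have "st (c0 # c) z j (K + 4) \<noteq> []" by (simp add: st_def)
          ultimately have "runs f lp (st (c0 # c) z j) (Suc ((1 + (gb (x + k' x) + (Suc (b x) + ((1 + 5 * b x) + ((1 + 4 * b x) +
             ((gu (x + k' x + b x) + 2 * k' x) + (1 + 2 * b x))))))) + (1 + length c * T x))) (st [] z' (Suc j + length c))"
            unfolding lp_def by (intro runs_While_step)
          then have "runs f lp (st (c0 # c) z j) (1 + length (c0 # c) * T x) (st [] z' (Suc j + length c))"
            by (rule runs_mono) (simp add: T_def)
          then show ?case by auto
        qed
        let ?c = "cnt X"
        obtain z where lp: "runs f lp (st ?c (s K) 0) (1 + length ?c * T x) (st [] z (length ?c))"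
          using loop[of ?c "s K" 0] by auto
        have p1: "runs f pc s (gc x) (st ?c (s K) 0)"
        proof -
          have "runs f pc s (gc (env_size 1 (\<lambda>i. s r)) + 2 * length (s (K + 4))) (s(K + 4 := cnt (s r)))"
            by (rule pc[rule_format]) (use s in \<open>simp add: d_def\<close>)
          moreover have "s(K + 4 := cnt (s r)) = st ?c (s K) 0" using s by (auto simp: fun_eq_iff st_def X_def W_def)
          ultimately show ?thesis using s by (simp add: env_size_def x_def X_def)
        qed
        have p2: "runs f lp (st ?c (s K) 0) (1 + hc x * T x) (st [] z (length ?c))"
          using lp by (rule runs_mono) (use hc(3)[of "\<lambda>_. X"] in \<open>simp add: env_size_def x_def\<close>)
        let ?s8 = "st [] z (length ?c)"
        let ?o = "out X (W (length ?c))"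
        have 8: "?s8 r = X" "?s8 r' = s r'" "?s8 (K + 3) = W (length ?c)" using True by (auto simp: st_def X_def)
        have p3: "runs f po ?s8 (go (x + k' x) + 2 * length (s r')) (?s8(r' := ?o))"
        proof -
          have "runs f po ?s8 (go (env_size 2 (\<lambda>i. ?s8 (\<rho> i))) + 2 * length (?s8 r')) (?s8(r' := out (?s8 r) (?s8 (K + 3))))"
            by (rule po[rule_format]) (use s in \<open>simp add: st_def d_def\<close>)
          moreover have "go (env_size 2 (\<lambda>i. ?s8 (\<rho> i))) \<le> go (x + k' x)"
            by (rule monoD[OF go(2)]) (use Wlen[of "length ?c"] in \<open>simp add: env_size_def numeral_2_eq_2 8 x_def\<close>)
          ultimately show ?thesis unfolding 8 by (auto elim: runs_mono)
        qed
        have p4: "runs f (clear (K + 3)) (?s8(r' := ?o)) (1 + 2 * k' x) (s(r' := ?o, K := z))"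
        proof -
          have "?s8(r' := ?o, K + 3 := []) = s(r' := ?o, K := z)" using True s by (auto simp: fun_eq_iff st_def)
          then show ?thesis using runs_clear[of f "K + 3" "?s8(r' := ?o)"] Wlen[of "length ?c"] True
            by (auto elim!: runs_mono simp: st_def)
        qed
        have "runs f (Seq pc (Seq lp (Seq po (clear (K + 3))))) s
           (gc x + ((1 + hc x * T x) + ((go (x + k' x) + 2 * length (s r')) + (1 + 2 * k' x)))) (s(r' := ?o, K := z))"
          by (rule runs_Seq[OF p1 runs_Seq[OF p2 runs_Seq[OF p3 p4]]])
        note run = this
        have o_eq: "?o = oracle_iter build cnt upd out f (s r)"
          unfolding oracle_iter_def W_def step_def X_def ..
        let ?y = "length (s r) + length (s r')"
        have "x \<le> ?y" by (simp add: x_def X_def)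
        then have "gc x + ((1 + hc x * T x) + ((go (x + k' x) + 2 * length (s r')) + (1 + 2 * k' x))) \<le> G ?y"
          unfolding G_def
          by (intro add_mono mult_mono monoD[OF gc(2)] monoD[OF hc(2)] monoD[OF T(2)] monoD[OF go(2)] monoD[OF k'(2)]) auto
        from runs_mono[OF run this] show ?thesis unfolding o_eq by blast
      qed
      then show ?thesis by blast
    qed auto
    note ex = this
    define ok where "ok r r' P \<longleftrightarrow> (\<forall>f s. r < K \<longrightarrow> r' < K \<longrightarrow> (\<forall>i>K. s i = []) \<longrightarrow>
      (\<exists>z. runs f P s (G (length (s r) + length (s r'))) (s(r' := oracle_iter build cnt upd out f (s r), K := z))))"
      for r r' P
    have "\<forall>r. \<exists>q. \<forall>r'. ok r r' (q r')"
      by (intro allI choice) (use ex in \<open>simp only: ok_def\<close>)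
    then have "\<exists>q. \<forall>r r'. ok r r' (q r r')" by (rule choice)
    then obtain q where "\<And>r r'. ok r r' (q r r')" by blast
    then show ?thesis unfolding ok_def by (intro exI[of _ q]) blast
  qed
  then show ?thesis using G by blast
qed

text \<open>A machine \<open>M\<close> decides the NP language with an oracle for \<open>A\<close>,
  and \<open>oracle_iter\<close> turns an oracle for \<open>B\<close> into one for \<open>A\<close>;
  its program is substituted for the queries of \<open>M\<close>. Answers of one bit keep the
  registers of \<open>M\<close> bounded by its running time.\<close>

theorem turing_reduction:
  assumes build: "poly_time 2 (\<lambda>e. build (e 0) (e 1))" and cnt: "poly_time 1 (\<lambda>e. cnt (e 0))"
    and upd: "poly_time 3 (\<lambda>e. upd (e 0) (e 1) (e 2))" and out: "poly_time 2 (\<lambda>e. out (e 0) (e 1))"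
    and k: "poly_bounded k" "\<And>X R S. length (upd X R S) \<le> k (length X)"
    and out1: "\<And>X R. length (out X R) \<le> 1"
    and red: "\<And>f. solves f B \<Longrightarrow> solves (oracle_iter build cnt upd out f) A"
    and A: "NP_hard A"
  shows "NP_hard B"
  unfolding NP_hard_def
proof (intro allI impI)
  fix L :: "bool list set" assume "in_NP L"
  then obtain M p where M: "\<And>f x. solves f A \<Longrightarrow> outputs_within f M [x] (poly p (length x)) [x \<in> L]"
    using A unfolding NP_hard_def by meson
  obtain g where g: "poly_bounded g" "mono g" and q: "\<And>K. \<exists>q. \<forall>f r r' s. r < K \<longrightarrow> r' < K \<longrightarrow> (\<forall>i>K. s i = []) \<longrightarrow>
      (\<exists>z. runs f (q r r') s (g (length (s r) + length (s r'))) (s(r' := oracle_iter build cnt upd out f (s r), K := z)))"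
    using oracle_iter_runs[OF build cnt upd out k out1] by blast
  \<comment> \<open>All registers from \<open>reg_bound M\<close> on are free. The successor
    guarantees \<open>0 < K\<close>, so that the output register is among the simulated ones even if
    \<open>M\<close> mentions no register.\<close>
  define K where "K = Suc (reg_bound M)"
  from q[of K] obtain q where q: "\<forall>f r r' s. r < K \<longrightarrow> r' < K \<longrightarrow> (\<forall>i>K. s i = []) \<longrightarrow>
      (\<exists>z. runs f (q r r') s (g (length (s r) + length (s r'))) (s(r' := oracle_iter build cnt upd out f (s r), K := z)))" ..
  \<comment> \<open>The successor makes the cost of a simulated step at least 1, which the
    elementary steps other than queries require.\<close>
  define g' where "g' x = Suc (g x)" for x
  have g': "poly_bounded g'" "mono g'" unfolding g'_def using g by (auto intro: pb_intros monoI dest: monoD)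
  have q': "\<exists>z. runs f (q r r') s (g' (length (s r) + length (s r'))) (s(r' := oracle_iter build cnt upd out f (s r), K := z))"
    if a: "r < K" "r' < K" "\<forall>i>K. s i = []" for f r r' s
  proof -
    obtain z where "runs f (q r r') s (g (length (s r) + length (s r'))) (s(r' := oracle_iter build cnt upd out f (s r), K := z))"
      using q[THEN spec, of f, THEN spec, of r, THEN spec, of r', THEN spec, of s,
          THEN mp, OF a(1), THEN mp, OF a(2), THEN mp, OF a(3)] ..
    then have "runs f (q r r') s (g' (length (s r) + length (s r'))) (s(r' := oracle_iter build cnt upd out f (s r), K := z))"
      by (rule runs_mono) (simp add: g'_def)
    then show ?thesis ..
  qed
  have "poly_bounded (\<lambda>n. poly p n * g' (2 * (n + poly p n)))"
    by (intro pb_intros pb_comp[OF g'(1)])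
  then obtain p' :: "nat poly" where p': "\<And>n. poly p n * g' (2 * (n + poly p n)) \<le> poly p' n"
    using pb_imp_poly by meson
  show "\<exists>M (p :: nat poly). \<forall>f. solves f B \<longrightarrow> (\<forall>x. outputs_within f M [x] (poly p (length x)) [x \<in> L])"
  proof (intro exI allI impI)
    fix f and x :: "bool list" assume f: "solves f B"
    let ?T = "length x + poly p (length x)"
    obtain t s where t: "t \<le> poly p (length x)" "exec (oracle_iter build cnt upd out f) M (init_store [x]) t s" "s 0 = [x \<in> L]"
      using M[OF red[OF f], of x] unfolding outputs_within_def by blast
    have "\<exists>u'. runs f (subst_query q M) (init_store [x]) (t * g' (2 * ?T)) u' \<and> (\<forall>i<K. u' i = s i) \<and> (\<forall>i>K. u' i = [])"
    proof (rule exec_subst_query[OF q' g'(2) _ _ t(2)])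
      show "length (init_store [x] i) + t \<le> ?T" for i using t(1) by (auto simp: init_store_def)
      show "\<forall>y. length (oracle_iter build cnt upd out f y) \<le> 1"
        using out1 by (simp add: oracle_iter_def)
    qed (auto simp: g'_def K_def init_store_def)
    then obtain u where u: "runs f (subst_query q M) (init_store [x]) (t * g' (2 * ?T)) u" "u 0 = s 0"
      by (auto simp: K_def)
    have "t * g' (2 * ?T) \<le> poly p' (length x)"
      by (rule order_trans[OF mult_le_mono1[OF t(1)] p'])
    with u t(3) show "outputs_within f (subst_query q M) [x] (poly p' (length x)) [x \<in> L]"
      unfolding outputs_within_def runs_def by (metis order_trans)
  qed
qed

section \<open>Influences on the hypercube\<close>

definition flip :: "nat \<Rightarrow> nat set \<Rightarrow> nat set" where
  "flip i x = (if i \<in> x then x - {i} else insert i x)"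

lemma flip_flip [simp]: "flip i (flip i x) = x"
  by (auto simp: flip_def)

lemma flip_Pow: "i \<in> A \<Longrightarrow> x \<in> Pow A \<Longrightarrow> flip i x \<in> Pow A"
  by (auto simp: flip_def)

section \<open>Walsh expansion and hypercontractivity on the cube of subsets\<close>

definition character :: "nat set \<Rightarrow> nat set \<Rightarrow> real" where
  "character S x = (- 1) ^ card (S \<inter> x)"

definition walsh :: "nat set \<Rightarrow> (nat set \<Rightarrow> real) \<Rightarrow> nat set \<Rightarrow> real" where
  "walsh A c x = (\<Sum>S\<in>Pow A. c S * character S x)"

lemma sum_Pow_insert:
  assumes "finite A" "a \<notin> A"
  shows "(\<Sum>x\<in>Pow (insert a A). F x) = (\<Sum>x\<in>Pow A. F x + F (insert a x) :: real)"
proof -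
  have "(\<Sum>x\<in>Pow (insert a A). F x) = (\<Sum>x\<in>Pow A. F x) + (\<Sum>x\<in>insert a ` Pow A. F x)"
    unfolding Pow_insert by (rule sum.union_disjoint) (use assms in auto)
  also have "(\<Sum>x\<in>insert a ` Pow A. F x) = (\<Sum>x\<in>Pow A. F (insert a x))"
    by (rule sum.reindex_cong[OF _ refl refl]) (use assms in \<open>auto simp: inj_on_def\<close>)
  finally show ?thesis by (simp add: sum.distrib)
qed

lemma character_insert:
  assumes "finite A" "a \<notin> A" "S \<subseteq> A" "x \<subseteq> A"
  shows "character (insert a S) x = character S x" "character S (insert a x) = character S x"
    "character (insert a S) (insert a x) = - character S x"
proof -
  have "a \<notin> S" "a \<notin> x" "finite S" using assms by (auto intro: finite_subset)
  then show "character (insert a S) x = character S x" "character S (insert a x) = character S x"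
    "character (insert a S) (insert a x) = - character S x"
    by (simp_all add: character_def)
qed

lemma walsh_insert:
  assumes "finite A" "a \<notin> A" "x \<subseteq> A"
  shows "walsh (insert a A) c x = walsh A c x + walsh A (\<lambda>S. c (insert a S)) x"
    "walsh (insert a A) c (insert a x) = walsh A c x - walsh A (\<lambda>S. c (insert a S)) x"
  unfolding walsh_def sum_Pow_insert[OF assms(1,2)] sum.distrib[symmetric] sum_subtractf[symmetric]
  by (intro sum.cong refl; use character_insert[OF assms(1,2) _ assms(3)] in simp)+

lemma walsh_scale: "walsh A (\<lambda>S. k * c S) x = k * walsh A c x"
  unfolding walsh_def by (simp add: sum_distrib_left mult.assoc)

text \<open>Induction on the dimension: half the sum and half the difference of the two restrictions
  along the new coordinate \<open>a\<close> are expanded separately and provide the coefficients of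
  the sets without and with \<open>a\<close>.\<close>

lemma walsh_exists:
  assumes "finite A"
  shows "\<exists>c. \<forall>x\<in>Pow A. g x = walsh A c x"
  using assms
proof (induction A arbitrary: g rule: finite_induct)
  case empty
  show ?case by (rule exI[of _ g]) (simp add: walsh_def character_def)
next
  case (insert a A)
  obtain c0 where c0: "\<And>x. x \<subseteq> A \<Longrightarrow> (g x + g (insert a x)) / 2 = walsh A c0 x"
    using insert.IH[of "\<lambda>x. (g x + g (insert a x)) / 2"] by auto
  obtain c1 where c1: "\<And>x. x \<subseteq> A \<Longrightarrow> (g x - g (insert a x)) / 2 = walsh A c1 x"
    using insert.IH[of "\<lambda>x. (g x - g (insert a x)) / 2"] by auto
  define c where "c S = (if a \<in> S then c1 (S - {a}) else c0 S)" for S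
  have w: "walsh A c x = walsh A c0 x" "walsh A (\<lambda>S. c (insert a S)) x = walsh A c1 x" for x
    unfolding walsh_def c_def using insert.hyps by (auto intro!: sum.cong arg_cong[of _ _ c1] simp: insert_absorb)
  have "g y = walsh (insert a A) c y" if "y \<subseteq> insert a A" for y
  proof (cases "a \<in> y")
    case True
    obtain x where x: "y = insert a x" "x \<subseteq> A" using True \<open>y \<subseteq> insert a A\<close>
      by (intro that[of "y - {a}"]) auto
    show ?thesis
      unfolding x(1) walsh_insert(2)[OF insert.hyps x(2)] w c0[OF x(2), symmetric] c1[OF x(2), symmetric]
      by (simp add: field_simps)
  next
    case False
    then have x: "y \<subseteq> A" using that by auto
    show ?thesis
      unfolding walsh_insert(1)[OF insert.hyps x] w c0[OF x, symmetric] c1[OF x, symmetric]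
      by (simp add: field_simps)
  qed
  then show ?case by auto
qed

text \<open>In the induction, the products mixing parts with and without \<open>a\<close> have
  opposite signs at a point and its neighbour in direction \<open>a\<close>, hence cancel. The
  bilinear form serves to compute means and inner products as well as norms.\<close>

lemma parseval:
  assumes "finite A"
  shows "(\<Sum>x\<in>Pow A. walsh A c x * walsh A d x) = 2 ^ card A * (\<Sum>S\<in>Pow A. c S * d S)"
  using assms
proof (induction A arbitrary: c d rule: finite_induct)
  case empty
  show ?case by (simp add: walsh_def character_def)
next
  case (insert a A)
  have "(\<Sum>x\<in>Pow (insert a A). walsh (insert a A) c x * walsh (insert a A) d x)
      = (\<Sum>x\<in>Pow A. 2 * (walsh A c x * walsh A d x) + 2 * (walsh A (\<lambda>S. c (insert a S)) x * walsh A (\<lambda>S. d (insert a S)) x))"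
    unfolding sum_Pow_insert[OF insert.hyps]
    by (intro sum.cong refl) (simp add: walsh_insert[OF insert.hyps] algebra_simps)
  also have "\<dots> = 2 * (\<Sum>x\<in>Pow A. walsh A c x * walsh A d x) +
      2 * (\<Sum>x\<in>Pow A. walsh A (\<lambda>S. c (insert a S)) x * walsh A (\<lambda>S. d (insert a S)) x)"
    by (simp add: sum.distrib sum_distrib_left)
  finally show ?case
    unfolding insert.IH sum_Pow_insert[OF insert.hyps] using insert.hyps
    by (simp add: sum.distrib algebra_simps)
qed

lemma cauchy_schwarz_sum:
  fixes a b :: "'a \<Rightarrow> real"
  shows "(\<Sum>i\<in>A. a i * b i)\<^sup>2 \<le> (\<Sum>i\<in>A. (a i)\<^sup>2) * (\<Sum>i\<in>A. (b i)\<^sup>2)"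
proof (cases "finite A")
  case True
  let ?X = "\<Sum>i\<in>A. (a i)\<^sup>2" and ?Y = "\<Sum>i\<in>A. (b i)\<^sup>2" and ?S = "\<Sum>i\<in>A. a i * b i"
  have "0 \<le> (\<Sum>i\<in>A. (?Y * a i - ?S * b i)\<^sup>2)" by (intro sum_nonneg) auto
  also have "\<dots> = ?Y\<^sup>2 * ?X - 2 * ?Y * ?S * ?S + ?S\<^sup>2 * ?Y"
    by (simp add: power2_diff sum.distrib sum_subtractf power_mult_distrib sum_distrib_left[symmetric] mult.assoc)
      (simp add: sum_distrib_left sum_distrib_right mult_ac)
  also have "\<dots> = ?Y * (?X * ?Y - ?S\<^sup>2)" by (simp add: power2_eq_square algebra_simps)
  finally have *: "0 \<le> ?Y * (?X * ?Y - ?S\<^sup>2)" .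
  show ?thesis
  proof (cases "?Y = 0")
    case True
    then have "\<forall>i\<in>A. b i = 0" using \<open>finite A\<close> by (simp add: sum_nonneg_eq_0_iff)
    then show ?thesis by simp
  next
    case False
    then have "?Y > 0" by (simp add: order_less_le sum_nonneg)
    then show ?thesis using * by (simp add: zero_le_mult_iff)
  qed
qed simp

text \<open>Bonami's inequality: the noise operator of rate \<open>r\<close> is a contraction from
  the 2-norm to the 4-norm. The induction treats one coordinate at a time and bounds the mixed term
  by Cauchy-Schwarz.\<close>

lemma hypercontractivity:
  assumes "finite A" and r: "r\<^sup>2 = (1 / 3 :: real)"
  shows "(\<Sum>x\<in>Pow A. (walsh A (\<lambda>S. r ^ card S * c S) x) ^ 4) \<le> 2 ^ card A * (\<Sum>S\<in>Pow A. (c S)\<^sup>2)\<^sup>2"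
  using assms(1)
proof (induction A arbitrary: c rule: finite_induct)
  case empty
  show ?case by (simp add: walsh_def character_def power4_eq_xxxx power2_eq_square)
next
  case (insert a A)
  let ?p = "walsh A (\<lambda>S. r ^ card S * c S)" and ?q = "walsh A (\<lambda>S. r ^ card S * c (insert a S))"
  let ?u = "\<Sum>S\<in>Pow A. (c S)\<^sup>2" and ?v = "\<Sum>S\<in>Pow A. (c (insert a S))\<^sup>2"
  let ?M = "2 ^ card A :: real"
  have "r ^ 4 = (r\<^sup>2)\<^sup>2" by simp
  then have r4: "r ^ 4 = 1 / 9" unfolding r by (simp add: power_divide)
  have q': "walsh A (\<lambda>S. r ^ card (insert a S) * c (insert a S)) x = r * ?q x" for x
  proof -
    have "walsh A (\<lambda>S. r ^ card (insert a S) * c (insert a S)) x = walsh A (\<lambda>S. r * (r ^ card S * c (insert a S))) x"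
      unfolding walsh_def
    proof (rule sum.cong[OF refl])
      fix S assume "S \<in> Pow A"
      then have "card (insert a S) = Suc (card S)" using insert.hyps by (auto intro: card_insert_disjoint finite_subset)
      then show "r ^ card (insert a S) * c (insert a S) * character S x = r * (r ^ card S * c (insert a S)) * character S x" by simp
    qed
    then show ?thesis by (simp add: walsh_scale)
  qed
  \<comment> \<open>This is where the rate comes from: the mixed coefficient
    \<open>12 * r\<^sup>2\<close> equals 4, exactly the mixed coefficient of twice the square of a
    sum, with which the total is compared below.\<close>
  have pw: "(p + r * q) ^ 4 + (p - r * q) ^ 4 = 2 * p ^ 4 + 4 * (p\<^sup>2 * q\<^sup>2) + 2 / 9 * q ^ 4" for p q :: real
  proof -
    have "(p + r * q) ^ 4 + (p - r * q) ^ 4 = 2 * p ^ 4 + 12 * r\<^sup>2 * (p\<^sup>2 * q\<^sup>2) + 2 * r ^ 4 * q ^ 4"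
      by algebra
    then show ?thesis by (simp add: r r4)
  qed
  have "(\<Sum>x\<in>Pow (insert a A). (walsh (insert a A) (\<lambda>S. r ^ card S * c S) x) ^ 4)
      = (\<Sum>x\<in>Pow A. 2 * (?p x) ^ 4 + 4 * ((?p x)\<^sup>2 * (?q x)\<^sup>2) + 2 / 9 * (?q x) ^ 4)"
    unfolding sum_Pow_insert[OF insert.hyps]
    by (intro sum.cong refl) (simp add: walsh_insert[OF insert.hyps] q' pw)
  also have "\<dots> = 2 * (\<Sum>x\<in>Pow A. (?p x) ^ 4) + 4 * (\<Sum>x\<in>Pow A. (?p x)\<^sup>2 * (?q x)\<^sup>2) + 2 / 9 * (\<Sum>x\<in>Pow A. (?q x) ^ 4)"
    by (simp add: sum.distrib sum_distrib_left)
  also have "\<dots> \<le> 2 * (?M * ?u\<^sup>2) + 4 * (?M * (?u * ?v)) + 2 / 9 * (?M * ?v\<^sup>2)"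
  proof -
    have p4: "(\<Sum>x\<in>Pow A. (?p x) ^ 4) \<le> ?M * ?u\<^sup>2" and q4: "(\<Sum>x\<in>Pow A. (?q x) ^ 4) \<le> ?M * ?v\<^sup>2"
      by (rule insert.IH)+
    have "(\<Sum>x\<in>Pow A. (?p x)\<^sup>2 * (?q x)\<^sup>2)\<^sup>2 \<le> (\<Sum>x\<in>Pow A. ((?p x)\<^sup>2)\<^sup>2) * (\<Sum>x\<in>Pow A. ((?q x)\<^sup>2)\<^sup>2)"
      by (rule cauchy_schwarz_sum)
    also have "\<dots> \<le> (?M * ?u\<^sup>2) * (?M * ?v\<^sup>2)"
      using p4 q4 by (intro mult_mono) (auto intro!: sum_nonneg)
    also have "\<dots> = (?M * (?u * ?v))\<^sup>2" by (simp add: power2_eq_square)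
    finally have "(\<Sum>x\<in>Pow A. (?p x)\<^sup>2 * (?q x)\<^sup>2) \<le> ?M * (?u * ?v)"
      by (rule power2_le_imp_le) (auto intro!: mult_nonneg_nonneg sum_nonneg)
    with p4 q4 show ?thesis by linarith
  qed
  also have "\<dots> \<le> 2 * ?M * (?u + ?v)\<^sup>2"
  proof -
    have "2 / 9 * (?M * ?v\<^sup>2) \<le> 2 * (?M * ?v\<^sup>2)" by (intro mult_right_mono) auto
    then show ?thesis by (simp add: power2_sum algebra_simps)
  qed
  also have "\<dots> = 2 ^ card (insert a A) * (\<Sum>S\<in>Pow (insert a A). (c S)\<^sup>2)\<^sup>2"
    unfolding sum_Pow_insert[OF insert.hyps] using insert.hyps by (simp add: sum.distrib)
  finally show ?case .
qed

lemma character_flip: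
  assumes "finite S"
  shows "character S (flip i x) = (if i \<in> S then - character S x else character S x)"
proof (cases "i \<in> S")
  case False
  then have "S \<inter> flip i x = S \<inter> x" by (auto simp: flip_def)
  then show ?thesis using False by (simp add: character_def)
next
  case True
  show ?thesis
  proof (cases "i \<in> x")
    case True
    then have "S \<inter> x = insert i (S \<inter> flip i x)" "i \<notin> S \<inter> flip i x" using \<open>i \<in> S\<close> by (auto simp: flip_def)
    then have "card (S \<inter> x) = Suc (card (S \<inter> flip i x))" using assms by simp
    then show ?thesis using \<open>i \<in> S\<close> by (simp add: character_def)
  next
    case False
    then have "S \<inter> flip i x = insert i (S \<inter> x)" "i \<notin> S \<inter> x" using \<open>i \<in> S\<close> by (auto simp: flip_def)
    then have "card (S \<inter> flip i x) = Suc (card (S \<inter> x))" using assms by simp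
    then show ?thesis using \<open>i \<in> S\<close> by (simp add: character_def)
  qed
qed

section \<open>Influences and the theorem of Kahn, Kalai and Linial\<close>

definition influence :: "nat set \<Rightarrow> nat \<Rightarrow> (nat set \<Rightarrow> bool) \<Rightarrow> real" where
  "influence A i f = (\<Sum>x\<in>Pow A. of_bool (f x \<noteq> f (flip i x))) / 2 ^ card A"

definition antipodal :: "nat set \<Rightarrow> (nat set \<Rightarrow> bool) \<Rightarrow> real" where
  "antipodal A f = (\<Sum>x\<in>Pow A. of_bool (f x \<noteq> f (A - x))) / 2 ^ card A"

text \<open>Points separated from their antipodes cancel in the mean of the sign version of
  \<open>f\<close>. With \<open>a = antipodal A f\<close>, the mean is at most \<open>1 - a\<close>
  in absolute value, so the variance, which is the right-hand side, is at least
  \<open>1 - (1 - a)\<^sup>2\<close>, and this is at least \<open>a\<close>.\<close>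

lemma variance_bound:
  assumes A: "finite A" and c: "\<And>x. x \<in> Pow A \<Longrightarrow> (if f x then 1 else - 1) = walsh A c x"
  shows "antipodal A f \<le> (\<Sum>S\<in>Pow A - {{}}. (c S)\<^sup>2)"
proof -
  let ?g = "\<lambda>x. if f x then 1 else - 1 :: real"
  let ?M = "2 ^ card A :: real"
  let ?a = "antipodal A f"
  have "?M * (\<Sum>S\<in>Pow A. c S * c S) = (\<Sum>x\<in>Pow A. walsh A c x * walsh A c x)"
    using parseval[OF A] by simp
  also have "\<dots> = (\<Sum>x\<in>Pow A. 1)" by (intro sum.cong refl) (simp add: c[symmetric])
  also have "\<dots> = ?M" using A by (simp add: card_Pow)
  finally have "(\<Sum>S\<in>Pow A. (c S)\<^sup>2) = 1" by (simp add: power2_eq_square)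
  then have var: "(\<Sum>S\<in>Pow A - {{}}. (c S)\<^sup>2) = 1 - (c {})\<^sup>2"
    using A by (subst sum_diff1) auto
  have one: "walsh A (\<lambda>S. of_bool (S = {})) x = 1" for x
  proof -
    have "walsh A (\<lambda>S. of_bool (S = {})) x = (\<Sum>S\<in>Pow A. if S = {} then character S x else 0)"
      unfolding walsh_def by (intro sum.cong) auto
    then show ?thesis using A by (simp add: character_def)
  qed
  have mean: "?M * c {} = (\<Sum>x\<in>Pow A. ?g x)"
  proof -
    have "(\<Sum>x\<in>Pow A. ?g x) = (\<Sum>x\<in>Pow A. walsh A c x * walsh A (\<lambda>S. of_bool (S = {})) x)"
      by (intro sum.cong refl) (simp add: c one)
    also have "\<dots> = ?M * (\<Sum>S\<in>Pow A. if S = {} then c S else 0)"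
      unfolding parseval[OF A] by (intro arg_cong2[where f = "(*)"] refl sum.cong) auto
    finally show ?thesis using A by simp
  qed
  have "(\<Sum>x\<in>Pow A. ?g (A - x)) = (\<Sum>x\<in>Pow A. ?g x)"
    by (rule sum.reindex_bij_witness[of _ "\<lambda>x. A - x" "\<lambda>x. A - x"]) (auto simp: double_diff)
  then have "2 * (?M * c {}) = (\<Sum>x\<in>Pow A. ?g x + ?g (A - x))"
    unfolding mean by (simp only: sum.distrib)
  then have "\<bar>2 * (?M * c {})\<bar> \<le> (\<Sum>x\<in>Pow A. \<bar>?g x + ?g (A - x)\<bar>)" by simp
  also have "\<dots> = (\<Sum>x\<in>Pow A. 2 - 2 * of_bool (f x \<noteq> f (A - x)))" by (intro sum.cong) auto
  also have "\<dots> = 2 * (?M * (1 - ?a))"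
    using A by (simp add: sum_subtractf sum_distrib_left[symmetric] card_Pow antipodal_def algebra_simps)
  finally have "\<bar>c {}\<bar> \<le> 1 - ?a" by (simp add: abs_mult)
  then have "\<bar>c {}\<bar>\<^sup>2 \<le> (1 - ?a)\<^sup>2" by (intro power_mono) auto
  moreover have "0 \<le> ?a" unfolding antipodal_def by (intro divide_nonneg_nonneg sum_nonneg) auto
  moreover have "?a \<le> 1" using \<open>\<bar>c {}\<bar> \<le> 1 - ?a\<close> by linarith
  then have "?a * ?a \<le> ?a" using \<open>0 \<le> ?a\<close> by (simp add: mult_left_le)
  ultimately show ?thesis unfolding var by (simp add: power2_eq_square algebra_simps)
qed

text \<open>\<open>h\<close> is half the discrete derivative of the sign version of \<open>f\<close>
  in direction \<open>i\<close>; it takes the values -1, 0 and 1, and the mean of its square is the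
  influence. \<open>Z\<close> is the squared 2-norm of \<open>h\<close> after noise with
  \<open>r\<^sup>2 = 1 / 3\<close>, and also the inner product of \<open>h\<close> with its doubly
  noisy version \<open>u\<close>. Hoelder's inequality and hypercontractivity bound this product by
  mu^(3/4) Z^(1/2), where mu is the influence; solving for Z gives the claim.\<close>

lemma kkl_level:
  assumes A: "finite A" "i \<in> A" and c: "\<And>x. x \<in> Pow A \<Longrightarrow> (if f x then 1 else - 1) = walsh A c x"
  shows "influence A i f = (\<Sum>S\<in>Pow A. of_bool (i \<in> S) * (c S)\<^sup>2)"
    "(\<Sum>S\<in>Pow A. of_bool (i \<in> S) * (c S)\<^sup>2 / 3 ^ card S)\<^sup>2 \<le> (influence A i f) ^ 3"
proof -
  let ?M = "2 ^ card A :: real"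
  define ci where "ci S = of_bool (i \<in> S) * c S" for S
  define h where "h x = walsh A ci x" for x
  have h: "h x = ((if f x then 1 else - 1) - (if f (flip i x) then 1 else - 1)) / 2" if "x \<in> Pow A" for x
  proof -
    have "h x = (walsh A c x - walsh A c (flip i x)) / 2"
      unfolding h_def walsh_def sum_subtractf[symmetric] sum_divide_distrib
      using A by (intro sum.cong refl) (auto simp: character_flip finite_subset ci_def)
    then show ?thesis using c that flip_Pow[OF A(2) that] by simp
  qed
  have h2: "(h x)\<^sup>2 = of_bool (f x \<noteq> f (flip i x))" if "x \<in> Pow A" for x
    unfolding h[OF that] by auto
  have sumh2: "(\<Sum>x\<in>Pow A. (h x)\<^sup>2) = ?M * influence A i f"
  proof -
    have "(\<Sum>x\<in>Pow A. (h x)\<^sup>2) = (\<Sum>x\<in>Pow A. of_bool (f x \<noteq> f (flip i x)))"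
      by (rule sum.cong[OF refl h2])
    then show ?thesis by (simp only: influence_def) simp
  qed
  have "(\<Sum>x\<in>Pow A. (h x)\<^sup>2) = ?M * (\<Sum>S\<in>Pow A. of_bool (i \<in> S) * (c S)\<^sup>2)"
    unfolding power2_eq_square h_def parseval[OF A(1)] ci_def
    by (auto intro!: sum.cong)
  then show "influence A i f = (\<Sum>S\<in>Pow A. of_bool (i \<in> S) * (c S)\<^sup>2)"
    unfolding sumh2 by simp
  define Z where "Z = (\<Sum>S\<in>Pow A. of_bool (i \<in> S) * (c S)\<^sup>2 / 3 ^ card S)"
  define r :: real where "r = sqrt (1 / 3)"
  have r: "r\<^sup>2 = 1 / 3" by (simp add: r_def)
  define d where "d S = r ^ card S * ci S" for S
  define u where "u x = walsh A (\<lambda>S. r ^ card S * d S) x" for x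
  have r2: "r ^ k * r ^ k = 1 / 3 ^ k" for k
    by (metis r power_mult_distrib power2_eq_square power_one_over)
  have hu: "(\<Sum>x\<in>Pow A. h x * u x) = ?M * Z"
    unfolding h_def u_def parseval[OF A(1)] Z_def
  proof (intro arg_cong2[where f = "(*)"] refl sum.cong)
    fix S
    have "ci S * (r ^ card S * d S) = (r ^ card S * r ^ card S) * (ci S * ci S)" by (simp add: d_def)
    then show "ci S * (r ^ card S * d S) = of_bool (i \<in> S) * (c S)\<^sup>2 / 3 ^ card S"
      unfolding r2 by (auto simp: ci_def power2_eq_square)
  qed
  have "(\<Sum>S\<in>Pow A. (d S)\<^sup>2) = Z"
    unfolding Z_def
  proof (intro sum.cong refl)
    fix S
    have "(d S)\<^sup>2 = (r ^ card S * r ^ card S) * (ci S * ci S)" by (simp add: d_def power2_eq_square)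
    then show "(d S)\<^sup>2 = of_bool (i \<in> S) * (c S)\<^sup>2 / 3 ^ card S"
      unfolding r2 by (auto simp: ci_def power2_eq_square)
  qed
  then have u4: "(\<Sum>x\<in>Pow A. (u x) ^ 4) \<le> ?M * Z\<^sup>2"
    using hypercontractivity[OF A(1) r, of d] by (simp add: u_def)
  let ?\<mu> = "influence A i f"
  have mu: "?\<mu> \<ge> 0" unfolding influence_def by (intro divide_nonneg_nonneg sum_nonneg) auto
  have hh: "(h x)\<^sup>2 * h x = h x" "((h x)\<^sup>2)\<^sup>2 = (h x)\<^sup>2" if "x \<in> Pow A" for x
    unfolding h[OF that] by auto
  \<comment> \<open>Hoelder's inequality with exponents 4/3 and 4 is obtained from two applications
    of Cauchy-Schwarz, after inserting the factor \<open>(h x)\<^sup>2\<close>, which leaves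
    \<open>h x\<close> unchanged.\<close>
  have 1: "(?M * Z)\<^sup>2 \<le> (?M * ?\<mu>) * (\<Sum>x\<in>Pow A. (h x)\<^sup>2 * (u x)\<^sup>2)"
  proof -
    have "(\<Sum>x\<in>Pow A. h x * u x) = (\<Sum>x\<in>Pow A. h x * ((h x)\<^sup>2 * u x))"
    proof (intro sum.cong refl)
      fix x assume "x \<in> Pow A"
      then have "h x * ((h x)\<^sup>2 * u x) = ((h x)\<^sup>2 * h x) * u x" by simp
      then show "h x * u x = h x * ((h x)\<^sup>2 * u x)" by (simp only: hh(1)[OF \<open>x \<in> Pow A\<close>])
    qed
    then have "(?M * Z)\<^sup>2 \<le> (\<Sum>x\<in>Pow A. (h x)\<^sup>2) * (\<Sum>x\<in>Pow A. ((h x)\<^sup>2 * u x)\<^sup>2)"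
      unfolding hu[symmetric] by (simp only: cauchy_schwarz_sum)
    also have "(\<Sum>x\<in>Pow A. ((h x)\<^sup>2 * u x)\<^sup>2) = (\<Sum>x\<in>Pow A. (h x)\<^sup>2 * (u x)\<^sup>2)"
      by (intro sum.cong refl) (simp only: power_mult_distrib hh)
    finally show ?thesis unfolding sumh2 .
  qed
  have 2: "(\<Sum>x\<in>Pow A. (h x)\<^sup>2 * (u x)\<^sup>2)\<^sup>2 \<le> (?M * ?\<mu>) * (?M * Z\<^sup>2)"
  proof -
    have "(\<Sum>x\<in>Pow A. (h x)\<^sup>2 * (u x)\<^sup>2)\<^sup>2 \<le> (\<Sum>x\<in>Pow A. ((h x)\<^sup>2)\<^sup>2) * (\<Sum>x\<in>Pow A. ((u x)\<^sup>2)\<^sup>2)"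
      by (rule cauchy_schwarz_sum)
    also have "(\<Sum>x\<in>Pow A. ((h x)\<^sup>2)\<^sup>2) = ?M * ?\<mu>" unfolding sumh2[symmetric] by (intro sum.cong refl) (simp only: hh)
    also have "(\<Sum>x\<in>Pow A. ((u x)\<^sup>2)\<^sup>2) = (\<Sum>x\<in>Pow A. (u x) ^ 4)" by simp
    finally show ?thesis using u4 mu by (meson mult_left_mono order_trans mult_nonneg_nonneg zero_le_power zero_le_numeral)
  qed
  have "((?M * Z)\<^sup>2)\<^sup>2 \<le> ((?M * ?\<mu>) * (\<Sum>x\<in>Pow A. (h x)\<^sup>2 * (u x)\<^sup>2))\<^sup>2"
    using 1 by (intro power_mono) auto
  also have "\<dots> \<le> (?M * ?\<mu>)\<^sup>2 * ((?M * ?\<mu>) * (?M * Z\<^sup>2))"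
    unfolding power_mult_distrib[of "?M * ?\<mu>"] using 2 by (intro mult_left_mono) auto
  finally have "?M ^ 4 * (Z\<^sup>2 * Z\<^sup>2) \<le> ?M ^ 4 * (?\<mu> ^ 3 * Z\<^sup>2)"
    by (simp only: power2_eq_square power3_eq_cube power4_eq_xxxx mult_ac)
  then have "Z\<^sup>2 * Z\<^sup>2 \<le> ?\<mu> ^ 3 * Z\<^sup>2" by simp
  then show "(\<Sum>S\<in>Pow A. of_bool (i \<in> S) * (c S)\<^sup>2 / 3 ^ card S)\<^sup>2 \<le> ?\<mu> ^ 3"
    unfolding Z_def[symmetric]
  proof (cases "Z = 0")
    case False
    then have "0 < Z\<^sup>2" by simp
    then show "Z\<^sup>2 \<le> ?\<mu> ^ 3" by (rule mult_right_le_imp_le[OF \<open>Z\<^sup>2 * Z\<^sup>2 \<le> ?\<mu> ^ 3 * Z\<^sup>2\<close>])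
  qed (use mu in simp)
qed

text \<open>If all influences were below \<open>s\<^sup>2\<close>, then \<open>kkl_level\<close>
  would make the weight on levels 1 to \<open>k\<close> small, while the levels above
  \<open>k\<close> are light because the total influence is the sum of the squared coefficients
  weighted by level. Together they would fall short of the variance. The dimension of the cube never
  enters.\<close>

theorem kkl:
  assumes v: "v > (0 :: real)" and K: "K > 0"
  shows "\<exists>\<delta>>0. \<forall>A f. finite A \<longrightarrow> antipodal A f \<ge> v \<longrightarrow> (\<Sum>i\<in>A. influence A i f) \<le> K \<longrightarrow> (\<exists>i\<in>A. influence A i f \<ge> \<delta>)"
proof -
  \<comment> \<open>\<open>k\<close> makes the bound \<open>K / k\<close> for the weight above level
    \<open>k\<close> less than \<open>v / 2\<close>; then \<open>s\<close> makes the bound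
    \<open>3 ^ k * s * K\<close> for the levels up to \<open>k\<close> equal to
    \<open>v / 2\<close>.\<close>
  obtain k :: nat where k: "real k > 2 * K / v" using reals_Archimedean2 by blast
  then have k0: "real k > 0" using v K by (meson divide_pos_pos less_trans mult_pos_pos zero_less_numeral)
  define s where "s = v / (2 * 3 ^ k * K)"
  have s: "s > 0" using v K by (simp add: s_def)
  have "\<exists>i\<in>A. influence A i f \<ge> s\<^sup>2"
    if A: "finite A" and a: "antipodal A f \<ge> v" and I: "(\<Sum>i\<in>A. influence A i f) \<le> K" for A f
  proof (rule ccontr)
    assume "\<not> ?thesis"
    then have small: "influence A i f < s\<^sup>2" if "i \<in> A" for i using that by auto
    obtain c where c: "\<And>x. x \<in> Pow A \<Longrightarrow> (if f x then 1 else - 1) = walsh A c x"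
      using walsh_exists[OF A, of "\<lambda>x. if f x then 1 else - 1"] by auto
    let ?I = "\<Sum>i\<in>A. influence A i f"
    let ?Z = "\<lambda>i. \<Sum>S\<in>Pow A. of_bool (i \<in> S) * (c S)\<^sup>2 / 3 ^ card S"
    have mu: "influence A i f \<ge> 0" for i unfolding influence_def by (intro divide_nonneg_nonneg sum_nonneg) auto
    have Z: "?Z i \<le> s * influence A i f" if i: "i \<in> A" for i
    proof (rule power2_le_imp_le)
      have "(?Z i)\<^sup>2 \<le> (influence A i f) ^ 3" by (rule kkl_level(2)[OF A i c])
      also have "\<dots> = influence A i f * (influence A i f)\<^sup>2" by (simp add: power3_eq_cube power2_eq_square)
      also have "\<dots> \<le> s\<^sup>2 * (influence A i f)\<^sup>2" using small[OF i] by (intro mult_right_mono) auto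
      finally show "(?Z i)\<^sup>2 \<le> (s * influence A i f)\<^sup>2" by (simp add: power_mult_distrib)
    qed (use s mu in simp)
    have swap: "(\<Sum>i\<in>A. \<Sum>S\<in>Pow A. of_bool (i \<in> S) * F S) = (\<Sum>S\<in>Pow A. real (card S) * F S)" for F
    proof -
      have "(\<Sum>i\<in>A. of_bool (i \<in> S) * F S) = real (card S) * F S" if "S \<in> Pow A" for S
      proof -
        have "(\<Sum>i\<in>A. of_bool (i \<in> S) * F S) = (\<Sum>i\<in>A \<inter> S. F S)"
          unfolding sum.inter_restrict[OF A] by (intro sum.cong) auto
        then show ?thesis using that by (simp add: Int_absorb1)
      qed
      then show ?thesis by (subst sum.swap) simp
    qed
    have I_eq: "?I = (\<Sum>S\<in>Pow A. real (card S) * (c S)\<^sup>2)"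
      unfolding swap[symmetric] by (intro sum.cong refl kkl_level(1)[OF A _ c])
    have Z_eq: "(\<Sum>S\<in>Pow A. real (card S) * ((c S)\<^sup>2 / 3 ^ card S)) \<le> s * ?I"
      unfolding swap[symmetric] sum_distrib_left by (intro sum_mono) (use Z in simp)
    have "antipodal A f \<le> (\<Sum>S\<in>Pow A - {{}}. (c S)\<^sup>2)" by (rule variance_bound[OF A c])
    also have "\<dots> \<le> (\<Sum>S\<in>Pow A - {{}}. 3 ^ k * (real (card S) * ((c S)\<^sup>2 / 3 ^ card S)) + (real (card S) * (c S)\<^sup>2) / k)"
    proof (rule sum_mono)
      fix S assume "S \<in> Pow A - {{}}"
      then have S: "card S \<ge> 1" using A by (auto simp: card_gt_0_iff Suc_le_eq finite_subset)
      show "(c S)\<^sup>2 \<le> 3 ^ k * (real (card S) * ((c S)\<^sup>2 / 3 ^ card S)) + (real (card S) * (c S)\<^sup>2) / k"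
      proof (cases "card S \<le> k")
        case True
        then have "1 \<le> (3 ^ k / 3 ^ card S :: real)" by (simp add: power_increasing)
        then have "1 * 1 \<le> (3 ^ k / 3 ^ card S) * real (card S)" using S by (intro mult_mono) auto
        then have "1 * (c S)\<^sup>2 \<le> ((3 ^ k / 3 ^ card S) * real (card S)) * (c S)\<^sup>2" by (intro mult_right_mono) auto
        moreover have "0 \<le> (real (card S) * (c S)\<^sup>2) / k" by simp
        moreover have "((3 ^ k / 3 ^ card S) * real (card S)) * (c S)\<^sup>2 = 3 ^ k * (real (card S) * ((c S)\<^sup>2 / 3 ^ card S))"
          by simp
        ultimately show ?thesis by linarith
      next
        case False
        then have "1 \<le> real (card S) / k" using k0 by simp
        then have "1 * (c S)\<^sup>2 \<le> (real (card S) / k) * (c S)\<^sup>2" by (intro mult_right_mono) auto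
        moreover have "0 \<le> 3 ^ k * (real (card S) * ((c S)\<^sup>2 / 3 ^ card S))" by simp
        moreover have "(real (card S) / k) * (c S)\<^sup>2 = (real (card S) * (c S)\<^sup>2) / k" by simp
        ultimately show ?thesis by linarith
      qed
    qed
    also have "\<dots> \<le> (\<Sum>S\<in>Pow A. 3 ^ k * (real (card S) * ((c S)\<^sup>2 / 3 ^ card S)) + (real (card S) * (c S)\<^sup>2) / k)"
      by (rule sum_mono2) (use A in auto)
    also have "\<dots> = 3 ^ k * (\<Sum>S\<in>Pow A. real (card S) * ((c S)\<^sup>2 / 3 ^ card S)) + ?I / k"
      unfolding I_eq by (simp add: sum.distrib sum_distrib_left sum_divide_distrib)
    also have "\<dots> \<le> 3 ^ k * (s * ?I) + ?I / k" using Z_eq by simp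
    also have "\<dots> \<le> 3 ^ k * (s * K) + K / k"
      using I s k0 by (intro add_mono mult_left_mono divide_right_mono) auto
    also have "3 ^ k * (s * K) = v / 2" using K by (simp add: s_def)
    also have "K / k < v / 2" using k k0 v by (simp add: field_simps)
    finally show False using a by simp
  qed
  then show ?thesis using s by (intro exI[of _ "s\<^sup>2"]) auto
qed

section \<open>Labelings from influential coordinates\<close>

definition disagreement :: "nat set \<Rightarrow> (nat set \<Rightarrow> bool) \<Rightarrow> (nat set \<Rightarrow> bool) \<Rightarrow> real" where
  "disagreement A f g = (\<Sum>x\<in>Pow A. of_bool (f x \<noteq> g x)) / 2 ^ card A"

lemma disagreement_nonneg: "0 \<le> disagreement A f g"
  unfolding disagreement_def by (intro divide_nonneg_nonneg sum_nonneg) auto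

lemma disagreement_le_1: "finite A \<Longrightarrow> disagreement A f g \<le> 1"
proof -
  assume A: "finite A"
  have "(\<Sum>x\<in>Pow A. of_bool (f x \<noteq> g x)) \<le> (\<Sum>x\<in>Pow A. 1 :: real)" by (intro sum_mono) auto
  then show ?thesis using A by (simp add: disagreement_def card_Pow)
qed

lemma influence_nonneg: "0 \<le> influence A i f"
  unfolding influence_def by (intro divide_nonneg_nonneg sum_nonneg) auto

lemma antipodal_nonneg: "0 \<le> antipodal A f"
  unfolding antipodal_def by (intro divide_nonneg_nonneg sum_nonneg) auto

lemma antipodal_le_1: "finite A \<Longrightarrow> antipodal A f \<le> 1"
proof -
  assume A: "finite A"
  have "(\<Sum>x\<in>Pow A. of_bool (f x \<noteq> f (A - x))) \<le> (\<Sum>x\<in>Pow A. 1 :: real)" by (intro sum_mono) auto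
  then show ?thesis using A by (simp add: antipodal_def card_Pow)
qed

text \<open>Changing a function at one point affects two terms of the influence, that of the point
  and that of its neighbour, hence the factor 2. This carries influential coordinates from one tied
  cube to another.\<close>

lemma influence_le_dis:
  assumes "finite A" "i \<in> A"
  shows "influence A i f \<le> influence A i g + 2 * disagreement A f g"
proof -
  have flip: "(\<Sum>x\<in>Pow A. of_bool (f (flip i x) \<noteq> g (flip i x))) = (\<Sum>x\<in>Pow A. of_bool (f x \<noteq> g x) :: real)"
    by (rule sum.reindex_bij_witness[of _ "flip i" "flip i"]) (use flip_Pow[OF assms(2)] in auto)
  have "(\<Sum>x\<in>Pow A. of_bool (f x \<noteq> f (flip i x))) \<le>
      (\<Sum>x\<in>Pow A. of_bool (g x \<noteq> g (flip i x)) + of_bool (f x \<noteq> g x) + of_bool (f (flip i x) \<noteq> g (flip i x)) :: real)"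
    by (intro sum_mono) auto
  also have "\<dots> = (\<Sum>x\<in>Pow A. of_bool (g x \<noteq> g (flip i x))) + 2 * (\<Sum>x\<in>Pow A. of_bool (f x \<noteq> g x))"
    unfolding sum.distrib flip by simp
  finally show ?thesis unfolding influence_def disagreement_def by (simp add: divide_right_mono add_divide_distrib[symmetric])
qed

lemma disagreement_sym: "disagreement A f g = disagreement A g f"
  unfolding disagreement_def by (simp add: eq_commute)

text \<open>The preimage of \<open>x\<close> under \<open>p\<close>. Composed with it, the dictator
  of coordinate \<open>j\<close> becomes the dictator of \<open>p j\<close>, in accordance with the
  direction of \<open>ug_perm\<close>, from labels of the right endpoint to labels of the left
  one.\<close>

definition pull :: "nat set \<Rightarrow> (nat \<Rightarrow> nat) \<Rightarrow> nat set \<Rightarrow> nat set" where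
  "pull A p x = {i \<in> A. p i \<in> x}"

lemma influence_pull:
  assumes p: "bij_betw p A A" and j: "j \<in> A" and "finite A"
  shows "influence A (p j) (\<lambda>x. f (pull A p x)) = influence A j f"
proof -
  have inj: "inj_on p A" and im: "p ` A = A" using p by (auto simp: bij_betw_def)
  have pull_flip: "pull A p (flip (p j) x) = flip j (pull A p x)" for x
    using j inj by (auto simp: pull_def flip_def inj_on_def)
  have "(\<Sum>x\<in>Pow A. of_bool (f (pull A p x) \<noteq> f (pull A p (flip (p j) x)))) =
      (\<Sum>x\<in>Pow A. of_bool (f x \<noteq> f (flip j x)) :: real)"
    unfolding pull_flip
  proof (rule sum.reindex_bij_witness[of _ "\<lambda>x. p ` x" "pull A p"])
    show "p ` pull A p x = x" if "x \<in> Pow A" for x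
      using that im by (auto simp: pull_def image_iff)
    show "pull A p (p ` x) = x" if "x \<in> Pow A" for x
      using that inj by (auto simp: pull_def inj_on_def)
  qed (use im in \<open>auto simp: pull_def\<close>)
  then show ?thesis by (simp add: influence_def)
qed

lemma card_influential:
  assumes "finite A" "(\<Sum>i\<in>A. influence A i f) \<le> K" "d > 0"
  shows "real (card {i \<in> A. influence A i f \<ge> d}) \<le> K / d"
proof -
  have "d * real (card {i \<in> A. influence A i f \<ge> d}) = (\<Sum>i\<in>{i \<in> A. influence A i f \<ge> d}. d)" by simp
  also have "\<dots> \<le> (\<Sum>i\<in>{i \<in> A. influence A i f \<ge> d}. influence A i f)" by (intro sum_mono) auto
  also have "\<dots> \<le> (\<Sum>i\<in>A. influence A i f)" by (intro sum_mono2) (use assms influence_nonneg in auto)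
  finally show ?thesis using assms by (simp add: pos_le_divide_eq mult.commute)
qed

text \<open>A labeling drawn uniformly from the product of the lists \<open>M v\<close> gives both
  ends of an edge their prescribed labels with probability at least \<open>1 / s\<^sup>2\<close>,
  the ends being distinct, and some labeling attains the expectation. Probabilities appear as counts
  in \<open>PiE V M\<close>.\<close>

lemma labeling_average:
  fixes w :: "'e \<Rightarrow> real" and M :: "'v \<Rightarrow> 'l set"
  assumes V: "finite V" and M: "\<And>v. v \<in> V \<Longrightarrow> finite (M v) \<and> M v \<noteq> {} \<and> real (card (M v)) \<le> s"
    and G: "finite G" "\<And>e. e \<in> G \<Longrightarrow> w e \<ge> 0 \<and> l e \<in> V \<and> r e \<in> V \<and> l e \<noteq> r e \<and> i e \<in> M (l e) \<and> j e \<in> M (r e)"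
    and s: "s > 0"
  shows "\<exists>h\<in>PiE V M. (\<Sum>e\<in>G. w e) / s\<^sup>2 \<le> (\<Sum>e\<in>G. w e * of_bool (h (l e) = i e \<and> h (r e) = j e))"
proof (rule ccontr)
  assume "\<not> ?thesis"
  then have less: "(\<Sum>e\<in>G. w e * of_bool (h (l e) = i e \<and> h (r e) = j e)) < (\<Sum>e\<in>G. w e) / s\<^sup>2" if "h \<in> PiE V M" for h
    using that by auto
  let ?P = "PiE V M"
  have fin: "finite ?P" using V M by (intro finite_PiE) auto
  have ne: "?P \<noteq> {}" using M by (auto simp: PiE_eq_empty_iff)
  have count: "real (card ?P) / s\<^sup>2 \<le> real (card {h \<in> ?P. h (l e) = i e \<and> h (r e) = j e})" if e: "e \<in> G" for e
  proof -
    let ?M = "M(l e := {i e}, r e := {j e})"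
    have e': "l e \<in> V" "r e \<in> V" "l e \<noteq> r e" "i e \<in> M (l e)" "j e \<in> M (r e)" using G(2)[OF e] by auto
    have "{h \<in> ?P. h (l e) = i e \<and> h (r e) = j e} = PiE V ?M"
      using e' by (auto simp: PiE_iff extensional_def split: if_splits)
    then have "card {h \<in> ?P. h (l e) = i e \<and> h (r e) = j e} = (\<Prod>v\<in>V. card (?M v))"
      using V by (simp add: card_PiE)
    also have "\<dots> = (\<Prod>v\<in>V - {l e} - {r e}. card (M v))"
    proof -
      have "(\<Prod>v\<in>V. card (?M v)) = card (?M (l e)) * (card (?M (r e)) * (\<Prod>v\<in>V - {l e} - {r e}. card (?M v)))"
        using V e' by (subst prod.remove[of V "l e"], simp, simp, subst prod.remove[of "V - {l e}" "r e"]) auto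
      then show ?thesis using e' by (auto intro!: prod.cong)
    qed
    finally have c: "card {h \<in> ?P. h (l e) = i e \<and> h (r e) = j e} = (\<Prod>v\<in>V - {l e} - {r e}. card (M v))" .
    have "card ?P = card (M (l e)) * (card (M (r e)) * (\<Prod>v\<in>V - {l e} - {r e}. card (M v)))"
      unfolding card_PiE[OF V] using V e'
      by (subst prod.remove[of V "l e"], simp, simp, subst prod.remove[of "V - {l e}" "r e"]) auto
    then have "real (card ?P) = real (card (M (l e))) * real (card (M (r e))) * real (\<Prod>v\<in>V - {l e} - {r e}. card (M v))"
      by simp
    also have "\<dots> \<le> (s * s) * real (\<Prod>v\<in>V - {l e} - {r e}. card (M v))"
      using M[OF e'(1)] M[OF e'(2)] s by (intro mult_right_mono mult_mono) (auto intro: prod_nonneg)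
    finally show ?thesis unfolding c using s by (simp add: field_simps power2_eq_square)
  qed
  have "real (card ?P) * ((\<Sum>e\<in>G. w e) / s\<^sup>2) = (\<Sum>e\<in>G. w e * (real (card ?P) / s\<^sup>2))"
    by (simp add: sum_distrib_right sum_divide_distrib mult_ac sum_distrib_left)
  also have "\<dots> \<le> (\<Sum>e\<in>G. w e * real (card {h \<in> ?P. h (l e) = i e \<and> h (r e) = j e}))"
    using G(2) count by (intro sum_mono mult_left_mono) auto
  also have "\<dots> = (\<Sum>e\<in>G. \<Sum>h\<in>?P. w e * of_bool (h (l e) = i e \<and> h (r e) = j e))"
  proof (intro sum.cong refl)
    fix e
    have "(\<Sum>h\<in>?P. w e * of_bool (h (l e) = i e \<and> h (r e) = j e)) = (\<Sum>h\<in>?P. if h (l e) = i e \<and> h (r e) = j e then w e else 0)"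
      by (intro sum.cong) auto
    also have "\<dots> = (\<Sum>h\<in>{h \<in> ?P. h (l e) = i e \<and> h (r e) = j e}. w e)"
      by (rule sum.inter_filter[symmetric, OF fin])
    finally show "w e * real (card {h \<in> ?P. h (l e) = i e \<and> h (r e) = j e}) = (\<Sum>h\<in>?P. w e * of_bool (h (l e) = i e \<and> h (r e) = j e))"
      by simp
  qed
  also have "\<dots> = (\<Sum>h\<in>?P. \<Sum>e\<in>G. w e * of_bool (h (l e) = i e \<and> h (r e) = j e))" by (rule sum.swap)
  also have "\<dots> < (\<Sum>h\<in>?P. (\<Sum>e\<in>G. w e) / s\<^sup>2)" by (intro sum_strict_mono fin ne less)
  also have "\<dots> = real (card ?P) * ((\<Sum>e\<in>G. w e) / s\<^sup>2)" by simp
  finally show False by simp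
qed

section \<open>Value of a unique game versus cost of functions on its cubes\<close>

definition ug_cost :: "nat \<Rightarrow> unique_game \<Rightarrow> real \<Rightarrow> (nat \<Rightarrow> nat set \<Rightarrow> bool) \<Rightarrow> (nat \<Rightarrow> nat set \<Rightarrow> bool) \<Rightarrow> nat \<Rightarrow> real" where
  "ug_cost N U \<Lambda> g f e = (\<Sum>i<N. influence {..<N} i (g e)) +
     \<Lambda> * (disagreement {..<N} (g e) (f (ug_left U e)) + disagreement {..<N} (g e) (\<lambda>x. f (ug_right U e) (pull {..<N} (ug_perm U e) x)))"

lemma ug_opt_ge:
  assumes "is_unique_game N U" "l \<in> {..<ug_verts U} \<rightarrow>\<^sub>E {..<N}"
  shows "ug_value U l \<le> ug_opt N U"
  unfolding ug_opt_def by (intro Max_ge finite_imageI finite_PiE) (use assms in auto)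

text \<open>Here \<open>q\<close> stands for the rounded weights. An edge outside \<open>G\<close>
  has a small antipodal part, a large total influence or a large disagreement; each of these kinds
  accounts for at most a quarter of \<kappa>, which leaves a quarter for \<open>G\<close>. On
  \<open>G\<close>, the coordinate found by \<open>kkl\<close> in the edge cube passes to both
  endpoint cubes.\<close>

lemma ug_soundness:
  assumes \<kappa>: "\<kappa> > (0::real)" and W0: "W0 > (0::real)"
  shows "\<exists>\<Lambda>0>(0::real). \<exists>\<zeta>>(0::real). \<forall>\<Lambda>\<ge>\<Lambda>0. \<forall>N U q g f. N > 0 \<longrightarrow> is_unique_game N U \<longrightarrow> of_rat (ug_opt N U) \<le> \<zeta> \<longrightarrow>
     (\<forall>e<ug_edges U. 0 \<le> q e \<and> q e \<le> 2 * of_rat (ug_wt U e)) \<longrightarrow>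
     \<kappa> \<le> (\<Sum>e<ug_edges U. q e * antipodal {..<N} (g e)) \<longrightarrow>
     W0 < (\<Sum>e<ug_edges U. q e * ug_cost N U \<Lambda> g f e)"
proof -
  \<comment> \<open>By Markov's inequality, edges with total influence above \<open>K\<close> have
    \<open>q\<close>-weight at most \<open>W0 / K = \<kappa> / 4\<close>. Below, \<Lambda>0 plays
    the same role for a disagreement above \<tau>.\<close>
  define K where "K = 4 * W0 / \<kappa>"
  have K: "K > 0" using \<kappa> W0 by (simp add: K_def)
  have "\<kappa> / 8 > 0" using \<kappa> by simp
  from kkl[OF this K] obtain \<delta> where \<delta>: "\<delta> > 0" and kkl: "\<And>A f. finite A \<Longrightarrow> antipodal A f \<ge> \<kappa> / 8 \<Longrightarrow>
      (\<Sum>i\<in>A. influence A i f) \<le> K \<Longrightarrow> (\<exists>i\<in>A. influence A i f \<ge> \<delta>)"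
    by blast
  \<comment> \<open>A disagreement of \<tau> shifts an influence by at most a quarter of \<delta>:
    from \<delta> in the edge cube to at least half of it in the endpoint cubes, and from one half
    there back to at least one quarter. The last value bounds the number of candidates by
    \<open>4 * K / \<delta>\<close>, hence the form of \<open>s\<close>.\<close>
  define \<tau> where "\<tau> = \<delta> / 8"
  define \<Lambda>0 where "\<Lambda>0 = 4 * W0 / (\<kappa> * \<tau>)"
  define s where "s = 4 * K / \<delta> + 1"
  define \<zeta> where "\<zeta> = \<kappa> / (16 * s\<^sup>2)"
  have \<tau>: "\<tau> > 0" using \<delta> by (simp add: \<tau>_def)
  have s: "s \<ge> 1" "s > 0" using K \<delta> by (auto simp: s_def add_pos_pos)
  have \<Lambda>0: "\<Lambda>0 > 0" using \<kappa> W0 \<tau> by (simp add: \<Lambda>0_def)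
  have \<zeta>: "\<zeta> > 0" using \<kappa> s by (simp add: \<zeta>_def)
  have "W0 < (\<Sum>e<ug_edges U. q e * ug_cost N U \<Lambda> g f e)"
    if \<Lambda>: "\<Lambda> \<ge> \<Lambda>0" and N: "N > 0" and U: "is_unique_game N U" and opt: "of_rat (ug_opt N U) \<le> \<zeta>"
      and q: "\<forall>e<ug_edges U. 0 \<le> q e \<and> q e \<le> 2 * of_rat (ug_wt U e)"
      and ant: "\<kappa> \<le> (\<Sum>e<ug_edges U. q e * antipodal {..<N} (g e))" for \<Lambda> N U q g f
  proof (rule ccontr)
    assume "\<not> ?thesis"
    then have cost: "(\<Sum>e<ug_edges U. q e * ug_cost N U \<Lambda> g f e) \<le> W0" by simp
    let ?A = "{..<N}" and ?E = "{..<ug_edges U}"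
    define I where "I e = (\<Sum>i<N. influence ?A i (g e))" for e
    define dl where "dl e = disagreement ?A (g e) (f (ug_left U e))" for e
    define dr where "dr e = disagreement ?A (g e) (\<lambda>x. f (ug_right U e) (pull ?A (ug_perm U e) x))" for e
    define w where "w e = (of_rat (ug_wt U e) :: real)" for e
    have wt1: "(\<Sum>e\<in>?E. w e) = 1"
      using U by (simp add: is_unique_game_def w_def of_rat_sum[symmetric])
    have w0: "w e \<ge> 0" if "e < ug_edges U" for e
      using U that by (simp add: is_unique_game_def w_def less_imp_le)
    have q0: "0 \<le> q e" "q e \<le> 2 * w e" if "e < ug_edges U" for e using q that by (auto simp: w_def)
    have I0: "0 \<le> I e" and d0: "0 \<le> dl e" "0 \<le> dr e" for e
      by (auto simp: I_def dl_def dr_def intro!: sum_nonneg influence_nonneg disagreement_nonneg)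
    have L0: "\<Lambda> \<ge> 0" using \<Lambda> \<Lambda>0 by linarith
    have cost': "(\<Sum>e\<in>?E. q e * (I e + \<Lambda> * (dl e + dr e))) \<le> W0"
      using cost by (simp add: ug_cost_def I_def dl_def dr_def)
    have costI: "(\<Sum>e\<in>?E. q e * I e) \<le> W0"
      by (rule order_trans[OF sum_mono cost']) (use q0 L0 d0 in \<open>auto intro!: mult_left_mono\<close>)
    have costd: "(\<Sum>e\<in>?E. q e * (\<Lambda> * (dl e + dr e))) \<le> W0"
      by (rule order_trans[OF sum_mono cost']) (use q0 L0 d0 I0 in \<open>auto intro!: mult_left_mono\<close>)
    define G where "G = {e \<in> ?E. antipodal ?A (g e) \<ge> \<kappa> / 8 \<and> I e \<le> K \<and> dl e + dr e \<le> \<tau>}"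
    have G: "finite G" "G \<subseteq> ?E" by (auto simp: G_def)
    have "\<kappa> \<le> (\<Sum>e\<in>?E. q e * antipodal ?A (g e))" using ant by simp
    \<comment> \<open>The bound holds edge by edge: whichever of the four cases applies to
      \<open>e\<close>, the corresponding summand alone dominates the left-hand side.\<close>
    also have "\<dots> \<le> (\<Sum>e\<in>?E. w e * (\<kappa> / 4) + q e * I e * (1 / K) + q e * (\<Lambda> * (dl e + dr e)) * (1 / (\<Lambda>0 * \<tau>)) + q e * of_bool (e \<in> G))"
    proof (rule sum_mono)
      fix e assume e: "e \<in> ?E"
      then have qe: "0 \<le> q e" "q e \<le> 2 * w e" "0 \<le> w e" using q0 w0 by auto
      have nn: "0 \<le> w e * (\<kappa> / 4)" "0 \<le> q e * I e * (1 / K)" "0 \<le> q e * (\<Lambda> * (dl e + dr e)) * (1 / (\<Lambda>0 * \<tau>))" "0 \<le> q e * of_bool (e \<in> G)"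
        using qe \<kappa> I0 K d0 L0 \<Lambda>0 \<tau> by auto
      have a1: "q e * antipodal ?A (g e) \<le> q e * 1" using qe antipodal_le_1[of ?A "g e"] by (intro mult_left_mono) auto
      consider "antipodal ?A (g e) < \<kappa> / 8" | "I e > K" | "dl e + dr e > \<tau>" | "e \<in> G" using e unfolding G_def by force
      then show "q e * antipodal ?A (g e) \<le> w e * (\<kappa> / 4) + q e * I e * (1 / K) + q e * (\<Lambda> * (dl e + dr e)) * (1 / (\<Lambda>0 * \<tau>)) + q e * of_bool (e \<in> G)"
      proof cases
        case 1
        then have "q e * antipodal ?A (g e) \<le> (2 * w e) * (\<kappa> / 8)"
          using qe antipodal_nonneg by (intro mult_mono) auto
        moreover have "(2 * w e) * (\<kappa> / 8) = w e * (\<kappa> / 4)" by simp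
        ultimately show ?thesis using nn by linarith
      next
        case 2
        then have "q e * 1 \<le> q e * (I e * (1 / K))" using qe K by (intro mult_left_mono) (auto simp: field_simps)
        then show ?thesis using nn a1 by (simp add: mult.assoc)
      next
        case 3
        then have "\<Lambda>0 * \<tau> \<le> \<Lambda> * (dl e + dr e)" using \<Lambda> \<Lambda>0 \<tau> by (intro mult_mono) auto
        then have "1 \<le> \<Lambda> * (dl e + dr e) * (1 / (\<Lambda>0 * \<tau>))" using \<Lambda>0 \<tau> by (simp add: field_simps)
        then have "q e * 1 \<le> q e * (\<Lambda> * (dl e + dr e) * (1 / (\<Lambda>0 * \<tau>)))" using qe by (intro mult_left_mono) auto
        then show ?thesis using nn a1 by (simp add: mult.assoc)
      next
        case 4
        then show ?thesis using nn a1 by simp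
      qed
    qed
    also have "\<dots> = (\<Sum>e\<in>?E. w e) * (\<kappa> / 4) + (\<Sum>e\<in>?E. q e * I e) * (1 / K) +
        (\<Sum>e\<in>?E. q e * (\<Lambda> * (dl e + dr e))) * (1 / (\<Lambda>0 * \<tau>)) + (\<Sum>e\<in>?E. q e * of_bool (e \<in> G))"
      by (simp only: sum.distrib sum_distrib_right)
    also have "\<dots> \<le> 1 * (\<kappa> / 4) + W0 * (1 / K) + W0 * (1 / (\<Lambda>0 * \<tau>)) + (\<Sum>e\<in>?E. q e * of_bool (e \<in> G))"
      using wt1 costI costd K \<Lambda>0 \<tau> \<kappa> by (intro add_mono mult_right_mono) auto
    also have "W0 * (1 / K) = \<kappa> / 4" using W0 \<kappa> by (simp add: K_def)
    also have "W0 * (1 / (\<Lambda>0 * \<tau>)) = \<kappa> / 4" using W0 \<kappa> \<tau> by (simp add: \<Lambda>0_def)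
    also have "(\<Sum>e\<in>?E. q e * of_bool (e \<in> G)) = (\<Sum>e\<in>G. q e)"
    proof -
      have "(\<Sum>e\<in>?E. q e * of_bool (e \<in> G)) = (\<Sum>e\<in>?E. if e \<in> G then q e else 0)" by (intro sum.cong) auto
      also have "\<dots> = (\<Sum>e\<in>?E \<inter> G. q e)" by (rule sum.inter_restrict[symmetric]) simp
      finally show ?thesis using G by (simp add: Int_absorb1)
    qed
    also have "(\<Sum>e\<in>G. q e) \<le> (\<Sum>e\<in>G. 2 * w e)" using G q0 by (intro sum_mono) auto
    also have "\<dots> = 2 * (\<Sum>e\<in>G. w e)" by (simp add: sum_distrib_left)
    finally have Gw: "\<kappa> / 8 \<le> (\<Sum>e\<in>G. w e)" by simp
    define L where "L v = {i \<in> ?A. influence ?A i (f v) \<ge> \<delta> / 2}" for v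
    \<comment> \<open>The fallback \<open>{0}\<close> makes the lists nonempty and short at vertices
      that touch no edge of \<open>G\<close>; it consists of a legal label because
      \<open>N > 0\<close>.\<close>
    define M where "M v = (if L v = {} \<or> real (card (L v)) > s then {0} else L v)" for v
    have edge: "\<exists>i j. i \<in> M (ug_left U e) \<and> j \<in> M (ug_right U e) \<and> i = ug_perm U e j" if e: "e \<in> G" for e
    proof -
      let ?l = "ug_left U e" and ?r = "ug_right U e" and ?p = "ug_perm U e"
      have p: "bij_betw ?p ?A ?A" using U e G by (auto simp: is_unique_game_def)
      have eG: "antipodal ?A (g e) \<ge> \<kappa> / 8" "(\<Sum>i\<in>?A. influence ?A i (g e)) \<le> K" "dl e \<le> \<tau>" "dr e \<le> \<tau>"
        using e d0[of e] by (auto simp: G_def I_def)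
      obtain i where i: "i \<in> ?A" "influence ?A i (g e) \<ge> \<delta>" using kkl[OF _ eG(1,2)] by auto
      obtain j where j: "j \<in> ?A" "?p j = i" using p i by (metis bij_betw_imp_surj_on imageE)
      have "influence ?A i (g e) \<le> influence ?A i (f ?l) + 2 * dl e"
        unfolding dl_def by (rule influence_le_dis) (use i in auto)
      then have il: "i \<in> L ?l" using i eG(3) \<tau> by (auto simp: L_def \<tau>_def)
      have "influence ?A i (g e) \<le> influence ?A i (\<lambda>x. f ?r (pull ?A ?p x)) + 2 * dr e"
        unfolding dr_def by (rule influence_le_dis) (use i in auto)
      moreover have "influence ?A i (\<lambda>x. f ?r (pull ?A ?p x)) = influence ?A j (f ?r)"
        using influence_pull[OF p j(1), of "f ?r"] j(2) by simp
      ultimately have jr: "j \<in> L ?r" using i j eG(4) \<tau> by (auto simp: L_def \<tau>_def)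
      \<comment> \<open>The vertex cubes carry no hypercube edges, so nothing bounds their total
        influence directly. Their lists are short because every candidate is still influential in
        the tied edge cube, whose total influence is at most \<open>K\<close>.\<close>
      have "real (card {i \<in> ?A. influence ?A i (g e) \<ge> \<delta> / 4}) \<le> K / (\<delta> / 4)"
        by (rule card_influential[OF _ eG(2)]) (use \<delta> in auto)
      then have card4: "real (card {i \<in> ?A. influence ?A i (g e) \<ge> \<delta> / 4}) \<le> 4 * K / \<delta>"
        by (simp add: mult.commute)
      have "L ?l \<subseteq> {i \<in> ?A. influence ?A i (g e) \<ge> \<delta> / 4}"
      proof
        fix k assume k: "k \<in> L ?l"
        have "influence ?A k (f ?l) \<le> influence ?A k (g e) + 2 * dl e"
          unfolding dl_def disagreement_sym[of _ "g e"] by (rule influence_le_dis) (use k in \<open>auto simp: L_def\<close>)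
        then show "k \<in> {i \<in> ?A. influence ?A i (g e) \<ge> \<delta> / 4}" using k eG(3) by (auto simp: L_def \<tau>_def)
      qed
      then have "card (L ?l) \<le> card {i \<in> ?A. influence ?A i (g e) \<ge> \<delta> / 4}" by (intro card_mono) auto
      then have cl: "real (card (L ?l)) \<le> s" using card4 unfolding s_def by linarith
      have "?p ` L ?r \<subseteq> {i \<in> ?A. influence ?A i (g e) \<ge> \<delta> / 4}"
      proof
        fix y assume "y \<in> ?p ` L ?r"
        then obtain k where k: "k \<in> L ?r" "y = ?p k" by auto
        have kA: "k \<in> ?A" using k by (auto simp: L_def)
        then have yA: "y \<in> ?A" using p k by (auto simp: bij_betw_def)
        have "influence ?A y (\<lambda>x. f ?r (pull ?A ?p x)) \<le> influence ?A y (g e) + 2 * dr e"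
          unfolding dr_def disagreement_sym[of _ "g e"] by (rule influence_le_dis) (use yA in auto)
        moreover have "influence ?A y (\<lambda>x. f ?r (pull ?A ?p x)) = influence ?A k (f ?r)"
          using influence_pull[OF p kA, of "f ?r"] k(2) by simp
        ultimately show "y \<in> {i \<in> ?A. influence ?A i (g e) \<ge> \<delta> / 4}" using k yA eG(4) by (auto simp: L_def \<tau>_def)
      qed
      then have "card (?p ` L ?r) \<le> card {i \<in> ?A. influence ?A i (g e) \<ge> \<delta> / 4}" by (intro card_mono) auto
      moreover have "card (?p ` L ?r) = card (L ?r)"
        by (rule card_image) (use p in \<open>auto simp: bij_betw_def L_def intro: inj_on_subset\<close>)
      ultimately have cr: "real (card (L ?r)) \<le> s" using card4 unfolding s_def by linarith
      show ?thesis using il jr cl cr j by (intro exI[of _ i] exI[of _ j]) (auto simp: M_def)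
    qed
    then have "\<exists>i j. \<forall>e\<in>G. i e \<in> M (ug_left U e) \<and> j e \<in> M (ug_right U e) \<and> i e = ug_perm U e (j e)" by metis
    then obtain i j where ij: "\<And>e. e \<in> G \<Longrightarrow> i e \<in> M (ug_left U e) \<and> j e \<in> M (ug_right U e) \<and> i e = ug_perm U e (j e)" by blast
    have "\<exists>h\<in>PiE {..<ug_verts U} M. (\<Sum>e\<in>G. w e) / s\<^sup>2 \<le>
        (\<Sum>e\<in>G. w e * of_bool (h (ug_left U e) = i e \<and> h (ug_right U e) = j e))"
    proof (rule labeling_average)
      show "finite (M v) \<and> M v \<noteq> {} \<and> real (card (M v)) \<le> s" for v
        using s by (auto simp: M_def L_def)
      show "w e \<ge> 0 \<and> ug_left U e \<in> {..<ug_verts U} \<and> ug_right U e \<in> {..<ug_verts U} \<and> ug_left U e \<noteq> ug_right U e \<and>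
          i e \<in> M (ug_left U e) \<and> j e \<in> M (ug_right U e)" if "e \<in> G" for e
        using that ij[OF that] w0 U G by (auto simp: is_unique_game_def)
    qed (use G s in auto)
    then obtain l where l: "l \<in> PiE {..<ug_verts U} M" and lv: "(\<Sum>e\<in>G. w e) / s\<^sup>2 \<le>
        (\<Sum>e\<in>G. w e * of_bool (l (ug_left U e) = i e \<and> l (ug_right U e) = j e))" by blast
    have "M v \<subseteq> ?A" for v using N by (auto simp: M_def L_def)
    then have l': "l \<in> {..<ug_verts U} \<rightarrow>\<^sub>E {..<N}" using l PiE_mono[of "{..<ug_verts U}" M "\<lambda>_. ?A"] by blast
    have "(\<Sum>e\<in>G. w e * of_bool (l (ug_left U e) = i e \<and> l (ug_right U e) = j e)) \<le>
        (\<Sum>e\<in>?E. w e * of_bool (l (ug_left U e) = ug_perm U e (l (ug_right U e))))"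
    proof -
      have "(\<Sum>e\<in>G. w e * of_bool (l (ug_left U e) = i e \<and> l (ug_right U e) = j e)) \<le>
        (\<Sum>e\<in>G. w e * of_bool (l (ug_left U e) = ug_perm U e (l (ug_right U e))))"
        using G w0 ij by (intro sum_mono mult_left_mono) auto
      also have "\<dots> \<le> (\<Sum>e\<in>?E. w e * of_bool (l (ug_left U e) = ug_perm U e (l (ug_right U e))))"
        using G w0 by (intro sum_mono2) auto
      finally show ?thesis .
    qed
    also have "\<dots> = of_rat (ug_value U l)"
    proof -
      have "(\<Sum>e\<in>?E. w e * of_bool (l (ug_left U e) = ug_perm U e (l (ug_right U e)))) =
         (\<Sum>e\<in>?E. if l (ug_left U e) = ug_perm U e (l (ug_right U e)) then w e else 0)" by (intro sum.cong) auto
      also have "\<dots> = (\<Sum>e\<in>{e\<in>?E. l (ug_left U e) = ug_perm U e (l (ug_right U e))}. w e)"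
        by (rule sum.inter_filter[symmetric]) simp
      finally show ?thesis by (simp add: ug_value_def w_def of_rat_sum)
    qed
    also have "\<dots> \<le> of_rat (ug_opt N U)" using ug_opt_ge[OF U l'] by (simp add: of_rat_less_eq)
    finally have "(\<Sum>e\<in>G. w e) / s\<^sup>2 \<le> \<zeta>" using lv opt by linarith
    moreover have "\<kappa> / 8 / s\<^sup>2 \<le> (\<Sum>e\<in>G. w e) / s\<^sup>2" using Gw by (intro divide_right_mono) auto
    moreover have "\<zeta> < \<kappa> / 8 / s\<^sup>2" using \<kappa> s by (simp add: \<zeta>_def field_simps)
    ultimately show False by linarith
  qed
  then show ?thesis using \<Lambda>0 \<zeta> by (intro exI[of _ \<Lambda>0] conjI exI[of _ \<zeta>]) auto
qed

text \<open>An edge cube gets the dictator of the label of its left endpoint. So the tie to the left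
  costs nothing, the tie to the right costs something only if the edge is violated, and every point
  is separated from its antipode. The factors 2 in the bound come from the rounding of the
  weights.\<close>

lemma ug_completeness:
  assumes U: "is_unique_game N U" and N: "N > 0" and opt: "of_rat (ug_opt N U) \<ge> 1 - \<eta>" and \<Lambda>: "\<Lambda> \<ge> 0"
    and q: "\<forall>e<ug_edges U. 0 \<le> q e \<and> q e \<le> 2 * of_rat (ug_wt U e)"
  shows "\<exists>g f. (\<forall>e x. x \<subseteq> {..<N} \<longrightarrow> e < ug_edges U \<longrightarrow> g e x \<noteq> g e ({..<N} - x)) \<and>
     (\<Sum>e<ug_edges U. q e * ug_cost N U \<Lambda> g f e) \<le> 2 + 2 * \<Lambda> * (\<eta> :: real)"
proof -
  let ?A = "{..<N}" and ?E = "{..<ug_edges U}"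
  let ?P = "{..<ug_verts U} \<rightarrow>\<^sub>E ?A"
  have "ug_opt N U \<in> ug_value U ` ?P"
    unfolding ug_opt_def by (intro Max_in) (use N in \<open>auto intro!: finite_imageI finite_PiE simp: PiE_eq_empty_iff\<close>)
  then obtain l where l: "l \<in> ?P" "ug_value U l = ug_opt N U" by auto
  define g where "g e x = (l (ug_left U e) \<in> x)" for e x
  define f where "f v x = (l v \<in> x)" for v and x :: "nat set"
  let ?sat = "\<lambda>e. l (ug_left U e) = ug_perm U e (l (ug_right U e))"
  define w where "w e = (of_rat (ug_wt U e) :: real)" for e
  have wt1: "(\<Sum>e\<in>?E. w e) = 1"
    using U by (simp add: is_unique_game_def w_def of_rat_sum[symmetric])
  have lA: "l (ug_left U e) \<in> ?A" "l (ug_right U e) \<in> ?A" if "e < ug_edges U" for e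
    using U l that by (auto simp: is_unique_game_def PiE_iff)
  have cost: "ug_cost N U \<Lambda> g f e \<le> 1 + \<Lambda> * of_bool (\<not> ?sat e)" if e: "e < ug_edges U" for e
  proof -
    have "influence ?A i (g e) = of_bool (i = l (ug_left U e))" if "i \<in> ?A" for i
    proof -
      have "(g e x \<noteq> g e (flip i x)) = (i = l (ug_left U e))" for x
        by (auto simp: g_def flip_def)
      then show ?thesis by (simp add: influence_def card_Pow)
    qed
    then have "(\<Sum>i<N. influence ?A i (g e)) = (\<Sum>i<N. if i = l (ug_left U e) then 1 else 0)"
      by (intro sum.cong) auto
    then have 1: "(\<Sum>i<N. influence ?A i (g e)) = 1" using lA[OF e] by simp
    have 2: "disagreement ?A (g e) (f (ug_left U e)) = 0" by (simp add: disagreement_def g_def f_def)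
    have 3: "disagreement ?A (g e) (\<lambda>x. f (ug_right U e) (pull ?A (ug_perm U e) x)) \<le> of_bool (\<not> ?sat e)"
    proof (cases "?sat e")
      case True
      then have "g e x = f (ug_right U e) (pull ?A (ug_perm U e) x)" for x
        using lA[OF e] by (auto simp: g_def f_def pull_def)
      then show ?thesis by (simp add: disagreement_def)
    qed (use disagreement_le_1[of ?A] in auto)
    show ?thesis unfolding ug_cost_def 1 2 using mult_left_mono[OF 3 \<Lambda>] by simp
  qed
  have "(\<Sum>e\<in>?E. w e * of_bool (\<not> ?sat e)) = (\<Sum>e\<in>?E. w e) - (\<Sum>e\<in>?E. if ?sat e then w e else 0)"
    unfolding sum_subtractf[symmetric] by (intro sum.cong) auto
  also have "(\<Sum>e\<in>?E. if ?sat e then w e else 0) = (\<Sum>e\<in>{e\<in>?E. ?sat e}. w e)"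
    by (rule sum.inter_filter[symmetric]) simp
  also have "\<dots> = of_rat (ug_value U l)" by (simp add: ug_value_def w_def of_rat_sum)
  finally have unsat: "(\<Sum>e\<in>?E. w e * of_bool (\<not> ?sat e)) \<le> \<eta>" using wt1 l opt by simp
  have "(\<Sum>e\<in>?E. q e * ug_cost N U \<Lambda> g f e) \<le> (\<Sum>e\<in>?E. 2 * w e + 2 * \<Lambda> * (w e * of_bool (\<not> ?sat e)))"
  proof (rule sum_mono)
    fix e assume "e \<in> ?E"
    then have e: "e < ug_edges U" by simp
    have "q e * ug_cost N U \<Lambda> g f e \<le> q e * (1 + \<Lambda> * of_bool (\<not> ?sat e))"
      using q e cost by (intro mult_left_mono) auto
    also have "\<dots> \<le> (2 * w e) * (1 + \<Lambda> * of_bool (\<not> ?sat e))"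
      using q e \<Lambda> by (intro mult_right_mono) (auto simp: w_def)
    finally show "q e * ug_cost N U \<Lambda> g f e \<le> 2 * w e + 2 * \<Lambda> * (w e * of_bool (\<not> ?sat e))"
      by (simp add: algebra_simps)
  qed
  also have "\<dots> = 2 * (\<Sum>e\<in>?E. w e) + 2 * \<Lambda> * (\<Sum>e\<in>?E. w e * of_bool (\<not> ?sat e))"
    by (simp only: sum.distrib sum_distrib_left)
  also have "\<dots> \<le> 2 + 2 * \<Lambda> * \<eta>" using wt1 unsat \<Lambda> by (simp add: mult_left_mono)
  finally have "(\<Sum>e<ug_edges U. q e * ug_cost N U \<Lambda> g f e) \<le> 2 + 2 * \<Lambda> * \<eta>" .
  moreover have "g e x \<noteq> g e (?A - x)" if "x \<subseteq> ?A" "e < ug_edges U" for e x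
    using lA[OF that(2)] by (auto simp: g_def)
  ultimately show ?thesis by blast
qed

section \<open>The cut graph of a unique game\<close>

text \<open>Weights and demands are given by the larger and the smaller end of an edge, in the
  triangular order in which \<open>enc_cut_graph\<close> lists them.\<close>

lemma sum_cg_edges:
  fixes F :: "nat \<Rightarrow> nat \<Rightarrow> 'a :: comm_monoid_add"
  shows "(\<Sum>e\<in>{e. e \<subseteq> {..<M} \<and> card e = 2}. F (Max e) (Min e)) = (\<Sum>j<M. \<Sum>i<j. F j i)"
proof -
  have "(\<Sum>j<M. \<Sum>i<j. F j i) = (\<Sum>(j, i)\<in>(SIGMA j:{..<M}. {..<j}). F j i)"
    by (simp add: sum.Sigma)
  also have "\<dots> = (\<Sum>e\<in>{e. e \<subseteq> {..<M} \<and> card e = 2}. F (Max e) (Min e))"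
  proof (rule sum.reindex_bij_witness[of _ "\<lambda>e. (Max e, Min e)" "\<lambda>(j, i). {i, j}"])
    fix e :: "nat set" assume "e \<in> {e. e \<subseteq> {..<M} \<and> card e = 2}"
    then obtain a b where "e = {a, b}" "a \<noteq> b" "a < M" "b < M" by (auto simp: card_2_iff)
    then show "(\<lambda>(j, i). {i, j}) (Max e, Min e) = e" "(Max e, Min e) \<in> (SIGMA j:{..<M}. {..<j})"
      by (auto simp: max_def min_def)
  qed (auto simp: max_def min_def)
  finally show ?thesis by simp
qed

lemma sum_cells:
  fixes F :: "nat \<Rightarrow> 'a :: comm_monoid_add"
  shows "(\<Sum>p<B * Q. F p) = (\<Sum>u<B. \<Sum>x<Q. F (u * Q + x))"
proof -
  have "sum F {u * Q..<u * Q + Q} = (\<Sum>x<Q. F (u * Q + x))" for u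
    using sum.shift_bounds_nat_ivl[of F 0 "u * Q" Q] by (simp add: atLeast0LessThan add.commute)
  then show ?thesis using sum.nat_group[of F Q B] by simp
qed

lemma sum_below_cell:
  fixes F :: "nat \<Rightarrow> 'a :: comm_monoid_add"
  shows "(\<Sum>p<u * Q + x. F p) = (\<Sum>u'<u. \<Sum>y<Q. F (u' * Q + y)) + (\<Sum>y<x. F (u * Q + y))"
proof -
  have "(\<Sum>p<u * Q + x. F p) = (\<Sum>p<u * Q. F p) + (\<Sum>p\<in>{u * Q..<u * Q + x}. F p)"
    by (metis le_add1 lessThan_atLeast0 sum.atLeastLessThan_concat zero_le)
  also have "(\<Sum>p\<in>{u * Q..<u * Q + x}. F p) = (\<Sum>y<x. F (u * Q + y))"
    using sum.shift_bounds_nat_ivl[of F 0 "u * Q" x] by (simp add: atLeast0LessThan add.commute)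
  finally show ?thesis by (simp add: sum_cells)
qed

lemma sum_triangle:
  fixes F :: "nat \<Rightarrow> nat \<Rightarrow> real"
  assumes "\<And>x y. x < Q \<Longrightarrow> y < Q \<Longrightarrow> F x y = F y x" "\<And>x. x < Q \<Longrightarrow> F x x = 0"
  shows "2 * (\<Sum>x<Q. \<Sum>y<x. F x y) = (\<Sum>x<Q. \<Sum>y<Q. F x y)"
  using assms
proof (induction Q)
  case (Suc Q)
  have "(\<Sum>x<Suc Q. \<Sum>y<Suc Q. F x y) = (\<Sum>x<Q. \<Sum>y<Q. F x y) + (\<Sum>x<Q. F x Q) + (\<Sum>y<Q. F Q y) + F Q Q"
    by (simp add: sum.distrib)
  also have "(\<Sum>x<Q. F x Q) = (\<Sum>y<Q. F Q y)" using Suc.prems(1) by (intro sum.cong) auto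
  finally show ?case using Suc by (simp add: algebra_simps)
qed simp

text \<open>\<open>kk e\<close> is the exponent of the rounded weight of edge \<open>e\<close>,
  \<open>lam\<close> the exponent of the factor by which ties are heavier, \<open>gw\<close> and
  \<open>gd\<close> are the exponents of weight and demand of the deciding pair. \<open>pts\<close>
  fixes a numbering of the cube points.\<close>

locale ug_reduction =
  fixes N :: nat and U :: unique_game and pts :: "nat set list" and kk :: "nat \<Rightarrow> nat" and lam gw gd :: nat
  assumes N: "N > 0" and U: "is_unique_game N U" and pts: "distinct pts" "set pts = Pow {..<N}"
begin

abbreviation "n \<equiv> ug_verts U"
abbreviation "m \<equiv> ug_edges U"
abbreviation "A \<equiv> {..<N}"
abbreviation "Q \<equiv> length pts"

lemma Q: "Q = 2 ^ N"
  using distinct_card[OF pts(1)] by (simp add: pts(2) card_Pow)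

lemma Q2: "Q \<ge> 2"
  using N power_increasing[of 1 N "2::nat"] by (simp add: Q)

text \<open>Vertex \<open>u * Q + x\<close> of the cut graph is the point \<open>pts ! x\<close> of cell \<open>u\<close>. Cell \<open>0\<close> contains the
  deciding pair, cell \<open>v + 1\<close> belongs to the vertex \<open>v\<close>, cell \<open>n + 1 + e\<close> to the edge \<open>e\<close> of the game.
  The functions below are only used for \<open>u * Q + x > u' * Q + y\<close>.\<close>

definition cwt :: "nat \<Rightarrow> nat \<Rightarrow> nat \<Rightarrow> nat \<Rightarrow> nat" where
  "cwt u x u' y =
    (if u = u' then
       (if u = 0 then (if x = 1 \<and> y = 0 then 2 ^ gw else 0)
        else if u \<le> n then 0
        else if \<exists>i<N. pts ! y = flip i (pts ! x) then 2 ^ kk (u - n - 1) else 0)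
     else if n < u \<and> 0 < u' \<and> u' \<le> n \<and>
       (u' - 1 = ug_left U (u - n - 1) \<and> x = y \<or>
        u' - 1 = ug_right U (u - n - 1) \<and> pts ! y = pull A (ug_perm U (u - n - 1)) (pts ! x))
     then 2 ^ (lam + kk (u - n - 1)) else 0)"

definition cdem :: "(nat \<Rightarrow> bool) \<Rightarrow> nat \<Rightarrow> nat \<Rightarrow> nat \<Rightarrow> nat \<Rightarrow> nat" where
  "cdem rem u x u' y =
    (if u = u' then
       (if u = 0 then (if x = 1 \<and> y = 0 then 2 ^ gd else 0)
        else if u \<le> n then 0
        else if pts ! y = A - pts ! x \<and> \<not> rem (u * Q + x) then 2 ^ kk (u - n - 1) else 0)
     else 0)"

definition ncells :: nat where "ncells = 1 + n + m"

definition cell_fun :: "(nat \<Rightarrow> nat \<Rightarrow> nat \<Rightarrow> nat \<Rightarrow> nat) \<Rightarrow> nat \<Rightarrow> nat \<Rightarrow> nat" where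
  "cell_fun c j i = c (j div Q) (j mod Q) (i div Q) (i mod Q)"

definition graph :: "(nat \<Rightarrow> bool) \<Rightarrow> cut_graph" where
  "graph rem = \<lparr>cg_verts = ncells * Q, cg_wt = (\<lambda>e. of_nat (cell_fun cwt (Max e) (Min e))),
     cg_dem = (\<lambda>e. of_nat (cell_fun (cdem rem) (Max e) (Min e)))\<rparr>"

lemma is_cut_graph: "is_cut_graph (graph rem)"
proof -
  have "1 * 2 \<le> ncells * Q" by (rule mult_le_mono) (use Q2 in \<open>auto simp: ncells_def\<close>)
  then show ?thesis by (simp add: is_cut_graph_def graph_def)
qed

lemma sum_cell_fun:
  fixes s :: "nat \<Rightarrow> bool"
  shows "(\<Sum>j<ncells * Q. \<Sum>i<j. of_bool (s i \<noteq> s j) * real (cell_fun c j i)) =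
    (\<Sum>u<ncells. (\<Sum>x<Q. \<Sum>u'<u. \<Sum>y<Q. of_bool (s (u' * Q + y) \<noteq> s (u * Q + x)) * real (c u x u' y)) +
       (\<Sum>x<Q. \<Sum>y<x. of_bool (s (u * Q + y) \<noteq> s (u * Q + x)) * real (c u x u y)))"
proof -
  have dm: "(u * Q + x) div Q = u" "(u * Q + x) mod Q = x" if "x < Q" for u x
    by (rule div_nat_eqI; use that in \<open>simp add: algebra_simps\<close>) (use that in simp)
  show ?thesis
    unfolding sum_cells sum_below_cell sum.distrib
    by (intro arg_cong2[where f = "(+)"] sum.cong refl) (auto simp: cell_fun_def dm)
qed

lemma sum_pts: "(\<Sum>x<Q. F (pts ! x)) = (\<Sum>x\<in>Pow A. F x :: real)"
  by (rule sum.reindex_bij_betw[of "(!) pts"]) (use bij_betw_nth[OF pts(1), of "{..<Q}" "Pow A"] pts(2) in simp)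

definition idx :: "nat set \<Rightarrow> nat" where
  "idx x = (THE i. i < Q \<and> pts ! i = x)"

lemma idx: "x \<subseteq> A \<Longrightarrow> idx x < Q \<and> pts ! idx x = x"
  unfolding idx_def by (rule theI') (metis PowI in_set_conv_nth nth_eq_iff_index_eq pts)

lemma idx_nth: "i < Q \<Longrightarrow> idx (pts ! i) = i"
  using idx[of "pts ! i"] by (metis Pow_iff nth_eq_iff_index_eq nth_mem pts)

lemma nth_sub: "i < Q \<Longrightarrow> pts ! i \<subseteq> A"
  using pts(2) nth_mem by blast

definition edge_block :: "nat set \<Rightarrow> nat \<Rightarrow> nat set \<Rightarrow> bool" where
  "edge_block S e x \<longleftrightarrow> (n + 1 + e) * Q + idx x \<in> S"

definition vertex_block :: "nat set \<Rightarrow> nat \<Rightarrow> nat set \<Rightarrow> bool" where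
  "vertex_block S v x \<longleftrightarrow> (v + 1) * Q + idx x \<in> S"

definition gad :: "nat set \<Rightarrow> bool" where
  "gad S \<longleftrightarrow> (0 \<in> S) \<noteq> (1 \<in> S)"

definition Wf :: "nat set \<Rightarrow> real" where
  "Wf S = (\<Sum>e<m. 2 ^ kk e * ug_cost N U (2 ^ (lam + 1)) (edge_block S) (vertex_block S) e)"

definition Df :: "(nat \<Rightarrow> bool) \<Rightarrow> nat set \<Rightarrow> real" where
  "Df rem S = (\<Sum>e<m. 2 ^ kk e * ((\<Sum>x\<in>Pow A. of_bool (edge_block S e x \<noteq> edge_block S e (A - x) \<and> \<not> rem ((n + 1 + e) * Q + idx x))) / 2 ^ N))"

section \<open>Weight and demand of a cut in terms of functions on cubes\<close>

lemma cut_sum: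
  assumes "cg_verts I = M" "\<And>e. cg I e = of_nat (F (Max e) (Min e))"
  shows "of_rat (\<Sum>e\<in>crossing I S. cg I e) = (\<Sum>j<M. \<Sum>i<j. of_bool ((i \<in> S) \<noteq> (j \<in> S)) * real (F j i))"
proof -
  have "(\<Sum>e\<in>crossing I S. cg I e) = (\<Sum>e\<in>cg_edges I. if card (e \<inter> S) = 1 then cg I e else 0)"
    unfolding crossing_def by (rule sum.inter_filter) (auto simp: cg_edges_def intro: finite_subset[of _ "Pow {..<cg_verts I}"])
  also have "\<dots> = (\<Sum>e\<in>cg_edges I. of_nat (of_bool ((Min e \<in> S) \<noteq> (Max e \<in> S)) * F (Max e) (Min e)))"
  proof (intro sum.cong refl)
    fix e assume "e \<in> cg_edges I"
    then obtain a b where e: "e = {a, b}" "a < b"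
      by (auto simp: cg_edges_def card_2_iff) (metis insert_commute nat_neq_iff)
    have "card ({a, b} \<inter> S) = 1 \<longleftrightarrow> (a \<in> S) \<noteq> (b \<in> S)"
      using e by (cases "a \<in> S"; cases "b \<in> S") (auto simp: Int_insert_left)
    then show "(if card (e \<inter> S) = 1 then cg I e else 0) = of_nat (of_bool ((Min e \<in> S) \<noteq> (Max e \<in> S)) * F (Max e) (Min e))"
      using e assms(2)[of e] by auto
  qed
  also have "\<dots> = (\<Sum>j<M. \<Sum>i<j. of_nat (of_bool ((i \<in> S) \<noteq> (j \<in> S)) * F j i))"
    unfolding cg_edges_def assms(1) by (rule sum_cg_edges)
  finally show ?thesis by (simp add: of_rat_sum)
qed

lemma edge_props:
  assumes "e < m"
  shows "ug_left U e < n" "ug_right U e < n" "ug_left U e \<noteq> ug_right U e" "bij_betw (ug_perm U e) A A"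
  using U assms by (auto simp: is_unique_game_def)

lemma sum_split_cells: "(\<Sum>u<ncells. F u :: real) = F 0 + (\<Sum>v<n. F (v + 1)) + (\<Sum>e<m. F (n + 1 + e))"
proof -
  have "(\<Sum>u<1 + k. F u) = F 0 + (\<Sum>v<k. F (v + 1))" for k
    by (induction k) (auto simp: add_ac)
  moreover have "(\<Sum>u<1 + n + k. F u) = (\<Sum>u<1 + n. F u) + (\<Sum>e<k. F (n + 1 + e))" for k
    by (induction k) (auto simp: add_ac)
  ultimately show ?thesis unfolding ncells_def by simp
qed

lemma sum_gadget: "(\<Sum>x<Q. \<Sum>y<x. of_bool (s y \<noteq> s x) * real (if x = 1 \<and> y = 0 then k else 0)) = of_bool (s 0 \<noteq> s 1) * real k"
proof -
  have "(\<Sum>y<x. of_bool (s y \<noteq> s x) * real (if x = 1 \<and> y = 0 then k else 0)) = (if x = 1 then of_bool (s 0 \<noteq> s 1) * real k else 0)" for x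
    by (cases "x = 1") auto
  then have "(\<Sum>x<Q. \<Sum>y<x. of_bool (s y \<noteq> s x) * real (if x = 1 \<and> y = 0 then k else 0)) = (\<Sum>x<Q. if x = 1 then of_bool (s 0 \<noteq> s 1) * real k else 0)"
    by simp
  also have "\<dots> = of_bool (s 0 \<noteq> s 1) * real k" using Q2 by (subst sum.delta) auto
  finally show ?thesis .
qed

text \<open>Distinct directions lead to distinct neighbours of a point, so a sum over neighbours is
  a sum over directions.\<close>

lemma sum_Pow_influence:
  "(\<Sum>x\<in>Pow A. \<Sum>y\<in>Pow A. of_bool (f y \<noteq> f x) * of_bool (\<exists>i<N. y = flip i x)) = 2 ^ N * (\<Sum>i<N. influence A i f)"
proof -
  have "(\<Sum>y\<in>Pow A. of_bool (f y \<noteq> f x) * of_bool (\<exists>i<N. y = flip i x)) = (\<Sum>i<N. of_bool (f x \<noteq> f (flip i x)) :: real)"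
    if x: "x \<in> Pow A" for x
  proof -
    have inj: "inj_on (\<lambda>i. flip i x) {..<N}"
      by (rule inj_onI) (auto simp: flip_def split: if_splits)
    have sub: "(\<lambda>i. flip i x) ` {..<N} \<subseteq> Pow A" using flip_Pow[OF _ x] by blast
    have "(\<Sum>y\<in>Pow A. of_bool (f y \<noteq> f x) * of_bool (\<exists>i<N. y = flip i x)) =
        (\<Sum>y\<in>(\<lambda>i. flip i x) ` {..<N}. of_bool (f y \<noteq> f x) * of_bool (\<exists>i<N. y = flip i x) :: real)"
      by (rule sum.mono_neutral_right) (use sub in auto)
    also have "\<dots> = (\<Sum>i<N. of_bool (f x \<noteq> f (flip i x)))"
      unfolding sum.reindex[OF inj] o_def by (intro sum.cong refl) auto
    finally show ?thesis .
  qed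
  then have "(\<Sum>x\<in>Pow A. \<Sum>y\<in>Pow A. of_bool (f y \<noteq> f x) * of_bool (\<exists>i<N. y = flip i x)) =
      (\<Sum>x\<in>Pow A. \<Sum>i<N. of_bool (f x \<noteq> f (flip i x)) :: real)" by simp
  also have "\<dots> = (\<Sum>i<N. \<Sum>x\<in>Pow A. of_bool (f x \<noteq> f (flip i x)))" by (rule sum.swap)
  also have "\<dots> = 2 ^ N * (\<Sum>i<N. influence A i f)" by (simp add: influence_def sum_distrib_left)
  finally show ?thesis .
qed

text \<open>Hypercube edges are unordered pairs and contribute half of the sum over all points,
  whereas ties are counted once per point. Factoring out \<open>2 ^ N / 2\<close> therefore doubles
  the tie factor to \<open>2 ^ (lam + 1)\<close>.\<close>

lemma cut_wt_graph:
  "of_rat (cut_wt (graph rem) S) = of_bool (gad S) * 2 ^ gw + 2 ^ N / 2 * Wf S"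
proof -
  let ?s = "\<lambda>p. p \<in> S"
  let ?C = "\<lambda>u. (\<Sum>x<Q. \<Sum>u'<u. \<Sum>y<Q. of_bool (?s (u' * Q + y) \<noteq> ?s (u * Q + x)) * real (cwt u x u' y)) +
       (\<Sum>x<Q. \<Sum>y<x. of_bool (?s (u * Q + y) \<noteq> ?s (u * Q + x)) * real (cwt u x u y))"
  have "of_rat (cut_wt (graph rem) S) = (\<Sum>j<ncells * Q. \<Sum>i<j. of_bool (?s i \<noteq> ?s j) * real (cell_fun cwt j i))"
    unfolding cut_wt_def by (rule cut_sum) (auto simp: graph_def)
  also have "\<dots> = (\<Sum>u<ncells. ?C u)" by (rule sum_cell_fun)
  also have "\<dots> = ?C 0 + (\<Sum>v<n. ?C (v + 1)) + (\<Sum>e<m. ?C (n + 1 + e))" by (rule sum_split_cells)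
  also have "?C 0 = of_bool (gad S) * 2 ^ gw"
    using sum_gadget[of ?s "2 ^ gw"] by (simp add: cwt_def gad_def)
  also have "(\<Sum>v<n. ?C (v + 1)) = 0" by (intro sum.neutral) (auto simp: cwt_def)
  also have "(\<Sum>e<m. ?C (n + 1 + e)) = (\<Sum>e<m. 2 ^ N / 2 * (2 ^ kk e * ug_cost N U (2 ^ (lam + 1)) (edge_block S) (vertex_block S) e))"
  proof (rule sum.cong[OF refl])
    fix e assume "e \<in> {..<m}"
    then have e: "e < m" by simp
    note ep = edge_props[OF e]
    let ?u = "n + 1 + e"
    let ?l = "ug_left U e" and ?r = "ug_right U e" and ?p = "ug_perm U e"
    let ?g = "edge_block S e"
    have gx: "(?u * Q + x \<in> S) = ?g (pts ! x)" if "x < Q" for x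
      using idx_nth[OF that] by (simp add: edge_block_def)
    have fx: "(Suc v * Q + x \<in> S) = vertex_block S v (pts ! x)" if "x < Q" for x v
      using idx_nth[OF that] by (simp add: vertex_block_def)
    have inner: "(\<Sum>u'<?u. \<Sum>y<Q. of_bool (?s (u' * Q + y) \<noteq> ?s (?u * Q + x)) * real (cwt ?u x u' y)) =
        2 ^ (lam + kk e) * (of_bool (?g (pts ! x) \<noteq> vertex_block S ?l (pts ! x)) + of_bool (?g (pts ! x) \<noteq> vertex_block S ?r (pull A ?p (pts ! x))))"
      if x: "x < Q" for x
    proof -
      let ?F = "\<lambda>u'. \<Sum>y<Q. of_bool (?s (u' * Q + y) \<noteq> ?s (?u * Q + x)) * real (cwt ?u x u' y)"
      let ?px = "pull A ?p (pts ! x)"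
      have px: "?px \<subseteq> A" by (auto simp: pull_def)
      have Fl: "?F (Suc ?l) = 2 ^ (lam + kk e) * of_bool (?g (pts ! x) \<noteq> vertex_block S ?l (pts ! x))"
      proof -
        have "?F (Suc ?l) = (\<Sum>y<Q. if y = x then 2 ^ (lam + kk e) * of_bool (?g (pts ! x) \<noteq> vertex_block S ?l (pts ! x)) else 0)"
        proof (intro sum.cong refl)
          fix y assume y: "y \<in> {..<Q}"
          show "of_bool (?s (Suc ?l * Q + y) \<noteq> ?s (?u * Q + x)) * real (cwt ?u x (Suc ?l) y) =
             (if y = x then 2 ^ (lam + kk e) * of_bool (?g (pts ! x) \<noteq> vertex_block S ?l (pts ! x)) else 0)"
            unfolding gx[OF x] fx[OF y[unfolded lessThan_iff]] using ep by (auto simp: cwt_def)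
        qed
        also have "\<dots> = 2 ^ (lam + kk e) * of_bool (?g (pts ! x) \<noteq> vertex_block S ?l (pts ! x))" using x by simp
        finally show ?thesis .
      qed
      have Fr: "?F (Suc ?r) = 2 ^ (lam + kk e) * of_bool (?g (pts ! x) \<noteq> vertex_block S ?r ?px)"
      proof -
        have "?F (Suc ?r) = (\<Sum>y<Q. if y = idx ?px then 2 ^ (lam + kk e) * of_bool (?g (pts ! x) \<noteq> vertex_block S ?r ?px) else 0)"
        proof (intro sum.cong refl)
          fix y assume y: "y \<in> {..<Q}"
          have eq: "y = idx ?px \<longleftrightarrow> pts ! y = ?px"
            using y by (metis idx[OF px] idx_nth lessThan_iff)
          show "of_bool (?s (Suc ?r * Q + y) \<noteq> ?s (?u * Q + x)) * real (cwt ?u x (Suc ?r) y) =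
             (if y = idx ?px then 2 ^ (lam + kk e) * of_bool (?g (pts ! x) \<noteq> vertex_block S ?r ?px) else 0)"
            unfolding gx[OF x] fx[OF y[unfolded lessThan_iff]] eq using ep by (auto simp: cwt_def)
        qed
        also have "\<dots> = 2 ^ (lam + kk e) * of_bool (?g (pts ! x) \<noteq> vertex_block S ?r ?px)" using idx[OF px] by simp
        finally show ?thesis .
      qed
      have "(\<Sum>u'<?u. ?F u') = (\<Sum>u'\<in>{Suc ?l, Suc ?r}. ?F u')"
      proof (rule sum.mono_neutral_right)
        show "\<forall>u'\<in>{..<?u} - {Suc ?l, Suc ?r}. ?F u' = 0"
        proof
          fix u' assume "u' \<in> {..<?u} - {Suc ?l, Suc ?r}"
          then have "cwt ?u x u' y = 0" for y by (auto simp: cwt_def)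
          then show "?F u' = 0" by simp
        qed
      qed (use ep in auto)
      also have "\<dots> = ?F (Suc ?l) + ?F (Suc ?r)" using ep by simp
      finally show ?thesis unfolding Fl Fr by (simp only: distrib_left)
    qed
    have "(\<Sum>x<Q. \<Sum>u'<?u. \<Sum>y<Q. of_bool (?s (u' * Q + y) \<noteq> ?s (?u * Q + x)) * real (cwt ?u x u' y)) =
       (\<Sum>x<Q. 2 ^ (lam + kk e) * (of_bool (?g (pts ! x) \<noteq> vertex_block S ?l (pts ! x)) + of_bool (?g (pts ! x) \<noteq> vertex_block S ?r (pull A ?p (pts ! x)))))"
      by (intro sum.cong refl inner) simp
    also have "\<dots> = (\<Sum>x\<in>Pow A. 2 ^ (lam + kk e) * (of_bool (?g x \<noteq> vertex_block S ?l x) + of_bool (?g x \<noteq> vertex_block S ?r (pull A ?p x))))"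
      by (rule sum_pts)
    also have "\<dots> = 2 ^ (lam + kk e) * (2 ^ N * (disagreement A ?g (vertex_block S ?l) + disagreement A ?g (\<lambda>x. vertex_block S ?r (pull A ?p x))))"
      by (simp add: disagreement_def sum.distrib sum_distrib_left[symmetric] distrib_left)
    finally have 1: "(\<Sum>x<Q. \<Sum>u'<?u. \<Sum>y<Q. of_bool (?s (u' * Q + y) \<noteq> ?s (?u * Q + x)) * real (cwt ?u x u' y)) =
       2 ^ (lam + kk e) * (2 ^ N * (disagreement A ?g (vertex_block S ?l) + disagreement A ?g (\<lambda>x. vertex_block S ?r (pull A ?p x))))" .
    let ?T = "\<lambda>x y. of_bool (?s (?u * Q + y) \<noteq> ?s (?u * Q + x)) * real (cwt ?u x ?u y)"
    have adj: "(\<exists>i<N. pts ! y = flip i (pts ! x)) = (\<exists>i<N. pts ! x = flip i (pts ! y))" for x y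
      by (metis flip_flip)
    have "2 * (\<Sum>x<Q. \<Sum>y<x. ?T x y) = (\<Sum>x<Q. \<Sum>y<Q. ?T x y)"
      by (rule sum_triangle) (auto simp: cwt_def adj)
    also have "\<dots> = (\<Sum>x<Q. \<Sum>y<Q. 2 ^ kk e * (of_bool (?g (pts ! y) \<noteq> ?g (pts ! x)) * of_bool (\<exists>i<N. pts ! y = flip i (pts ! x))))"
    proof (intro sum.cong refl)
      fix x y assume "x \<in> {..<Q}" "y \<in> {..<Q}"
      then have xy: "x < Q" "y < Q" by auto
      show "?T x y = 2 ^ kk e * (of_bool (?g (pts ! y) \<noteq> ?g (pts ! x)) * of_bool (\<exists>i<N. pts ! y = flip i (pts ! x)))"
        unfolding gx[OF xy(1)] gx[OF xy(2)] by (simp add: cwt_def)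
    qed
    also have "\<dots> = (\<Sum>x\<in>Pow A. \<Sum>y\<in>Pow A. 2 ^ kk e * (of_bool (?g y \<noteq> ?g x) * of_bool (\<exists>i<N. y = flip i x)))"
      unfolding sum_pts[of "\<lambda>y. 2 ^ kk e * (of_bool (?g y \<noteq> ?g z) * of_bool (\<exists>i<N. y = flip i z))" for z]
      by (rule sum_pts)
    also have "\<dots> = 2 ^ kk e * (2 ^ N * (\<Sum>i<N. influence A i ?g))"
      unfolding sum_Pow_influence[symmetric] by (simp only: sum_distrib_left)
    finally have 2: "(\<Sum>x<Q. \<Sum>y<x. ?T x y) = 2 ^ kk e * (2 ^ N * (\<Sum>i<N. influence A i ?g)) / 2" by simp
    show "?C ?u = 2 ^ N / 2 * (2 ^ kk e * ug_cost N U (2 ^ (lam + 1)) (edge_block S) (vertex_block S) e)"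
      unfolding 1 2 ug_cost_def by (simp add: power_add algebra_simps)
  qed
  also have "\<dots> = 2 ^ N / 2 * Wf S" by (simp add: Wf_def sum_distrib_left)
  finally show ?thesis by simp
qed

text \<open>\<open>cdem\<close> consults the flag of only one point of an antipodal pair, the one
  with the larger number, whereas \<open>Df\<close> sums over all points. Flags that are equal on
  antipodes reconcile the two.\<close>

definition sym_rem :: "(nat \<Rightarrow> bool) \<Rightarrow> bool" where
  "sym_rem rem \<longleftrightarrow> (\<forall>e<m. \<forall>x\<subseteq>A. rem ((n + 1 + e) * Q + idx (A - x)) = rem ((n + 1 + e) * Q + idx x))"

text \<open>Every point has exactly one antipode, so the inner sum has a single term; the symmetry
  of the flags makes the summand symmetric, as \<open>sum_triangle\<close> demands.\<close>

lemma cell_dem: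
  assumes "sym_rem rem" "e < m"
  shows "2 * (\<Sum>x<Q. \<Sum>y<x. of_bool (s (pts ! y) \<noteq> s (pts ! x)) * real (cdem rem (n + 1 + e) x (n + 1 + e) y)) =
    2 ^ kk e * (\<Sum>x\<in>Pow A. of_bool (s x \<noteq> s (A - x) \<and> \<not> rem ((n + 1 + e) * Q + idx x)))"
proof -
  let ?u = "n + 1 + e"
  let ?T = "\<lambda>x y. of_bool (s (pts ! y) \<noteq> s (pts ! x)) * real (cdem rem ?u x ?u y)"
  have T: "?T x y = (if y = idx (A - pts ! x) then 2 ^ kk e * of_bool (s (pts ! x) \<noteq> s (A - pts ! x) \<and> \<not> rem (?u * Q + idx (pts ! x))) else 0)"
    if "x < Q" "y < Q" for x y
  proof -
    have eq: "y = idx (A - pts ! x) \<longleftrightarrow> pts ! y = A - pts ! x"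
      by (metis Diff_subset idx idx_nth that(2))
    show ?thesis
      by (cases "pts ! y = A - pts ! x") (simp_all add: cdem_def eq idx_nth[OF that(1)] eq_commute[of "s (A - pts ! x)"])
  qed
  have "2 * (\<Sum>x<Q. \<Sum>y<x. ?T x y) = (\<Sum>x<Q. \<Sum>y<Q. ?T x y)"
  proof (rule sum_triangle)
    fix x y assume xy: "x < Q" "y < Q"
    have "pts ! y = A - pts ! x \<longleftrightarrow> pts ! x = A - pts ! y" using nth_sub[OF xy(1)] nth_sub[OF xy(2)] by auto
    moreover have "rem (?u * Q + x) = rem (?u * Q + y)" if "pts ! x = A - pts ! y"
      using assms(1)[unfolded sym_rem_def, rule_format, OF assms(2) nth_sub[OF xy(2)]] that idx_nth[OF xy(1)] idx_nth[OF xy(2)] by simp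
    ultimately show "?T x y = ?T y x" by (auto simp: cdem_def)
  qed simp
  also have "\<dots> = (\<Sum>x<Q. \<Sum>y<Q. if y = idx (A - pts ! x) then 2 ^ kk e * of_bool (s (pts ! x) \<noteq> s (A - pts ! x) \<and> \<not> rem (?u * Q + idx (pts ! x))) else 0)"
    by (intro sum.cong refl T) auto
  also have "\<dots> = (\<Sum>x<Q. 2 ^ kk e * of_bool (s (pts ! x) \<noteq> s (A - pts ! x) \<and> \<not> rem (?u * Q + idx (pts ! x))))"
  proof (rule sum.cong[OF refl])
    fix x
    have "idx (A - pts ! x) \<in> {..<Q}" using idx[of "A - pts ! x"] by simp
    then show "(\<Sum>y<Q. if y = idx (A - pts ! x) then 2 ^ kk e * of_bool (s (pts ! x) \<noteq> s (A - pts ! x) \<and> \<not> rem (?u * Q + idx (pts ! x))) else 0) =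
       2 ^ kk e * of_bool (s (pts ! x) \<noteq> s (A - pts ! x) \<and> \<not> rem (?u * Q + idx (pts ! x)))"
      by (simp only: sum.delta[OF finite_lessThan] if_True)
  qed
  also have "\<dots> = (\<Sum>x\<in>Pow A. 2 ^ kk e * of_bool (s x \<noteq> s (A - x) \<and> \<not> rem (?u * Q + idx x)))" by (rule sum_pts)
  finally show ?thesis by (simp add: sum_distrib_left)
qed

lemma cut_dem_graph:
  assumes "sym_rem rem"
  shows "of_rat (cut_dem (graph rem) S) = of_bool (gad S) * 2 ^ gd + 2 ^ N / 2 * Df rem S"
proof -
  let ?s = "\<lambda>p. p \<in> S"
  let ?C = "\<lambda>u. (\<Sum>x<Q. \<Sum>u'<u. \<Sum>y<Q. of_bool (?s (u' * Q + y) \<noteq> ?s (u * Q + x)) * real (cdem rem u x u' y)) +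
       (\<Sum>x<Q. \<Sum>y<x. of_bool (?s (u * Q + y) \<noteq> ?s (u * Q + x)) * real (cdem rem u x u y))"
  have "of_rat (cut_dem (graph rem) S) = (\<Sum>j<ncells * Q. \<Sum>i<j. of_bool (?s i \<noteq> ?s j) * real (cell_fun (cdem rem) j i))"
    unfolding cut_dem_def by (rule cut_sum) (auto simp: graph_def)
  also have "\<dots> = (\<Sum>u<ncells. ?C u)" by (rule sum_cell_fun)
  also have "\<dots> = ?C 0 + (\<Sum>v<n. ?C (v + 1)) + (\<Sum>e<m. ?C (n + 1 + e))" by (rule sum_split_cells)
  also have "?C 0 = of_bool (gad S) * 2 ^ gd"
    using sum_gadget[of ?s "2 ^ gd"] by (simp add: cdem_def gad_def)
  also have "(\<Sum>v<n. ?C (v + 1)) = 0" by (intro sum.neutral) (auto simp: cdem_def)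
  also have "(\<Sum>e<m. ?C (n + 1 + e)) = (\<Sum>e<m. 2 ^ N / 2 * (2 ^ kk e * ((\<Sum>x\<in>Pow A. of_bool (edge_block S e x \<noteq> edge_block S e (A - x) \<and> \<not> rem ((n + 1 + e) * Q + idx x))) / 2 ^ N)))"
  proof (rule sum.cong[OF refl])
    fix e assume "e \<in> {..<m}"
    then have e: "e < m" by simp
    let ?u = "n + 1 + e"
    have gx: "(?u * Q + x \<in> S) = edge_block S e (pts ! x)" if "x < Q" for x
      using idx_nth[OF that] by (simp add: edge_block_def)
    have 1: "(\<Sum>x<Q. \<Sum>u'<?u. \<Sum>y<Q. of_bool (?s (u' * Q + y) \<noteq> ?s (?u * Q + x)) * real (cdem rem ?u x u' y)) = 0"
      by (intro sum.neutral ballI) (auto simp: cdem_def)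
    have 2: "(\<Sum>x<Q. \<Sum>y<x. of_bool (?s (?u * Q + y) \<noteq> ?s (?u * Q + x)) * real (cdem rem ?u x ?u y)) =
        (\<Sum>x<Q. \<Sum>y<x. of_bool (edge_block S e (pts ! y) \<noteq> edge_block S e (pts ! x)) * real (cdem rem ?u x ?u y))"
    proof (intro sum.cong refl)
      fix x y assume "x \<in> {..<Q}" "y \<in> {..<x}"
      then have xy: "x < Q" "y < Q" by auto
      show "of_bool (?s (?u * Q + y) \<noteq> ?s (?u * Q + x)) * real (cdem rem ?u x ?u y) =
          of_bool (edge_block S e (pts ! y) \<noteq> edge_block S e (pts ! x)) * real (cdem rem ?u x ?u y)"
        unfolding gx[OF xy(1)] gx[OF xy(2)] ..
    qed
    show "?C ?u = 2 ^ N / 2 * (2 ^ kk e * ((\<Sum>x\<in>Pow A. of_bool (edge_block S e x \<noteq> edge_block S e (A - x) \<and> \<not> rem (?u * Q + idx x))) / 2 ^ N))"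
      unfolding 1 2 using cell_dem[OF assms e, of "edge_block S e"] by simp
  qed
  also have "\<dots> = 2 ^ N / 2 * Df rem S" by (simp add: Df_def sum_distrib_left)
  finally show ?thesis by simp
qed

end

section \<open>Combining cuts\<close>

text \<open>\<open>T\<close> is built from the last cut to the first: the pairs newly separated by \<open>S j\<close> are separated by
  none of the earlier cuts, so one of \<open>T\<close> and \<open>x T (S j)\<close> separates half of them, and this does not
  change later.\<close>

lemma xor_combine:
  fixes cutp :: "'s \<Rightarrow> 'p \<Rightarrow> bool" and W :: "'s \<Rightarrow> real" and \<mu> :: "'p \<Rightarrow> real"
  assumes P: "finite P" and \<mu>: "\<And>p. p \<in> P \<Longrightarrow> 0 \<le> \<mu> p"
    and cx: "\<And>S T p. cutp (x S T) p \<longleftrightarrow> cutp S p \<noteq> cutp T p"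
    and Wx: "\<And>S T. ok S \<Longrightarrow> ok T \<Longrightarrow> ok (x S T) \<and> W (x S T) \<le> W S + W T"
    and z: "ok z" "W z = 0"
    and W0: "\<And>S. ok S \<Longrightarrow> 0 \<le> W S"
  shows "(\<And>j. ok (S j)) \<Longrightarrow> (\<And>j. rem (Suc j) = rem j \<union> {p \<in> P. cutp (S j) p}) \<Longrightarrow>
    \<exists>T. ok T \<and> W T \<le> (\<Sum>j<k. W (S j)) \<and>
      (\<Sum>p\<in>P \<inter> rem k - rem 0. \<mu> p) \<le> 2 * (\<Sum>p\<in>{p \<in> P \<inter> rem k - rem 0. cutp T p}. \<mu> p)"
proof (induction k arbitrary: S rem)
  case 0
  have e: "P \<inter> rem 0 - rem 0 = {}" by auto
  show ?case unfolding e using z by (intro exI[of _ z]) simp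
next
  case (Suc k)
  obtain T where T: "ok T" "W T \<le> (\<Sum>j<k. W (S (Suc j)))"
    "(\<Sum>p\<in>P \<inter> rem (Suc k) - rem 1. \<mu> p) \<le> 2 * (\<Sum>p\<in>{p \<in> P \<inter> rem (Suc k) - rem 1. cutp T p}. \<mu> p)"
    using Suc.IH[of "\<lambda>j. S (Suc j)" "\<lambda>j. rem (Suc j)"] Suc.prems by auto
  note step = Suc.prems(2)
  have mono: "rem 1 \<subseteq> rem (Suc k)"
  proof (induction k)
    case (Suc j)
    then show ?case using step[of "Suc j"] by blast
  qed simp
  have rem1: "rem 1 = rem 0 \<union> {p \<in> P. cutp (S 0) p}" using Suc.prems(2)[of 0] by simp
  define New where "New = {p \<in> P. cutp (S 0) p} - rem 0"
  define Old where "Old = P \<inter> rem (Suc k) - rem 1"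
  have split: "P \<inter> rem (Suc k) - rem 0 = Old \<union> New" "Old \<inter> New = {}"
    using mono rem1 by (auto simp: Old_def New_def)
  have fin: "finite Old" "finite New" using P by (auto simp: Old_def New_def)
  have OldP: "Old \<subseteq> P" and NewP: "New \<subseteq> P" by (auto simp: Old_def New_def)
  have sum_cut: "(\<Sum>p\<in>{p \<in> Old \<union> New. cutp T' p}. \<mu> p) = (\<Sum>p\<in>{p \<in> Old. cutp T' p}. \<mu> p) + (\<Sum>p\<in>{p \<in> New. cutp T' p}. \<mu> p)" for T'
  proof -
    have "{p \<in> Old \<union> New. cutp T' p} = {p \<in> Old. cutp T' p} \<union> {p \<in> New. cutp T' p}" by auto
    then show ?thesis using fin split(2) by (simp add: sum.union_disjoint disjoint_iff)
  qed
  let ?T = "x T (S 0)"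
  have oldx: "{p \<in> Old. cutp ?T p} = {p \<in> Old. cutp T p}"
    using rem1 by (auto simp: cx Old_def)
  have newx: "{p \<in> New. cutp ?T p} = New - {p \<in> New. cutp T p}"
    by (auto simp: cx New_def)
  have old: "(\<Sum>p\<in>Old. \<mu> p) \<le> 2 * (\<Sum>p\<in>{p \<in> Old. cutp T p}. \<mu> p)"
    using T(3) by (simp add: Old_def)
  have tot: "(\<Sum>p\<in>Old \<union> New. \<mu> p) = (\<Sum>p\<in>Old. \<mu> p) + (\<Sum>p\<in>New. \<mu> p)"
    using fin split(2) by (rule sum.union_disjoint)
  have new: "(\<Sum>p\<in>New. \<mu> p) = (\<Sum>p\<in>{p \<in> New. cutp T p}. \<mu> p) + (\<Sum>p\<in>{p \<in> New. cutp ?T p}. \<mu> p)"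
    unfolding newx using fin by (subst sum_diff) auto
  have WS: "(\<Sum>j<Suc k. W (S j)) = W (S 0) + (\<Sum>j<k. W (S (Suc j)))" by (rule sum.lessThan_Suc_shift)
  show ?case
  proof (cases "(\<Sum>p\<in>New. \<mu> p) \<le> 2 * (\<Sum>p\<in>{p \<in> New. cutp T p}. \<mu> p)")
    case True
    then have "sum \<mu> (Old \<union> New) \<le> 2 * (\<Sum>p\<in>{p \<in> Old \<union> New. cutp T p}. \<mu> p)"
      unfolding tot sum_cut using old by simp
    moreover have "W T \<le> (\<Sum>j<Suc k. W (S j))" using T(2) WS W0[OF Suc.prems(1)[of 0]] by linarith
    ultimately show ?thesis unfolding split(1) using T(1) by blast
  next
    case False
    then have "sum \<mu> (Old \<union> New) \<le> 2 * (\<Sum>p\<in>{p \<in> Old \<union> New. cutp ?T p}. \<mu> p)"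
      unfolding tot sum_cut oldx using old new by simp
    moreover have "ok ?T" "W ?T \<le> (\<Sum>j<Suc k. W (S j))"
      using T(2) WS Wx[OF T(1) Suc.prems(1)[of 0]] by auto
    ultimately show ?thesis unfolding split(1) by blast
  qed
qed

lemma finite_cuts: "finite (cuts I)"
  by (rule finite_subset[of _ "Pow {..<cg_verts I}"]) (auto simp: cuts_def)

lemma cut_dem_pos_imp_cut:
  assumes "cut_dem I S > 0" "S \<subseteq> {..<cg_verts I}" shows "S \<in> cuts I"
proof -
  have "crossing I {} = {}" by (auto simp: crossing_def)
  moreover have "crossing I {..<cg_verts I} = {}"
  proof -
    have "card (e \<inter> {..<cg_verts I}) = 2" if "e \<in> cg_edges I" for e
      using that by (auto simp: cg_edges_def Int_absorb2)
    then show ?thesis by (auto simp: crossing_def)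
  qed
  ultimately show ?thesis using assms by (auto simp: cuts_def cut_dem_def)
qed

text \<open>In units of \<open>2 ^ gd\<close> the deciding pair has demand 1 and weight
  \<open>2 ^ w\<close>, and the demands inside the cubes add up to a number between 1/2 and 2. The
  scale \<open>2 ^ K0\<close> allows the exponents \<open>kk e\<close> to be natural numbers;
  rounding loses at most a factor 2 in either direction.\<close>

locale scaled_reduction = ug_reduction +
  fixes K0 w :: nat
  assumes kk: "\<And>e. e < m \<Longrightarrow> of_rat (ug_wt U e) * 2 ^ K0 \<le> 2 * (2 ^ kk e :: real) \<and> (2 ^ kk e :: real) \<le> 2 * of_rat (ug_wt U e) * 2 ^ K0"
    and gd: "(2 ^ gd :: real) = 2 ^ N / 2 * 2 ^ K0" and gw: "gw = gd + w"
begin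

definition q :: "nat \<Rightarrow> real" where "q e = 2 ^ kk e / 2 ^ K0"

definition pairs :: "(nat \<times> nat set) set" where "pairs = {..<m} \<times> Pow A"

definition mu :: "nat \<times> nat set \<Rightarrow> real" where "mu p = q (fst p) / 2 ^ N"

definition separates :: "nat set \<Rightarrow> nat \<times> nat set \<Rightarrow> bool" where
  "separates S p \<longleftrightarrow> edge_block S (fst p) (snd p) \<noteq> edge_block S (fst p) (A - snd p)"

definition pos :: "nat \<times> nat set \<Rightarrow> nat" where "pos p = (n + 1 + fst p) * Q + idx (snd p)"

definition Wr :: "nat set \<Rightarrow> real" where
  "Wr S = (\<Sum>e<m. q e * ug_cost N U (2 ^ (lam + 1)) (edge_block S) (vertex_block S) e)"

definition Dr :: "(nat \<Rightarrow> bool) \<Rightarrow> nat set \<Rightarrow> real" where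
  "Dr rem S = (\<Sum>p\<in>{p \<in> pairs. separates S p \<and> \<not> rem (pos p)}. mu p)"

definition Rtot :: "(nat \<Rightarrow> bool) \<Rightarrow> real" where
  "Rtot rem = (\<Sum>p\<in>{p \<in> pairs. \<not> rem (pos p)}. mu p)"

lemma finite_pairs [simp]: "finite pairs" by (simp add: pairs_def)

lemma q_pos: "q e > 0" by (simp add: q_def)

lemma q_bounds: "e < m \<Longrightarrow> of_rat (ug_wt U e) / 2 \<le> q e" "e < m \<Longrightarrow> q e \<le> 2 * of_rat (ug_wt U e)"
  using kk by (auto simp: q_def field_simps)

lemma mu_pos: "mu p > 0" using q_pos by (simp add: mu_def)

lemma cut_wt_scaled: "of_rat (cut_wt (graph rem) S) = 2 ^ gd * (of_bool (gad S) * 2 ^ w + Wr S)"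
proof -
  have "Wf S = 2 ^ K0 * Wr S" by (simp add: Wf_def Wr_def q_def sum_distrib_left)
  moreover have "(2 ^ gw :: real) = 2 ^ gd * 2 ^ w" by (simp add: gw power_add)
  ultimately show ?thesis unfolding cut_wt_graph using gd by (simp only:) (simp add: algebra_simps)
qed

lemma Dr_alt: "Dr rem S = (\<Sum>e<m. q e * ((\<Sum>x\<in>Pow A. of_bool (edge_block S e x \<noteq> edge_block S e (A - x) \<and> \<not> rem ((n + 1 + e) * Q + idx x))) / 2 ^ N))"
proof -
  have "Dr rem S = (\<Sum>p\<in>pairs. if separates S p \<and> \<not> rem (pos p) then mu p else 0)"
    unfolding Dr_def by (rule sum.inter_filter) simp
  also have "\<dots> = (\<Sum>(e, x)\<in>{..<m} \<times> Pow A. q e / 2 ^ N * of_bool (edge_block S e x \<noteq> edge_block S e (A - x) \<and> \<not> rem ((n + 1 + e) * Q + idx x)))"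
    unfolding pairs_def by (intro sum.cong) (auto simp: separates_def pos_def mu_def)
  also have "\<dots> = (\<Sum>e<m. \<Sum>x\<in>Pow A. q e / 2 ^ N * of_bool (edge_block S e x \<noteq> edge_block S e (A - x) \<and> \<not> rem ((n + 1 + e) * Q + idx x)))"
    by (rule sum.cartesian_product[symmetric])
  finally show ?thesis by (simp only: sum_distrib_left[symmetric]) simp
qed

lemma cut_dem_scaled:
  "sym_rem rem \<Longrightarrow> of_rat (cut_dem (graph rem) S) = 2 ^ gd * (of_bool (gad S) + Dr rem S)"
proof -
  assume "sym_rem rem"
  have "Df rem S = 2 ^ K0 * Dr rem S" by (simp add: Df_def Dr_alt q_def sum_distrib_left)
  then show ?thesis unfolding cut_dem_graph[OF \<open>sym_rem rem\<close>] using gd by (simp add: algebra_simps)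
qed

lemma Wr_nonneg: "0 \<le> Wr S"
  unfolding Wr_def ug_cost_def
  by (intro sum_nonneg mult_nonneg_nonneg add_nonneg_nonneg influence_nonneg disagreement_nonneg less_imp_le[OF q_pos]) auto

lemma Dr_nonneg: "0 \<le> Dr rem S"
  unfolding Dr_def by (intro sum_nonneg less_imp_le[OF mu_pos])

lemma Rtot_none: "1 / 2 \<le> Rtot (\<lambda>_. False)" "Rtot rem \<le> 2"
proof -
  have eq: "Rtot (\<lambda>_. False) = (\<Sum>e<m. q e)"
  proof -
    have "Rtot (\<lambda>_. False) = (\<Sum>(e, x)\<in>{..<m} \<times> Pow A. q e / 2 ^ N)"
      unfolding Rtot_def pairs_def mu_def by (intro sum.cong) auto
    also have "\<dots> = (\<Sum>e<m. \<Sum>x\<in>Pow A. q e / 2 ^ N)" by (rule sum.cartesian_product[symmetric])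
    finally show ?thesis by (simp add: card_Pow)
  qed
  have wt1: "(\<Sum>e<m. of_rat (ug_wt U e)) = (1 :: real)"
    using U by (simp add: is_unique_game_def of_rat_sum[symmetric])
  have "(\<Sum>e<m. of_rat (ug_wt U e) / 2) \<le> (\<Sum>e<m. q e)" using q_bounds by (intro sum_mono) auto
  then show "1 / 2 \<le> Rtot (\<lambda>_. False)" unfolding eq using wt1 by (simp add: sum_divide_distrib[symmetric])
  have "(\<Sum>e<m. q e) \<le> (\<Sum>e<m. 2 * of_rat (ug_wt U e))" using q_bounds by (intro sum_mono) auto
  then have "Rtot (\<lambda>_. False) \<le> 2" unfolding eq using wt1 by (simp add: sum_distrib_left[symmetric])
  moreover have "Rtot rem \<le> Rtot (\<lambda>_. False)"
    unfolding Rtot_def by (rule sum_mono2) (auto intro: less_imp_le[OF mu_pos])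
  ultimately show "Rtot rem \<le> 2" by simp
qed

text \<open>A set is exhibited that separates every pair with a demand, so that the formula for cuts
  yields the total: the points containing coordinate 0 in every cell other than cell 0, and there
  position 0 alone.\<close>

lemma total_dem_scaled:
  assumes "sym_rem rem"
  shows "of_rat (total_dem (graph rem)) = 2 ^ gd * (1 + Rtot rem)"
proof -
  define S where "S = {p. p = 0 \<or> p \<ge> Q \<and> 0 \<in> pts ! (p mod Q)}"
  have pm: "((n + 1 + e) * Q + x) mod Q = x" if "x < Q" for e x
    using that by (simp only: mod_mult_self3 mod_less)
  have edge_block: "edge_block S e x = (0 \<in> x)" if "x \<subseteq> A" for e x
  proof -
    define P where "P = (n + 1 + e) * Q + idx x"
    have "P mod Q = idx x" using pm idx[OF that] by (simp only: P_def)
    moreover have "Q \<le> P" by (simp add: P_def)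
    moreover have "P \<noteq> 0" using \<open>Q \<le> P\<close> Q2 by linarith
    ultimately show ?thesis unfolding edge_block_def S_def P_def[symmetric] using idx[OF that] by simp
  qed
  have sep: "separates S p" if pp: "p \<in> pairs" for p
  proof -
    obtain e x where p: "p = (e, x)" "e < m" "x \<subseteq> A" using pp by (auto simp: pairs_def)
    show ?thesis unfolding separates_def p(1) fst_conv snd_conv edge_block[OF p(3)] edge_block[OF Diff_subset] using N by auto
  qed
  have "gad S" using Q2 by (auto simp: gad_def S_def)
  have "cut_dem (graph rem) S = total_dem (graph rem)"
    unfolding cut_dem_def total_dem_def
  proof (rule sum.mono_neutral_left)
    show "finite (cg_edges (graph rem))"
      by (auto simp: cg_edges_def intro: finite_subset[of _ "Pow {..<cg_verts (graph rem)}"])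
    show "crossing (graph rem) S \<subseteq> cg_edges (graph rem)" by (auto simp: crossing_def)
    show "\<forall>e\<in>cg_edges (graph rem) - crossing (graph rem) S. cg_dem (graph rem) e = 0"
    proof (rule ballI, rule ccontr)
      fix e assume e: "e \<in> cg_edges (graph rem) - crossing (graph rem) S" and d: "cg_dem (graph rem) e \<noteq> 0"
      then obtain i j where ij: "e = {i, j}" "i < j"
        by (auto simp: cg_edges_def card_2_iff) (metis insert_commute nat_neq_iff)
      have c: "cell_fun (cdem rem) j i \<noteq> 0" using d ij by (auto simp: graph_def max_def min_def)
      have same: "(i \<in> S) = (j \<in> S)"
      proof (rule ccontr)
        assume "(i \<in> S) \<noteq> (j \<in> S)"
        then have "card ({i, j} \<inter> S) = 1" using ij by (cases "i \<in> S"; cases "j \<in> S") (auto simp: Int_insert_left)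
        then show False using e ij by (auto simp: crossing_def)
      qed
      have u: "i div Q = j div Q" using c by (auto simp: cell_fun_def cdem_def split: if_splits)
      show False
      proof (cases "j div Q = 0")
        case True
        then have "j < Q" "i < Q" using u Q2 by (auto simp: div_eq_0_iff)
        then have "j = 1" "i = 0" using c by (auto simp: cell_fun_def cdem_def split: if_splits)
        then show False using same Q2 by (auto simp: S_def)
      next
        case False
        then have ge: "j \<ge> Q" "i \<ge> Q" using u by (metis div_less not_le)+
        have "pts ! (i mod Q) = A - pts ! (j mod Q)" using c False u by (auto simp: cell_fun_def cdem_def split: if_splits)
        then have "(0 \<in> pts ! (i mod Q)) \<noteq> (0 \<in> pts ! (j mod Q))" using N by auto
        then show False using same ge Q2 by (auto simp: S_def)
      qed
    qed
  qed
  moreover have "Dr rem S = Rtot rem"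
    unfolding Dr_def Rtot_def by (intro sum.cong) (use sep in auto)
  ultimately show ?thesis using cut_dem_scaled[OF assms, of S] \<open>gad S\<close> by simp
qed

text \<open>Position 0 lies in cell 0, outside all cubes, so this cut separates nothing but the
  deciding pair.\<close>

lemma gadget_cut:
  assumes "sym_rem rem"
  shows "{0} \<in> cuts (graph rem)" "of_rat (cut_wt (graph rem) {0}) = (2 ^ gd * 2 ^ w :: real)"
    "of_rat (cut_dem (graph rem) {0}) = (2 ^ gd :: real)"
proof -
  have "edge_block {0} e x = False" "vertex_block {0} v x = False" for e v x using Q2 by (auto simp: edge_block_def vertex_block_def)
  then have fg: "edge_block {0} = (\<lambda>_ _. False)" "vertex_block {0} = (\<lambda>_ _. False)" by (auto simp: fun_eq_iff)
  have "Wr {0} = 0" unfolding Wr_def fg by (simp add: ug_cost_def influence_def disagreement_def)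
  moreover have "gad {0}" by (simp add: gad_def)
  ultimately show "of_rat (cut_wt (graph rem) {0}) = (2 ^ gd * 2 ^ w :: real)" unfolding cut_wt_scaled by simp
  have "Dr rem {0} = 0" unfolding Dr_def separates_def fg by simp
  then show d: "of_rat (cut_dem (graph rem) {0}) = (2 ^ gd :: real)"
    unfolding cut_dem_scaled[OF assms] using \<open>gad {0}\<close> by simp
  then have "(0 :: real) < of_rat (cut_dem (graph rem) {0})" by simp
  then have "cut_dem (graph rem) {0} > 0" by (simp only: zero_less_of_rat_iff)
  moreover have "{0} \<subseteq> {..<cg_verts (graph rem)}" using is_cut_graph[of rem] by (auto simp: is_cut_graph_def)
  ultimately show "{0} \<in> cuts (graph rem)" by (rule cut_dem_pos_imp_cut)
qed

definition xor :: "nat set \<Rightarrow> nat set \<Rightarrow> nat set" where "xor S T = (S - T) \<union> (T - S)"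

lemma separates_xor: "separates (xor S T) p \<longleftrightarrow> separates S p \<noteq> separates T p"
  by (auto simp: separates_def edge_block_def xor_def)

text \<open>An edge crossing a symmetric difference crosses one of the two cuts, so cut weights are
  subadditive. The inequality is read off the graph, edge by edge; there \<open>Wr\<close> is the
  whole cut weight up to scaling because the deciding pair is not separated.\<close>

lemma Wr_xor:
  assumes "\<not> gad S" "\<not> gad T" shows "\<not> gad (xor S T)" "Wr (xor S T) \<le> Wr S + Wr T"
proof -
  show g: "\<not> gad (xor S T)" using assms by (auto simp: gad_def xor_def)
  let ?I = "graph (\<lambda>_. False)"
  have c: "of_rat (cut_wt ?I S) = (\<Sum>j<ncells * Q. \<Sum>i<j. of_bool ((i \<in> S) \<noteq> (j \<in> S)) * real (cell_fun cwt j i))" for S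
    unfolding cut_wt_def by (rule cut_sum) (auto simp: graph_def)
  have "(of_rat (cut_wt ?I (xor S T)) :: real) \<le> of_rat (cut_wt ?I S) + of_rat (cut_wt ?I T)"
    unfolding c sum.distrib[symmetric] by (intro sum_mono) (auto simp: xor_def)
  then have "2 ^ gd * Wr (xor S T) \<le> 2 ^ gd * (Wr S + Wr T)"
    unfolding cut_wt_scaled using assms g by (simp add: distrib_left)
  then show "Wr (xor S T) \<le> Wr S + Wr T" by simp
qed

text \<open>A set of positions determines functions on the points of the cube and the vertices of
  the game only; the lemma shows that the cost depends on nothing else.\<close>

lemma ug_cost_cong:
  assumes "\<And>x. x \<subseteq> A \<Longrightarrow> g e x = g' e x" "\<And>v x. v < n \<Longrightarrow> x \<subseteq> A \<Longrightarrow> f v x = f' v x" "e < m"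
  shows "ug_cost N U \<Lambda> g f e = ug_cost N U \<Lambda> g' f' e"
proof -
  have "influence A i (g e) = influence A i (g' e)" if "i < N" for i
    unfolding influence_def using assms(1) flip_Pow[of i A] that
    by (intro arg_cong2[where f = "(/)"] sum.cong refl) auto
  moreover have d: "disagreement A (g e) h = disagreement A (g' e) h'" if "\<And>x. x \<subseteq> A \<Longrightarrow> h x = h' x" for h h'
    unfolding disagreement_def by (intro arg_cong2[where f = "(/)"] sum.cong refl) (use assms(1) that in auto)
  have "disagreement A (g e) (f (ug_left U e)) = disagreement A (g' e) (f' (ug_left U e))"
    using edge_props[OF assms(3)] assms(2) by (intro d) auto
  moreover have "disagreement A (g e) (\<lambda>x. f (ug_right U e) (pull A (ug_perm U e) x)) = disagreement A (g' e) (\<lambda>x. f' (ug_right U e) (pull A (ug_perm U e) x))"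
    using edge_props[OF assms(3)] by (intro d assms(2)) (auto simp: pull_def)
  ultimately show ?thesis unfolding ug_cost_def by simp
qed

text \<open>The bound 4 is \<open>2 + 2 * \<Lambda> * \<eta>\<close> from
  \<open>ug_completeness\<close> for a tie factor with
  \<open>\<Lambda> * \<eta> \<le> 1\<close>.\<close>

lemma completeness:
  fixes \<eta> :: real
  assumes "of_rat (ug_opt N U) \<ge> 1 - \<eta>" "2 ^ (lam + 1) * \<eta> \<le> 1"
  shows "\<exists>S\<subseteq>{..<ncells * Q}. \<not> gad S \<and> Wr S \<le> 4 \<and> (\<forall>p\<in>pairs. separates S p)"
proof -
  have "\<forall>e<m. 0 \<le> q e \<and> q e \<le> 2 * of_rat (ug_wt U e)" using q_pos q_bounds by (auto intro: less_imp_le)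
  from ug_completeness[OF U N assms(1) _ this, of "2 ^ (lam + 1)"]
  obtain g f where gf: "\<And>e x. x \<subseteq> A \<Longrightarrow> e < m \<Longrightarrow> g e x \<noteq> g e (A - x)"
     "(\<Sum>e<m. q e * ug_cost N U (2 ^ (lam + 1)) g f e) \<le> 2 + 2 * 2 ^ (lam + 1) * \<eta>" by auto
  define s where "s u x = (if u = 0 then False else if u \<le> n then f (u - 1) (pts ! x) else g (u - n - 1) (pts ! x))" for u x
  define S where "S = {p. p < ncells * Q \<and> s (p div Q) (p mod Q)}"
  have mem: "u * Q + x \<in> S \<longleftrightarrow> s u x" if "u < ncells" "x < Q" for u x
  proof -
    have "u * Q + x < Suc u * Q" using that by simp
    also have "\<dots> \<le> ncells * Q" using that by (intro mult_le_mono1) auto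
    finally have "u * Q + x < ncells * Q" .
    moreover have "(u * Q + x) div Q = u" by (rule div_nat_eqI; use that in \<open>simp add: algebra_simps\<close>)
    moreover have "(u * Q + x) mod Q = x" using that by simp
    ultimately show ?thesis by (simp add: S_def)
  qed
  have edge_block: "edge_block S e x = g e x" if "x \<subseteq> A" "e < m" for e x
    unfolding edge_block_def using idx[OF that(1)] that(2) by (subst mem) (auto simp: ncells_def s_def)
  have vertex_block: "vertex_block S v x = f v x" if "x \<subseteq> A" "v < n" for v x
    unfolding vertex_block_def using idx[OF that(1)] that(2) by (subst mem) (auto simp: ncells_def s_def)
  have "Wr S = (\<Sum>e<m. q e * ug_cost N U (2 ^ (lam + 1)) g f e)"
    unfolding Wr_def
    by (intro sum.cong refl arg_cong2[where f = "(*)"] ug_cost_cong) (use edge_block vertex_block in auto)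
  then have "Wr S \<le> 4" using gf(2) assms(2) by (simp add: mult.assoc)
  moreover have "separates S p" if pp: "p \<in> pairs" for p
  proof -
    obtain e x where p: "p = (e, x)" "e < m" "x \<subseteq> A" using pp by (auto simp: pairs_def)
    show ?thesis
      unfolding separates_def p(1) fst_conv snd_conv edge_block[OF p(3,2)] edge_block[OF Diff_subset p(2)]
      by (rule gf(1)[OF p(3,2)])
  qed
  moreover have "\<not> gad S"
  proof -
    have "0 < Q" "1 < Q" "0 < ncells" using Q2 by (linarith, linarith, simp add: ncells_def)
    from mem[OF this(3,1)] mem[OF this(3,2)] show ?thesis by (simp add: gad_def s_def)
  qed
  moreover have "S \<subseteq> {..<ncells * Q}" by (auto simp: S_def)
  ultimately show ?thesis by blast
qed

end

section \<open>Answers of the oracles\<close>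

context scaled_reduction
begin

abbreviation none :: "nat \<Rightarrow> bool" where "none \<equiv> \<lambda>_. False"

definition cheap_cut :: bool where
  "cheap_cut \<longleftrightarrow> (\<exists>S\<subseteq>{..<ncells * Q}. \<not> gad S \<and> Wr S \<le> 4 \<and> (\<forall>p\<in>pairs. separates S p))"

text \<open>Both constants serve the combination of cuts in the removal loop. Its cuts cost at most
  \<open>C * 2 ^ w\<close> per unit of removed demand, of which there are at most 2 units; and if
  more than 1/4 has been removed, the combination separates more than 1/8. A balanced answer that
  spares the deciding pair separates at least 1/6, which also exceeds 1/16.\<close>

definition no_cheap_cut :: "real \<Rightarrow> bool" where
  "no_cheap_cut C \<longleftrightarrow> (\<forall>S. \<not> gad S \<longrightarrow> 1 / 16 \<le> Dr none S \<longrightarrow> 2 * C * 2 ^ w < Wr S)"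

lemma verts [simp]: "cg_verts (graph rem) = ncells * Q" by (simp add: graph_def)

lemma sym_none: "sym_rem none" by (simp add: sym_rem_def)

lemma Dr_separating: "(\<And>p. p \<in> pairs \<Longrightarrow> separates S p) \<Longrightarrow> Dr rem S = Rtot rem"
  unfolding Dr_def Rtot_def by (intro sum.cong) auto

lemma Dr_le_Rtot: "Dr rem S \<le> Rtot rem"
  unfolding Dr_def Rtot_def by (rule sum_mono2) (auto intro: less_imp_le[OF mu_pos])

lemma cut_dem_pos: "sym_rem rem \<Longrightarrow> cut_dem (graph rem) S > 0 \<longleftrightarrow> of_bool (gad S) + Dr rem S > 0"
proof -
  assume "sym_rem rem"
  have "cut_dem (graph rem) S > 0 \<longleftrightarrow> (0::real) < of_rat (cut_dem (graph rem) S)" by simp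
  also have "\<dots> \<longleftrightarrow> of_bool (gad S) + Dr rem S > 0"
    unfolding cut_dem_scaled[OF \<open>sym_rem rem\<close>] by (simp add: zero_less_mult_iff)
  finally show ?thesis .
qed

text \<open>The cut of the deciding pair alone is balanced and costs \<open>2 ^ w\<close>; a cheap
  cut is balanced and costs at most 4. In the presence of a cheap cut, an answer separating the pair
  would cost at least \<open>2 ^ w\<close>, more than \<open>4 * C\<close>. An answer sparing the
  pair costs at most \<open>C * 2 ^ w\<close> and separates a demand of at least 1/6, which
  \<open>no_cheap_cut\<close> excludes.\<close>

lemma balanced_answer:
  assumes C: "C \<ge> 1" and w: "48 * C < 2 ^ w" and b: "gd = Suc b"
    and y: "y \<in> approx_balanced_edge_separator C (enc_cut_graph (graph none) @ enc_rat (2 ^ b))"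
  shows "\<exists>S. y = enc_cut (graph none) S \<and> (cheap_cut \<longrightarrow> \<not> gad S) \<and> (no_cheap_cut C \<longrightarrow> gad S)"
proof -
  let ?I = "graph none" and ?B = "2 ^ b :: rat"
  have B: "(of_rat ?B :: real) = 2 ^ gd / 2" by (simp add: b of_rat_power)
  have tot: "(of_rat (total_dem ?I) :: real) = 2 ^ gd * (1 + Rtot none)" by (rule total_dem_scaled[OF sym_none])
  \<comment> \<open>In units of \<open>2 ^ gd\<close> the total demand lies between 3/2 and 3 and
    the balance parameter is 1/2, so it lies in the admissible range; the lower end is reached for
    total demand 3.\<close>
  have "(of_rat (total_dem ?I / 6) :: real) \<le> of_rat ?B"
    unfolding of_rat_divide tot B using Rtot_none(2)[of none] by (simp add: field_simps)
  then have 1: "total_dem ?I / 6 \<le> ?B" by (simp only: of_rat_less_eq)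
  have "(of_rat ?B :: real) \<le> of_rat (total_dem ?I / 2)"
    unfolding of_rat_divide tot B using Rtot_none(1) by (simp add: field_simps)
  then have 2: "?B \<le> total_dem ?I / 2" by (simp only: of_rat_less_eq)
  obtain S where S: "S \<in> balanced_cuts ?I (?B / 3)" "y = enc_cut ?I S"
    "of_rat (cut_wt ?I S) \<le> C * of_rat (Min (cut_wt ?I ` balanced_cuts ?I ?B))"
    using y is_cut_graph[of none] 1 2 unfolding approx_balanced_edge_separator_def by blast
  have fin: "finite (balanced_cuts ?I ?B)" using finite_cuts by (simp add: balanced_cuts_def)
  have le: "2 ^ gd * (of_bool (gad S) * 2 ^ w + Wr S) \<le> C * of_rat (cut_wt ?I T)" if "T \<in> balanced_cuts ?I ?B" for T
  proof -
    have "Min (cut_wt ?I ` balanced_cuts ?I ?B) \<le> cut_wt ?I T" using fin that by (intro Min_le) auto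
    then have "(of_rat (Min (cut_wt ?I ` balanced_cuts ?I ?B)) :: real) \<le> of_rat (cut_wt ?I T)" by (simp only: of_rat_less_eq)
    then show ?thesis using S(3) C unfolding cut_wt_scaled[of _ S] by (meson mult_left_mono order_trans zero_le_one)
  qed
  have "\<not> gad S" if cheap: cheap_cut
  proof
    assume g: "gad S"
    obtain T where T: "T \<subseteq> {..<ncells * Q}" "\<not> gad T" "Wr T \<le> 4" "\<forall>p\<in>pairs. separates T p"
      using cheap by (auto simp: cheap_cut_def)
    have D: "Dr none T = Rtot none" using T(4) by (intro Dr_separating) auto
    have "(of_rat ?B :: real) \<le> of_rat (cut_dem ?I T)"
      unfolding B cut_dem_scaled[OF sym_none] D using Rtot_none(1) T(2) by (simp add: field_simps)
    then have dT: "?B \<le> cut_dem ?I T" by (simp only: of_rat_less_eq)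
    have "0 < cut_dem ?I T" by (rule less_le_trans[OF _ dT]) simp
    then have "T \<in> cuts ?I" using T(1) by (intro cut_dem_pos_imp_cut) auto
    then have "T \<in> balanced_cuts ?I ?B" using dT by (simp add: balanced_cuts_def)
    from le[OF this] have "2 ^ gd * (2 ^ w + Wr S) \<le> 2 ^ gd * (C * Wr T)"
      unfolding cut_wt_scaled using g T(2) by (simp add: mult.left_commute)
    then have "2 ^ w + Wr S \<le> C * Wr T" by simp
    moreover have "C * Wr T \<le> C * 4" using C T(3) by (intro mult_left_mono) auto
    ultimately show False using w C Wr_nonneg[of S] by linarith
  qed
  moreover have "gad S" if nc: "no_cheap_cut C"
  proof (rule ccontr)
    assume g: "\<not> gad S"
    have "{0} \<in> balanced_cuts ?I ?B"
    proof -
      have "(of_rat ?B :: real) \<le> of_rat (cut_dem ?I {0})"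
        unfolding B gadget_cut(3)[OF sym_none] by simp
      then show ?thesis using gadget_cut(1)[OF sym_none] by (simp add: balanced_cuts_def of_rat_less_eq)
    qed
    from le[OF this] have "2 ^ gd * Wr S \<le> 2 ^ gd * (C * 2 ^ w)"
      unfolding gadget_cut(2)[OF sym_none] using g by (simp add: mult_ac)
    then have W: "Wr S \<le> C * 2 ^ w" by simp
    have "?B / 3 \<le> cut_dem ?I S" using S(1) by (simp add: balanced_cuts_def)
    then have "(of_rat (?B / 3) :: real) \<le> of_rat (cut_dem ?I S)" by (simp only: of_rat_less_eq)
    then have "2 ^ gd * (1 / 6) \<le> 2 ^ gd * Dr none S"
      unfolding of_rat_divide B cut_dem_scaled[OF sym_none] using g by simp
    then have "1 / 6 \<le> Dr none S" by (simp only: mult_le_cancel_left) auto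
    then have "2 * C * 2 ^ w < Wr S" using nc g by (simp add: no_cheap_cut_def)
    moreover have "0 \<le> C * 2 ^ w" using C by simp
    ultimately show False using W by linarith
  qed
  ultimately show ?thesis using S(2) by blast
qed

text \<open>The deciding pair alone has sparsity \<open>2 ^ w\<close>, which bounds the optimum. If
  a cheap cut exists and a demand of at least 1/4 remains, the optimum is at most 4 / (1/4) = 16,
  whereas a cut separating the pair has demand at most 3 and hence sparsity at least
  \<open>2 ^ w / 3\<close>. The constant 48 is the product of 16 and 3.\<close>

lemma sparsest_answer:
  assumes C: "C \<ge> 1" and w: "48 * C < 2 ^ w" and sym: "sym_rem rem"
    and y: "y \<in> approx_sparsest_cut C (enc_cut_graph (graph rem))"
  shows "\<exists>S. y = enc_cut (graph rem) S \<and> (\<not> gad S \<longrightarrow> 0 < Dr rem S \<and> Wr S \<le> C * 2 ^ w * Dr rem S) \<and>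
    (cheap_cut \<longrightarrow> 1 / 4 \<le> Rtot rem \<longrightarrow> \<not> gad S)"
proof -
  let ?I = "graph rem"
  \<comment> \<open>The demand of the deciding pair keeps the total positive even if all antipodal
    demands have been removed, so every query of the loop meets the promise.\<close>
  have "(0 :: real) < of_rat (total_dem ?I)"
    unfolding total_dem_scaled[OF sym] using Dr_le_Rtot[of rem "{}"] Dr_nonneg[of rem "{}"] by (simp add: zero_less_mult_iff)
  then have "total_dem ?I > 0" by simp
  then obtain S where S: "S \<in> sparsity_cuts ?I" "y = enc_cut ?I S"
    "of_rat (sparsity ?I S) \<le> C * of_rat (Min (sparsity ?I ` sparsity_cuts ?I))"
    using y is_cut_graph[of rem] unfolding approx_sparsest_cut_def by blast
  have fin: "finite (sparsity_cuts ?I)" using finite_cuts by (simp add: sparsity_cuts_def)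
  have sp: "of_rat (sparsity ?I T) = (of_bool (gad T) * 2 ^ w + Wr T) / (of_bool (gad T) + Dr rem T)" for T
    unfolding sparsity_def of_rat_divide cut_wt_scaled cut_dem_scaled[OF sym] by simp
  have le: "(of_bool (gad S) * 2 ^ w + Wr S) / (of_bool (gad S) + Dr rem S) \<le> C * of_rat (sparsity ?I T)"
    if "T \<in> sparsity_cuts ?I" for T
  proof -
    have "Min (sparsity ?I ` sparsity_cuts ?I) \<le> sparsity ?I T" using fin that by (intro Min_le) auto
    then have "(of_rat (Min (sparsity ?I ` sparsity_cuts ?I)) :: real) \<le> of_rat (sparsity ?I T)" by (simp only: of_rat_less_eq)
    then show ?thesis using S(3) C unfolding sp[of S] by (meson mult_left_mono order_trans zero_le_one)
  qed
  have Spos: "of_bool (gad S) + Dr rem S > 0"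
    using S(1) cut_dem_pos[OF sym, of S] by (simp add: sparsity_cuts_def)
  have "0 < Dr rem S \<and> Wr S \<le> C * 2 ^ w * Dr rem S" if g: "\<not> gad S"
  proof -
    have d0: "(of_rat (cut_dem ?I {0}) :: real) > 0" unfolding gadget_cut(3)[OF sym] by simp
    then have "{0} \<in> sparsity_cuts ?I" using gadget_cut(1)[OF sym] by (simp add: sparsity_cuts_def)
    from le[OF this] have "Wr S / Dr rem S \<le> C * 2 ^ w"
      using g unfolding sparsity_def of_rat_divide gadget_cut(2,3)[OF sym] by simp
    then show ?thesis using Spos g by (simp add: pos_divide_le_eq)
  qed
  moreover have "\<not> gad S" if cheap: cheap_cut and R: "1 / 4 \<le> Rtot rem"
  proof
    assume g: "gad S"
    obtain T where T: "T \<subseteq> {..<ncells * Q}" "\<not> gad T" "Wr T \<le> 4" "\<forall>p\<in>pairs. separates T p"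
      using cheap by (auto simp: cheap_cut_def)
    have D: "Dr rem T = Rtot rem" using T(4) by (intro Dr_separating) auto
    have dT: "cut_dem ?I T > 0" using cut_dem_pos[OF sym, of T] R T(2) by (simp add: D)
    then have "T \<in> sparsity_cuts ?I" using T(1) cut_dem_pos_imp_cut by (auto simp: sparsity_cuts_def)
    from le[OF this] have "(2 ^ w + Wr S) / (1 + Dr rem S) \<le> C * (Wr T / Rtot rem)"
      unfolding sp D using g T(2) by simp
    also have "\<dots> \<le> C * (4 / (1 / 4))" using C T(3) R Wr_nonneg[of T] by (intro mult_left_mono frac_le) auto
    finally have "2 ^ w + Wr S \<le> C * 16 * (1 + Dr rem S)" using Dr_nonneg[of rem S] by (simp add: pos_divide_le_eq)
    also have "\<dots> \<le> C * 16 * (1 + 2)"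
      using C Dr_le_Rtot[of rem S] Rtot_none(2)[of rem] by (intro mult_left_mono) auto
    finally show False using w Wr_nonneg[of S] by simp
  qed
  ultimately show ?thesis using S(2) by blast
qed

text \<open>With a cheap cut, every round that starts with remaining demand at least 1/4 removes a
  further pair, and there are only \<open>m * Q\<close> pairs; more rounds than that force the
  remainder below 1/4. Without cheap cuts little can be removed, since otherwise a combination of
  the answers would be a cheap cut itself.\<close>

lemma sparsest_loop:
  assumes C: "C \<ge> 1"
    and rem0: "rem 0 = none"
    and step: "\<And>j p. p \<in> pairs \<Longrightarrow> rem (Suc j) (pos p) \<longleftrightarrow> rem j (pos p) \<or> \<not> gad (S j) \<and> separates (S j) p"
    and S1: "\<And>j. \<not> gad (S j) \<Longrightarrow> 0 < Dr (rem j) (S j) \<and> Wr (S j) \<le> C * 2 ^ w * Dr (rem j) (S j)"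
    and S2: "\<And>j. cheap_cut \<Longrightarrow> 1 / 4 \<le> Rtot (rem j) \<Longrightarrow> \<not> gad (S j)"
    and k: "k > m * Q"
  shows "cheap_cut \<Longrightarrow> Rtot (rem k) < 1 / 4" "no_cheap_cut C \<Longrightarrow> Rtot (rem k) \<ge> 1 / 4"
proof -
  define Rm where "Rm j = {p \<in> pairs. rem j (pos p)}" for j
  have Rm_step: "Rm (Suc j) = Rm j \<union> {p \<in> pairs. \<not> gad (S j) \<and> separates (S j) p}" for j
    using step by (auto simp: Rm_def)
  have Rm_mono: "i \<le> j \<Longrightarrow> Rm i \<subseteq> Rm j" for i j
    by (induction rule: dec_induct) (auto simp: Rm_step)
  have finR: "finite (Rm j)" for j by (simp add: Rm_def)
  have Rtot_eq: "Rtot (rem j) = (\<Sum>p\<in>pairs - Rm j. mu p)" for j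
    unfolding Rtot_def Rm_def by (intro sum.cong) auto
  have Dr_eq: "Dr (rem j) (S j) = (\<Sum>p\<in>Rm (Suc j) - Rm j. mu p)" if "\<not> gad (S j)" for j
    unfolding Dr_def using that by (intro sum.cong) (auto simp: Rm_step, auto simp: Rm_def)
  show "Rtot (rem k) < 1 / 4" if cheap: cheap_cut
  proof (rule ccontr)
    assume "\<not> ?thesis"
    then have R: "1 / 4 \<le> Rtot (rem k)" by simp
    have "j \<le> card (Rm j)" if "j \<le> k" for j
      using that
    proof (induction j)
      case (Suc j)
      have "Rtot (rem k) \<le> Rtot (rem j)"
        unfolding Rtot_eq using Rm_mono[of j k] Suc.prems by (intro sum_mono2) (auto intro: less_imp_le[OF mu_pos])
      then have g: "\<not> gad (S j)" using S2[OF cheap] R by simp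
      have "Rm (Suc j) - Rm j \<noteq> {}"
      proof
        assume "Rm (Suc j) - Rm j = {}"
        then have "Dr (rem j) (S j) = 0" unfolding Dr_eq[OF g] by (simp only: sum.empty)
        then show False using S1[OF g] by simp
      qed
      then have "Rm j \<subset> Rm (Suc j)" by (auto simp: Rm_step)
      then have "card (Rm j) < card (Rm (Suc j))" by (rule psubset_card_mono[OF finR])
      then show ?case using Suc by simp
    qed simp
    then have "k \<le> card (Rm k)" by simp
    also have "\<dots> \<le> card pairs" by (rule card_mono) (auto simp: Rm_def)
    also have "\<dots> = m * Q" by (simp add: pairs_def Q card_Pow)
    finally show False using k by simp
  qed
  show "1 / 4 \<le> Rtot (rem k)" if nc: "no_cheap_cut C"
  proof -
    \<comment> \<open>Rounds whose answer separates the deciding pair remove nothing; in the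
      combination they count as the empty cut, which costs nothing.\<close>
    define S' where "S' j = (if gad (S j) then {} else S j)" for j
    have gE: "\<not> gad {}" by (simp add: gad_def)
    have sepE: "\<not> separates {} p" for p by (simp add: separates_def edge_block_def)
    have WE: "Wr {} = 0"
    proof -
      have "crossing (graph none) {} = {}" by (auto simp: crossing_def)
      then have "cut_wt (graph none) {} = 0" by (simp add: cut_wt_def)
      then show ?thesis using cut_wt_scaled[of none "{}"] gE by simp
    qed
    have "\<exists>T. \<not> gad T \<and> Wr T \<le> (\<Sum>j<k. Wr (S' j)) \<and>
      (\<Sum>p\<in>pairs \<inter> Rm k - Rm 0. mu p) \<le> 2 * (\<Sum>p\<in>{p \<in> pairs \<inter> Rm k - Rm 0. separates T p}. mu p)"
    proof (rule xor_combine[where x = xor and z = "{}"])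
      show "Rm (Suc j) = Rm j \<union> {p \<in> pairs. separates (S' j) p}" for j
        unfolding Rm_step S'_def using sepE by auto
    qed (use Wr_xor gE WE Wr_nonneg in \<open>auto simp: separates_xor S'_def less_imp_le[OF mu_pos]\<close>)
    moreover have "pairs \<inter> Rm k - Rm 0 = Rm k" by (auto simp: Rm_def rem0)
    ultimately obtain T where T: "\<not> gad T" "Wr T \<le> (\<Sum>j<k. Wr (S' j))"
      "(\<Sum>p\<in>Rm k. mu p) \<le> 2 * (\<Sum>p\<in>{p \<in> Rm k. separates T p}. mu p)" by auto
    \<comment> \<open>The costs telescope: each answer is charged to the demand that it removes, and
      every pair is removed at most once.\<close>
    have tel: "(\<Sum>j<i. Wr (S' j)) \<le> C * 2 ^ w * (\<Sum>p\<in>Rm i. mu p)" for i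
    proof (induction i)
      case 0
      show ?case using C by (auto intro!: mult_nonneg_nonneg sum_nonneg less_imp_le[OF mu_pos])
    next
      case (Suc i)
      have sub: "Rm i \<subseteq> Rm (Suc i)" by (rule Rm_mono) simp
      have "Wr (S' i) \<le> C * 2 ^ w * (\<Sum>p\<in>Rm (Suc i) - Rm i. mu p)"
      proof (cases "gad (S i)")
        case True
        then show ?thesis using C WE by (auto simp: S'_def intro!: mult_nonneg_nonneg sum_nonneg less_imp_le[OF mu_pos])
      next
        case False
        then show ?thesis using S1[OF False] Dr_eq[OF False] by (simp add: S'_def)
      qed
      moreover have "(\<Sum>p\<in>Rm (Suc i). mu p) = (\<Sum>p\<in>Rm i. mu p) + (\<Sum>p\<in>Rm (Suc i) - Rm i. mu p)"
        using sum.subset_diff[OF sub finR, of mu] by simp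
      ultimately show ?case using Suc by (simp add: distrib_left)
    qed
    have Rm2: "(\<Sum>p\<in>Rm k. mu p) \<le> 2"
    proof -
      have "(\<Sum>p\<in>Rm k. mu p) \<le> (\<Sum>p\<in>pairs. mu p)"
        by (intro sum_mono2) (auto simp: Rm_def intro: less_imp_le[OF mu_pos])
      also have "\<dots> = Rtot none" by (simp add: Rtot_def)
      finally show ?thesis using Rtot_none(2)[of none] by simp
    qed
    have "Wr T \<le> C * 2 ^ w * (\<Sum>p\<in>Rm k. mu p)" using T(2) tel[of k] by linarith
    also have "\<dots> \<le> C * 2 ^ w * 2" using Rm2 C by (intro mult_left_mono) auto
    finally have "Wr T \<le> 2 * C * 2 ^ w" by simp
    then have "Dr none T < 1 / 16" using nc T(1) unfolding no_cheap_cut_def by (meson linorder_not_le)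
    moreover have "(\<Sum>p\<in>{p \<in> Rm k. separates T p}. mu p) \<le> Dr none T"
      unfolding Dr_def by (intro sum_mono2) (auto simp: Rm_def intro: less_imp_le[OF mu_pos])
    \<comment> \<open>At least half of the removed demand is separated by \<open>T\<close>. With an
      initial demand of at least 1/2, more than 3/8 remains.\<close>
    ultimately have "(\<Sum>p\<in>Rm k. mu p) < 1 / 8" using T(3) by linarith
    moreover have "Rtot none = (\<Sum>p\<in>pairs - Rm k. mu p) + (\<Sum>p\<in>Rm k. mu p)"
      unfolding Rtot_def using sum.subset_diff[of "Rm k" pairs mu] by (simp add: Rm_def)
    ultimately show ?thesis unfolding Rtot_eq using Rtot_none(1) by linarith
  qed
qed

end

section \<open>Computing the cut graph\<close>

lemma pf_If_mem:
  assumes "finite B" "poly_time n F" "poly_time n H" "poly_time n K"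
  shows "poly_time n (\<lambda>e. if F e \<in> B then H e else K e)"
  using assms(1)
proof (induction B rule: finite_induct)
  case (insert b B)
  have "poly_time n (\<lambda>e. if F e = b then H e else if F e \<in> B then H e else K e)"
    by (intro pf_If_eq assms pf_const insert.IH)
  moreover have "(\<lambda>e. if F e = b then H e else if F e \<in> B then H e else K e) = (\<lambda>e. if F e \<in> insert b B then H e else K e)"
    by auto
  ultimately show ?case by simp
qed (use assms in simp)

lemma pf_If_ball:
  assumes "\<And>i. i \<in> set L \<Longrightarrow> finite (B i)" "\<And>i. i \<in> set L \<Longrightarrow> poly_time n (F i)" "poly_time n H" "poly_time n K"
  shows "poly_time n (\<lambda>e. if \<forall>i\<in>set L. F i e \<in> B i then H e else K e)"
  using assms(1,2)
proof (induction L)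
  case (Cons a L)
  have "poly_time n (\<lambda>e. if F a e \<in> B a then if \<forall>i\<in>set L. F i e \<in> B i then H e else K e else K e)"
    by (rule pf_If_mem[OF Cons.prems(1) Cons.prems(2) Cons.IH assms(4)]) (use Cons.prems in auto)
  moreover have "(\<lambda>e. if F a e \<in> B a then if \<forall>i\<in>set L. F i e \<in> B i then H e else K e else K e) =
      (\<lambda>e. if \<forall>i\<in>set (a # L). F i e \<in> B i then H e else K e)" by auto
  ultimately show ?case by simp
qed (use assms in simp)

lemma length_skip_pow: "length ((skip ^^ k) y) \<le> length y"
  by (rule funpow_length_le) (rule length_skip)

lemma pf_skip_pow: "poly_time n F \<Longrightarrow> poly_time n (\<lambda>e. (skip ^^ k) (F e))"
  by (rule pf_funpow_const) (auto intro: pf_skip pf_var)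

definition zero_code :: "bool list" where "zero_code = enc_rat 0"

definition pow_rat_code :: "bool list \<Rightarrow> bool list" where
  "pow_rat_code ys = pow_code ys @ enc_nat 1"

lemma pow_rat_code: "pow_rat_code ys = enc_rat (of_nat (2 ^ length ys))"
proof -
  have "quotient_of (of_int (2 ^ length ys)) = (2 ^ length ys, 1)"
    using quotient_of_int[of "2 ^ length ys"] by (simp only: Rat.of_int_def)
  then show ?thesis by (simp add: pow_rat_code_def pow_code enc_rat_def nat_power_eq)
qed

lemma pf_pow_rat_code: "poly_time n F \<Longrightarrow> poly_time n (\<lambda>e. pow_rat_code (F e))"
  unfolding pow_rat_code_def by (intro pf_append pf_pow_code pf_const)

definition first_count :: "bool list \<Rightarrow> bool list" where "first_count X = takeWhile id X"
definition after_count :: "bool list \<Rightarrow> bool list" where "after_count X = tl (dropWhile id X)"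

lemma pf_first_count: "poly_time n F \<Longrightarrow> poly_time n (\<lambda>e. first_count (F e))"
  unfolding first_count_def by (rule pf_takeWhile)

lemma pf_after_count: "poly_time n F \<Longrightarrow> poly_time n (\<lambda>e. after_count (F e))"
  unfolding after_count_def by (intro pf_tl pf_dropWhile)

definition cells :: "bool list \<Rightarrow> bool list" where "cells X = True # first_count X @ first_count (after_count X)"

lemma pf_cells: "poly_time n F \<Longrightarrow> poly_time n (\<lambda>e. cells (F e))"
  unfolding cells_def by (intro pf_Cons pf_append pf_first_count pf_after_count)

text \<open>\<open>N\<close>, \<open>lam\<close>, \<open>w\<close> and the list of cube points are
  constants of the program. Loops over cube points are therefore unrolled, and only the loops over
  cells depend on the input.\<close>

locale reduction_fun =
  fixes N lam w :: nat and pts :: "nat set list"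
  assumes N0: "N > 0" and pts0: "distinct pts" "set pts = Pow {..<N}"
begin

text \<open>An edge is encoded by \<open>N + 4\<close> numbers: two endpoints, \<open>N\<close>
  values of the bijection, numerator and denominator of the weight.\<close>

definition edge_record :: "bool list \<Rightarrow> bool list \<Rightarrow> bool list" where
  "edge_record X e = ((skip ^^ (N + 4)) ^^ length e) (after_count (after_count X))"

lemma pf_edge_record: "poly_time n F \<Longrightarrow> poly_time n G \<Longrightarrow> poly_time n (\<lambda>e. edge_record (F e) (G e))"
  unfolding edge_record_def by (intro pf_funpow pf_skip_pow pf_after_count pf_var length_skip_pow) auto

definition edge_field :: "nat \<Rightarrow> bool list \<Rightarrow> bool list \<Rightarrow> bool list" where
  "edge_field k X e = decode ((skip ^^ k) (edge_record X e))"

lemma pf_edge_field: "poly_time n F \<Longrightarrow> poly_time n G \<Longrightarrow> poly_time n (\<lambda>e. edge_field k (F e) (G e))"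
  unfolding edge_field_def by (intro pf_decode pf_skip_pow pf_edge_record)

text \<open>If \<open>a\<close> and \<open>b\<close> are the bit lengths of numerator and denominator, then \<open>2 ^ a / 2 ^ b\<close> is within a
  factor two of the weight. The length of the input, which exceeds \<open>b\<close>, makes the exponent
  nonnegative.\<close>

definition weight_exponent :: "bool list \<Rightarrow> bool list \<Rightarrow> bool list" where
  "weight_exponent X e = edge_field (N + 2) X e @ drop (length (edge_field (N + 3) X e)) X @ [True, True]"

lemma pf_weight_exponent: "poly_time n F \<Longrightarrow> poly_time n G \<Longrightarrow> poly_time n (\<lambda>e. weight_exponent (F e) (G e))"
  unfolding weight_exponent_def by (intro pf_append pf_edge_field pf_drop pf_const)

text \<open>For the cell \<open>n + 1 + e\<close> of an edge this leaves \<open>e + 1\<close> bits,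
  for all other cells nothing. So emptiness recognises the cells that belong to no edge, and
  \<open>tl\<close> yields \<open>e\<close> in unary.\<close>

definition edge_of :: "bool list \<Rightarrow> bool list \<Rightarrow> bool list" where
  "edge_of X u = drop (length (first_count X)) u"

lemma pf_edge_of: "poly_time n F \<Longrightarrow> poly_time n G \<Longrightarrow> poly_time n (\<lambda>e. edge_of (F e) (G e))"
  unfolding edge_of_def by (intro pf_drop pf_first_count)

text \<open>A bit beyond the end of \<open>R\<close> counts as \<open>False\<close>, hence the
  initial state \<open>[]\<close> means that nothing has been removed.\<close>

definition bitat :: "bool list \<Rightarrow> bool list \<Rightarrow> nat \<Rightarrow> bool list" where
  "bitat R u x = lcase (drop x (drop (length u * length pts) R)) [] [True] []"

lemma pf_bitat: "poly_time n F \<Longrightarrow> poly_time n G \<Longrightarrow> poly_time n (\<lambda>e. bitat (F e) (G e) x)"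
  unfolding bitat_def by (intro pf_lcase pf_drop_const pf_drop_mult pf_const)

definition cell_wt_code :: "nat \<Rightarrow> nat \<Rightarrow> bool list \<Rightarrow> bool list \<Rightarrow> bool list" where
  "cell_wt_code x y X u = (if u = [] then (if x = 1 \<and> y = 0 then pow_rat_code (X @ replicate (N + 1 + w) True) else zero_code)
     else if edge_of X u = [] then zero_code
     else if \<exists>i<N. pts ! y = flip i (pts ! x) then pow_rat_code (weight_exponent X (tl (edge_of X u))) else zero_code)"

definition cell_dem_code :: "nat \<Rightarrow> nat \<Rightarrow> bool list \<Rightarrow> bool list \<Rightarrow> bool list \<Rightarrow> bool list" where
  "cell_dem_code x y X R u = (if u = [] then (if x = 1 \<and> y = 0 then pow_rat_code (X @ replicate (N + 1) True) else zero_code)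
     else if edge_of X u = [] then zero_code
     else if pts ! y = {..<N} - pts ! x then
       (if bitat R u x = [] then pow_rat_code (weight_exponent X (tl (edge_of X u))) else zero_code) else zero_code)"

text \<open>The bijection is available only through the codes of its values. Whether point
  \<open>y\<close> is the pullback of point \<open>x\<close> is therefore tested coordinate by
  coordinate, each value against the finite set of labels compatible with the two points.\<close>

definition link_wt_code :: "nat \<Rightarrow> nat \<Rightarrow> bool list \<Rightarrow> bool list \<Rightarrow> bool list \<Rightarrow> bool list" where
  "link_wt_code x y X u u' = (if edge_of X u = [] then zero_code else if u' = [] then zero_code
     else if edge_of X u' = [] then
       (if unary_to_bits (tl u') = edge_field 0 X (tl (edge_of X u)) then
          (if x = y then pow_rat_code (replicate lam True @ weight_exponent X (tl (edge_of X u))) else zero_code)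
        else if unary_to_bits (tl u') = edge_field 1 X (tl (edge_of X u)) then
          (if \<forall>i\<in>set [0..<N]. edge_field (2 + i) X (tl (edge_of X u)) \<in> bits ` {j. j < N \<and> (j \<in> pts ! x) = (i \<in> pts ! y)}
           then pow_rat_code (replicate lam True @ weight_exponent X (tl (edge_of X u))) else zero_code)
        else zero_code)
     else zero_code)"

lemmas pf_rules = pf_If_eq pf_If pf_append pf_pow_rat_code pf_edge_of pf_weight_exponent pf_edge_field pf_bitat pf_unary_to_bits pf_tl pf_var pf_const

lemma pf_cell_wt_code: "poly_time n F \<Longrightarrow> poly_time n G \<Longrightarrow> poly_time n (\<lambda>e. cell_wt_code x y (F e) (G e))"
  unfolding cell_wt_code_def by (intro pf_rules)

lemma pf_cell_dem_code: "poly_time n F \<Longrightarrow> poly_time n G \<Longrightarrow> poly_time n H \<Longrightarrow> poly_time n (\<lambda>e. cell_dem_code x y (F e) (G e) (H e))"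
  unfolding cell_dem_code_def by (intro pf_rules)

lemma pf_link_wt_code: "poly_time n F \<Longrightarrow> poly_time n G \<Longrightarrow> poly_time n H \<Longrightarrow> poly_time n (\<lambda>e. link_wt_code x y (F e) (G e) (H e))"
  unfolding link_wt_code_def by (intro pf_rules pf_If_ball) auto

text \<open>The triangular order of \<open>enc_cut_graph\<close>, cut into cells: for each point
  first the pairs with points of earlier cells, which carry no demand, then the pairs inside its own
  cell.\<close>

definition body :: "bool list \<Rightarrow> bool list \<Rightarrow> bool list" where
  "body X R = concat (map (\<lambda>u. concat (map (\<lambda>x.
      concat (map (\<lambda>u'. concat (map (\<lambda>y. link_wt_code x y X (replicate u True) (replicate u' True) @ zero_code) [0..<length pts])) [0..<u]) @
      concat (map (\<lambda>y. cell_wt_code x y X (replicate u True) @ cell_dem_code x y X R (replicate u True)) [0..<x]))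
    [0..<length pts])) [0..<length (cells X)])"

lemma pf_body: "poly_time 2 (\<lambda>e. body (e 0) (e 1))"
proof -
  have 1: "poly_time 3 (\<lambda>e. concat (map (\<lambda>u'. (\<lambda>e. concat (map (\<lambda>y. link_wt_code x y (e 0) (e 2) (e 3) @ zero_code) [0..<length pts])) (e(3 := replicate u' True))) [0..<length (e 2)]))"
    for x
  proof (rule pf_concat)
    show "poly_time (Suc 3) (\<lambda>e. concat (map (\<lambda>y. link_wt_code x y (e 0) (e 2) (e 3) @ zero_code) [0..<length pts]))"
      by (intro pf_concat_const pf_append pf_link_wt_code pf_var pf_const) auto
  qed (auto intro: pf_var)
  have 2: "poly_time (Suc 2) (\<lambda>e. concat (map (\<lambda>x.
      concat (map (\<lambda>u'. concat (map (\<lambda>y. link_wt_code x y (e 0) (e 2) (replicate u' True) @ zero_code) [0..<length pts])) [0..<length (e 2)]) @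
      concat (map (\<lambda>y. cell_wt_code x y (e 0) (e 2) @ cell_dem_code x y (e 0) (e 1) (e 2)) [0..<x])) [0..<length pts]))"
  proof (rule pf_concat_const, rule pf_append)
    fix x
    show "poly_time (Suc 2) (\<lambda>e. concat (map (\<lambda>u'. concat (map (\<lambda>y. link_wt_code x y (e 0) (e 2) (replicate u' True) @ zero_code) [0..<length pts])) [0..<length (e 2)]))"
      using 1[of x] by (simp add: numeral_3_eq_3 numeral_2_eq_2)
    show "poly_time (Suc 2) (\<lambda>e. concat (map (\<lambda>y. cell_wt_code x y (e 0) (e 2) @ cell_dem_code x y (e 0) (e 1) (e 2)) [0..<x]))"
      by (intro pf_concat_const pf_append pf_cell_wt_code pf_cell_dem_code pf_var) auto
  qed
  have "poly_time 2 (\<lambda>e. e 0)" by (rule pf_var) simp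
  from pf_concat[OF pf_cells[OF this] 2] show ?thesis by (simp add: body_def)
qed

definition verts_code :: "bool list \<Rightarrow> bool list" where
  "verts_code X = concat (map (\<lambda>u. replicate (length pts) True) [0..<length (cells X)])"

lemma verts_code: "verts_code X = replicate (length (cells X) * length pts) True"
proof -
  have "concat (map (\<lambda>u. replicate q True) [0..<k]) = replicate (k * q) True" for k q
    by (induction k) (auto simp: replicate_add[symmetric] add.commute)
  then show ?thesis by (simp add: verts_code_def)
qed

lemma pf_verts_code: assumes "poly_time n F" shows "poly_time n (\<lambda>e. verts_code (F e))"
  unfolding verts_code_def by (rule pf_concat[OF pf_cells[OF assms] pf_const])

definition build :: "bool list \<Rightarrow> bool list \<Rightarrow> bool list" where
  "build X R = verts_code X @ [False] @ body X R"

lemma pf_build: assumes "poly_time n F" "poly_time n G" shows "poly_time n (\<lambda>e. build (F e) (G e))"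
  unfolding build_def by (intro pf_append pf_verts_code pf_const pf2[where g = body, OF pf_body assms] assms)

definition antipode :: "nat \<Rightarrow> nat" where
  "antipode x = (THE i. i < length pts \<and> pts ! i = {..<N} - pts ! x)"

text \<open>The flags are copied in all cases, so that the length of the result does not depend on \<open>R\<close>.\<close>

definition update :: "bool list \<Rightarrow> bool list \<Rightarrow> bool list \<Rightarrow> bool list" where
  "update X R S = concat (map (\<lambda>u. concat (map (\<lambda>x.
     if bitat R (replicate u True) x = [] then
       if bitat S [] 0 = bitat S [] 1 then
         if bitat S (replicate u True) x = bitat S (replicate u True) (antipode x) then [False] else [True]
       else [False]
     else [True]) [0..<length pts])) [0..<length (cells X)])"

lemma pf_update: "poly_time 3 (\<lambda>e. update (e 0) (e 1) (e 2))"
proof -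
  have "poly_time (Suc 3) (\<lambda>e. concat (map (\<lambda>x.
     if bitat (e 1) (e 3) x = [] then
       if bitat (e 2) [] 0 = bitat (e 2) [] 1 then
         if bitat (e 2) (e 3) x = bitat (e 2) (e 3) (antipode x) then [False] else [True]
       else [False]
     else [True]) [0..<length pts]))"
    by (intro pf_concat_const pf_rules) auto
  have "poly_time 3 (\<lambda>e. e 0)" by (rule pf_var) simp
  from pf_concat[OF pf_cells[OF this] \<open>poly_time (Suc 3) _\<close>] show ?thesis by (simp add: update_def cong: if_cong)
qed

lemma length_update: "length (update X R S) = length (cells X) * length pts"
proof -
  have "length (concat (map (\<lambda>x. if P x then if Q x then if S x then [False] else [True] else [False] else [True]) [0..<k])) = k"
    for P Q S and k :: nat by (induction k) auto
  note inner = this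
  have "length (concat (map F [0..<k])) = k * q" if "\<And>u. length (F u) = q" for F :: "nat \<Rightarrow> bool list" and k q
    using that by (induction k) auto
  then show ?thesis unfolding update_def by (simp add: inner)
qed

definition add_cell :: "bool list \<Rightarrow> bool list \<Rightarrow> bool list \<Rightarrow> bool list \<Rightarrow> bool list" where
  "add_cell X R e acc = fold (\<lambda>x acc. if bitat R (first_count X @ True # e) x = [] then add_pow (weight_exponent X e) acc else acc) [0..<length pts] acc"

lemma pf_add_cell: "poly_time n F \<Longrightarrow> poly_time n G \<Longrightarrow> poly_time n H \<Longrightarrow> poly_time n K \<Longrightarrow> poly_time n (\<lambda>e. add_cell (F e) (G e) (H e) (K e))"
proof -
  assume F: "poly_time n F" and G: "poly_time n G" and H: "poly_time n H" and K: "poly_time n K"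
  have "poly_time n (\<lambda>e. fold (\<lambda>x acc. if bitat (G e) (first_count (F e) @ True # H e) x = [] then add_pow (weight_exponent (F e) (H e)) acc else acc) L (K e))" for L
    using K
  proof (induction L arbitrary: K)
    case (Cons x L)
    show ?case unfolding fold.simps o_def
      by (intro Cons.IH pf_If_eq pf_bitat pf_append pf_first_count pf_Cons pf_const pf_add_pow pf_weight_exponent F G H Cons.prems)
  qed simp
  then show ?thesis by (simp add: add_cell_def)
qed

lemma length_add_cell: "length (add_cell X R e acc) \<le> length acc + length pts * (length (weight_exponent X e) + 1)"
proof -
  have "length (fold (\<lambda>x acc. if P x then add_pow k acc else acc) L acc) \<le> length acc + length L * (length k + 1)"
    for P and L :: "nat list" and k
  proof (induction L arbitrary: acc)
    case (Cons x L)
    show ?case using Cons[of "if P x then add_pow k acc else acc"] length_add_pow[of k acc] by (auto split: if_splits)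
  qed simp
  from this[of "\<lambda>x. bitat R (first_count X @ True # e) x = []" "weight_exponent X e" "[0..<length pts]"] show ?thesis
    unfolding add_cell_def by simp
qed

text \<open>The demand not yet removed, up to scaling, as a binary number: one power of two is added
  for each point whose flag is not set.\<close>

definition remaining :: "bool list \<Rightarrow> bool list \<Rightarrow> bool list" where
  "remaining X R = rec_nat [] (\<lambda>i acc. add_cell X R (replicate i True) acc) (length (first_count (after_count X)))"

lemma pf_remaining: "poly_time 2 (\<lambda>e. remaining (e 0) (e 1))"
proof -
  have "poly_time 3 (\<lambda>e. weight_exponent (e 0) (e 2))" by (intro pf_weight_exponent pf_var) auto
  from pf_size[OF this] obtain h where h: "poly_bounded h" "\<And>e. length (weight_exponent (e 0) (e 2)) \<le> h (env_size 3 e)" by blast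
  have "poly_time 2 (\<lambda>e. rec_nat [] (\<lambda>i r. (\<lambda>e. add_cell (e 0) (e 1) (e 2) (e 3)) (e(2 := replicate i True, Suc 2 := r))) (length (first_count (after_count (e 0)))))"
  proof (rule pf_loop)
    show "poly_bounded (\<lambda>x. length pts * (h x + 1))" by (intro pb_intros h)
    show "poly_time (2 + 2) (\<lambda>e. add_cell (e 0) (e 1) (e 2) (e 3))" by (intro pf_add_cell pf_var) auto
    show "length (add_cell (e 0) (e 1) (e 2) (e 3)) \<le> length (e (Suc 2)) + length pts * (h (env_size (Suc 2) e) + 1)" for e
    proof -
      have "length pts * (length (weight_exponent (e 0) (e 2)) + 1) \<le> length pts * (h (env_size 3 e) + 1)"
        by (intro mult_le_mono2 add_le_mono1 h(2))
      then show ?thesis using length_add_cell[of "e 0" "e 1" "e 2" "e 3"] unfolding numeral_3_eq_3 numeral_2_eq_2 by linarith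
    qed
  qed (auto intro!: pf_Nil pf_first_count pf_after_count pf_var)
  then show ?thesis by (simp add: remaining_def numeral_3_eq_3 numeral_2_eq_2)
qed

text \<open>\<open>True\<close> is answered when the loop has brought the remaining demand below
  1/4, which is the outcome in the presence of a cheap cut.\<close>

definition out :: "bool list \<Rightarrow> bool list \<Rightarrow> bool list" where
  "out X R = (if has_True (drop (length (X @ replicate N True)) (remaining X R)) = [] then [True] else [False])"

lemma pf_out: "poly_time 2 (\<lambda>e. out (e 0) (e 1))"
  unfolding out_def by (intro pf_If_eq pf_has_True pf_drop pf_append pf_var pf_const pf_remaining) auto

text \<open>The appended balance parameter is half the demand of the deciding pair, whose exponent
  is \<open>length X + N + 1\<close>.\<close>

definition build_b :: "bool list \<Rightarrow> bool list \<Rightarrow> bool list" where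
  "build_b X R = build X [] @ pow_rat_code (X @ replicate N True)"

definition update_b :: "bool list \<Rightarrow> bool list \<Rightarrow> bool list \<Rightarrow> bool list" where
  "update_b X R S = (if bitat S [] 0 = bitat S [] 1 then [] else [True])"

definition out_b :: "bool list \<Rightarrow> bool list \<Rightarrow> bool list" where
  "out_b X R = (if R = [] then [True] else [False])"

lemma pf_balanced:
  "poly_time 2 (\<lambda>e. build_b (e 0) (e 1))" "poly_time 3 (\<lambda>e. update_b (e 0) (e 1) (e 2))" "poly_time 2 (\<lambda>e. out_b (e 0) (e 1))"
  unfolding build_b_def update_b_def out_b_def
  by (intro pf_append pf_build pf_pow_rat_code pf_rules; simp)+

end

section \<open>Parsing the instance and correctness of the emitted code\<close>

lemma takeWhile_enc_unary: "takeWhile id (enc_unary k @ z) = replicate k True"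
  by (induction k) (auto simp: enc_unary_def)

lemma dropWhile_enc_unary: "dropWhile id (enc_unary k @ z) = False # z"
  by (induction k) (auto simp: enc_unary_def)

lemma skip_pow_codes:
  "k \<le> length as \<Longrightarrow> (skip ^^ k) (concat (map enc_nat as) @ z) = concat (map enc_nat (drop k as)) @ z"
proof (induction k)
  case (Suc k)
  then have "drop k as = as ! k # drop (Suc k) as" by (simp add: Cons_nth_drop_Suc)
  then show ?case using Suc by (simp add: enc_nat_code skip_code)
qed simp

lemma concat_cells:
  "concat (map F [0..<B * q]) = concat (map (\<lambda>u. concat (map (\<lambda>x. F (u * q + x)) [0..<q])) [0..<B])"
proof (induction B)
  case (Suc B)
  have "[0..<Suc B * q] = [0..<B * q] @ map (\<lambda>x. B * q + x) [0..<q]"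
    using upt_add_eq_append[of 0 "B * q" q] map_add_upt[of "B * q" q] by (simp add: add.commute)
  then show ?case using Suc by (simp add: o_def)
qed simp

lemma concat_below_cell:
  "concat (map F [0..<u * q + x]) =
    concat (map (\<lambda>u'. concat (map (\<lambda>y. F (u' * q + y)) [0..<q])) [0..<u]) @ concat (map (\<lambda>y. F (u * q + y)) [0..<x])"
proof -
  have "[0..<u * q + x] = [0..<u * q] @ map (\<lambda>y. u * q + y) [0..<x]"
    using upt_add_eq_append[of 0 "u * q" x] map_add_upt[of "u * q" x] by (simp add: add.commute)
  then show ?thesis by (simp add: concat_cells o_def)
qed

context reduction_fun
begin

lemma length_edge_record: "length (edge_record X e) \<le> length X"
proof -
  have "length (edge_record X e) \<le> length (after_count (after_count X))"
    unfolding edge_record_def by (rule funpow_length_le) (rule length_skip_pow)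
  also have "\<dots> \<le> length X"
    using length_dropWhile_le[of id X] length_dropWhile_le[of id "after_count X"] by (simp add: after_count_def)
  finally show ?thesis .
qed

end

locale parsed = reduction_fun +
  fixes U :: unique_game
  assumes U0: "is_unique_game N U"
begin

definition X :: "bool list" where "X = enc_ug N U"

definition nats :: "nat \<Rightarrow> nat list" where
  "nats e = [ug_left U e, ug_right U e] @ map (ug_perm U e) [0..<N] @
    [nat (fst (quotient_of (ug_wt U e))), nat (snd (quotient_of (ug_wt U e)))]"

lemma length_nats: "length (nats e) = N + 4" by (simp add: nats_def)

lemma nats_nth: "nats e ! 0 = ug_left U e" "nats e ! 1 = ug_right U e" "nats e ! Suc 0 = ug_right U e"
  "i < N \<Longrightarrow> nats e ! (2 + i) = ug_perm U e i"
  "nats e ! (N + 2) = nat (fst (quotient_of (ug_wt U e)))" "nats e ! (N + 3) = nat (snd (quotient_of (ug_wt U e)))"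
  by (simp_all add: nats_def nth_append nth_Cons')

lemma X_eq: "X = enc_unary (ug_verts U) @ enc_unary (ug_edges U) @ concat (map (\<lambda>e. concat (map enc_nat (nats e))) [0..<ug_edges U])"
  by (simp add: X_def enc_ug_def nats_def enc_rat_def o_def)

lemma counts_X: "first_count X = replicate (ug_verts U) True" "first_count (after_count X) = replicate (ug_edges U) True"
  "after_count (after_count X) = concat (map (\<lambda>e. concat (map enc_nat (nats e))) [0..<ug_edges U])"
  by (simp_all add: first_count_def after_count_def X_eq takeWhile_enc_unary dropWhile_enc_unary)

lemma cells_X: "length (cells X) = 1 + ug_verts U + ug_edges U"
  by (simp add: cells_def counts_X)

lemma edge_record_X:
  assumes "e \<le> ug_edges U"
  shows "edge_record X (replicate e True) = concat (map (\<lambda>e. concat (map enc_nat (nats e))) [e..<ug_edges U])"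
proof -
  have "((skip ^^ (N + 4)) ^^ e) (after_count (after_count X)) = concat (map (\<lambda>e. concat (map enc_nat (nats e))) [e..<ug_edges U])"
    using assms
  proof (induction e)
    case 0
    show ?case by (simp add: counts_X)
  next
    case (Suc e)
    then have "((skip ^^ (N + 4)) ^^ Suc e) (after_count (after_count X)) =
        (skip ^^ (N + 4)) (concat (map enc_nat (nats e)) @ concat (map (\<lambda>e. concat (map enc_nat (nats e))) [Suc e..<ug_edges U]))"
      by (simp add: upt_conv_Cons)
    also have "\<dots> = concat (map (\<lambda>e. concat (map enc_nat (nats e))) [Suc e..<ug_edges U])"
      by (subst skip_pow_codes) (simp_all add: length_nats)
    finally show ?case .
  qed
  then show ?thesis by (simp add: edge_record_def)
qed

lemma edge_field_X:
  assumes "e < ug_edges U" "k < N + 4"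
  shows "edge_field k X (replicate e True) = bits (nats e ! k)"
proof -
  have "edge_record X (replicate e True) = concat (map enc_nat (nats e)) @ concat (map (\<lambda>e. concat (map enc_nat (nats e))) [Suc e..<ug_edges U])"
    using assms by (simp add: edge_record_X upt_conv_Cons)
  then have "(skip ^^ k) (edge_record X (replicate e True)) =
     concat (map enc_nat (drop k (nats e))) @ concat (map (\<lambda>e. concat (map enc_nat (nats e))) [Suc e..<ug_edges U])"
    using assms by (simp add: skip_pow_codes length_nats)
  also have "drop k (nats e) = nats e ! k # drop (Suc k) (nats e)"
    using assms by (simp add: Cons_nth_drop_Suc length_nats)
  finally show ?thesis by (simp add: edge_field_def enc_nat_code decode_code)
qed

definition edge_exp :: "nat \<Rightarrow> nat" where "edge_exp e = length (weight_exponent X (replicate e True))"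

lemma length_code: "length (code bs) = 2 * length bs + 1"
  by (induction bs) (auto simp: code_def)

lemma edge_exp_bounds:
  assumes e: "e < ug_edges U"
  shows "of_rat (ug_wt U e) * 2 ^ (length X + 2) \<le> 2 * (2 ^ edge_exp e :: real)"
    "(2 ^ edge_exp e :: real) \<le> 2 * of_rat (ug_wt U e) * 2 ^ (length X + 2)"
proof -
  obtain a b where ab: "quotient_of (ug_wt U e) = (a, b)" by (cases "quotient_of (ug_wt U e)")
  have b: "b > 0" using quotient_of_denom_pos[OF ab] .
  have wt: "ug_wt U e = of_int a / of_int b" by (rule quotient_of_div[OF ab])
  have "ug_wt U e > 0" using U0 e by (auto simp: is_unique_game_def)
  then have a: "a > 0" using b unfolding wt by (simp add: zero_less_divide_iff)
  let ?la = "length (bits (nat a))" and ?lb = "length (bits (nat b))"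
  have la: "2 ^ ?la \<le> 2 * nat a" "nat a < 2 ^ ?la" using length_bits[of "nat a"] a by auto
  have lb: "2 ^ ?lb \<le> 2 * nat b" "nat b < 2 ^ ?lb" using length_bits[of "nat b"] b by auto
  \<comment> \<open>The code of the denominator is part of \<open>X\<close>, so its bit length is at
    most \<open>length X\<close> and the truncated subtraction hidden in \<open>drop\<close> is
    exact.\<close>
  have "nat b \<in> set (nats e)" by (simp add: nats_def ab)
  then obtain xs ys where "nats e = xs @ nat b # ys" by (meson split_list)
  then have "length (enc_nat (nat b)) \<le> length (concat (map enc_nat (nats e)))" by simp
  also have "\<dots> \<le> length (edge_record X (replicate e True))" using e by (simp add: edge_record_X upt_conv_Cons)
  also have "\<dots> \<le> length X" by (rule length_edge_record)
  finally have lbX: "?lb \<le> length X" by (simp add: enc_nat_code length_code)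
  have "edge_field (N + 2) X (replicate e True) = bits (nats e ! (N + 2))" "edge_field (N + 3) X (replicate e True) = bits (nats e ! (N + 3))"
    by (intro edge_field_X[OF e]; simp)+
  then have edge_exp: "edge_exp e = ?la + (length X - ?lb) + 2"
    unfolding edge_exp_def weight_exponent_def nats_nth ab fst_conv snd_conv by simp
  have "edge_exp e + ?lb = ?la + (length X + 2)" using edge_exp lbX by simp
  then have eq: "(2 ^ edge_exp e :: real) * 2 ^ ?lb = 2 ^ ?la * 2 ^ (length X + 2)" by (metis power_add)
  have wtr: "(of_rat (ug_wt U e) :: real) * b = a" using b by (simp add: wt of_rat_divide)
  have la': "(2 ^ ?la :: real) \<le> 2 * real_of_int a" "real_of_int a \<le> 2 ^ ?la"
  proof -
    have "real (2 ^ ?la) \<le> real (2 * nat a)" "real (nat a) \<le> real (2 ^ ?la)"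
      using la by (simp_all only: of_nat_le_iff less_imp_le)
    then show "(2 ^ ?la :: real) \<le> 2 * real_of_int a" "real_of_int a \<le> 2 ^ ?la" using a by simp_all
  qed
  have lb': "(2 ^ ?lb :: real) \<le> 2 * real_of_int b" "real_of_int b \<le> 2 ^ ?lb"
  proof -
    have "real (2 ^ ?lb) \<le> real (2 * nat b)" "real (nat b) \<le> real (2 ^ ?lb)"
      using lb by (simp_all only: of_nat_le_iff less_imp_le)
    then show "(2 ^ ?lb :: real) \<le> 2 * real_of_int b" "real_of_int b \<le> 2 ^ ?lb" using b by simp_all
  qed
  have b0: "0 < real_of_int b" using b by simp
  have "b * (of_rat (ug_wt U e) * 2 ^ (length X + 2)) = a * 2 ^ (length X + 2)" using wtr by (simp add: algebra_simps)
  also have "\<dots> \<le> 2 ^ ?la * 2 ^ (length X + 2)" using la' by simp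
  also have "\<dots> = 2 ^ edge_exp e * 2 ^ ?lb" by (rule eq[symmetric])
  also have "\<dots> \<le> 2 ^ edge_exp e * (2 * real_of_int b)" using lb' by (intro mult_left_mono) auto
  finally have "b * (of_rat (ug_wt U e) * 2 ^ (length X + 2)) \<le> b * (2 * 2 ^ edge_exp e)" by (simp add: algebra_simps)
  then show "of_rat (ug_wt U e) * 2 ^ (length X + 2) \<le> 2 * (2 ^ edge_exp e :: real)" using b0 by simp
  have "real_of_int b * 2 ^ edge_exp e \<le> 2 ^ ?lb * 2 ^ edge_exp e" using lb' by (intro mult_right_mono) auto
  also have "\<dots> = 2 ^ ?la * 2 ^ (length X + 2)" using eq by (simp add: mult.commute)
  also have "\<dots> \<le> (2 * real_of_int a) * 2 ^ (length X + 2)" using la' by (intro mult_right_mono) auto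
  also have "\<dots> = b * (2 * of_rat (ug_wt U e) * 2 ^ (length X + 2))" using wtr by (simp add: algebra_simps)
  finally have "real_of_int b * 2 ^ edge_exp e \<le> real_of_int b * (2 * of_rat (ug_wt U e) * 2 ^ (length X + 2))" .
  then show "(2 ^ edge_exp e :: real) \<le> 2 * of_rat (ug_wt U e) * 2 ^ (length X + 2)" using b0 by simp
qed

text \<open>The exponent of \<open>2 ^ N / 2 * 2 ^ scale_exp\<close>, the common factor of the
  demands inside the cubes; it gives the deciding pair demand 1 in normalised units.\<close>

definition gad_dem_exp :: nat where "gad_dem_exp = length X + N + 1"
definition gad_wt_exp :: nat where "gad_wt_exp = gad_dem_exp + w"
text \<open>The summand 2 makes a quarter of the scale equal to \<open>2 ^ length X\<close>, so that
  the comparison with 1/4 in \<open>out\<close> becomes a test of high bits.\<close>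

definition scale_exp :: nat where "scale_exp = length X + 2"

sublocale scaled_reduction N U pts edge_exp lam gad_wt_exp gad_dem_exp scale_exp w
  by unfold_locales (use N0 pts0 U0 edge_exp_bounds in \<open>auto simp: power_add gad_dem_exp_def gad_wt_exp_def scale_exp_def\<close>)

definition flag :: "bool list \<Rightarrow> nat \<Rightarrow> bool" where
  "flag R p \<longleftrightarrow> p < length R \<and> R ! p"

lemma bitat: "bitat R (replicate u True) x = (if flag R (u * Q + x) then [True] else [])"
proof -
  have "drop x (drop (u * Q) R) = drop (u * Q + x) R" by (simp add: add.commute)
  then show ?thesis
    by (cases "u * Q + x < length R") (auto simp: bitat_def flag_def Cons_nth_drop_Suc[symmetric])
qed

lemma bitat_0: "bitat S [] x = (if flag S x then [True] else [])"
  using bitat[of S 0 x] by simp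

lemma edge_of_X: "edge_of X (replicate u True) = replicate (u - n) True"
  by (simp add: edge_of_def counts_X)

lemma tl_replicate: "tl (replicate k True) = replicate (k - 1) True"
  by (cases k) auto

lemma zero_code: "zero_code = enc_rat (of_nat 0)" by (simp add: zero_code_def)

lemma replicate_eq_Nil: "(replicate k b = []) = (k = 0)" by auto

lemma pow_rat_code_gad_wt: "pow_rat_code (X @ replicate (N + 1 + w) True) = enc_rat (of_nat (2 ^ gad_wt_exp))"
  and pow_rat_code_gad_dem: "pow_rat_code (X @ replicate (N + 1) True) = enc_rat (of_nat (2 ^ gad_dem_exp))"
  and pow_rat_code_edge: "pow_rat_code (weight_exponent X (replicate e True)) = enc_rat (of_nat (2 ^ edge_exp e))"
  by (simp_all add: pow_rat_code gad_wt_exp_def gad_dem_exp_def edge_exp_def add_ac)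

lemma cell_wt_code_X: "cell_wt_code x y X (replicate u True) = enc_rat (of_nat (cwt u x u y))"
  unfolding cell_wt_code_def cwt_def edge_of_X tl_replicate replicate_eq_Nil pow_rat_code_gad_wt pow_rat_code_edge zero_code by auto

lemma cell_dem_code_X: "cell_dem_code x y X R (replicate u True) = enc_rat (of_nat (cdem (flag R) u x u y))"
  unfolding cell_dem_code_def cdem_def edge_of_X tl_replicate replicate_eq_Nil bitat pow_rat_code_gad_dem pow_rat_code_edge zero_code by auto

text \<open>A subset of \<open>A\<close> is the pullback if and only if membership agrees at every
  coordinate; as \<open>bits\<close> is injective, comparing codes compares labels.\<close>

lemma pull_eq_iff:
  assumes "y \<subseteq> A" shows "(\<forall>i\<in>set [0..<N]. bits (p i) \<in> bits ` {j. j < N \<and> (j \<in> x) = (i \<in> y)}) \<longleftrightarrow>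
    (\<forall>i<N. p i < N) \<and> y = pull A p x"
proof -
  have 1: "bits (p i) \<in> bits ` {j. j < N \<and> (j \<in> x) = (i \<in> y)} \<longleftrightarrow> p i < N \<and> (p i \<in> x) = (i \<in> y)" for i
    by auto
  have 2: "y = pull A p x \<longleftrightarrow> (\<forall>i<N. (p i \<in> x) = (i \<in> y))"
  proof
    assume "y = pull A p x"
    then show "\<forall>i<N. (p i \<in> x) = (i \<in> y)" by (simp add: pull_def)
  next
    assume "\<forall>i<N. (p i \<in> x) = (i \<in> y)"
    then show "y = pull A p x" using assms by (fastforce simp: pull_def)
  qed
  show ?thesis unfolding 1 2 by (simp add: Ball_def) blast
qed

lemma link_wt_code_X:
  assumes u: "u < ncells" "u' < u" and xy: "x < Q" "y < Q"
  shows "link_wt_code x y X (replicate u True) (replicate u' True) = enc_rat (of_nat (cwt u x u' y))"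
proof (cases "n < u \<and> 0 < u' \<and> u' \<le> n")
  case False
  then have "cwt u x u' y = 0" using u by (auto simp: cwt_def)
  moreover from False consider "u \<le> n" | "u' = 0" | "u' > n" by linarith
  then have "link_wt_code x y X (replicate u True) (replicate u' True) = zero_code"
    unfolding link_wt_code_def edge_of_X by cases simp_all
  ultimately show ?thesis by (simp add: zero_code)
next
  case True
  define e where "e = u - n - 1"
  have e: "e < m" using u True by (auto simp: e_def ncells_def)
  have te: "tl (edge_of X (replicate u True)) = replicate e True"
    by (simp add: edge_of_X tl_replicate e_def)
  have f: "edge_field 0 X (replicate e True) = bits (ug_left U e)" "edge_field 1 X (replicate e True) = bits (ug_right U e)"
    "i < N \<Longrightarrow> edge_field (2 + i) X (replicate e True) = bits (ug_perm U e i)" for i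
    using edge_field_X[OF e] nats_nth by auto
  have p: "\<forall>i<N. ug_perm U e i < N" using edge_props(4)[OF e] by (auto simp: bij_betw_def)
  have "(\<forall>i\<in>set [0..<N]. edge_field (2 + i) X (replicate e True) \<in> bits ` {j. j < N \<and> (j \<in> pts ! x) = (i \<in> pts ! y)}) \<longleftrightarrow>
      (\<forall>i\<in>set [0..<N]. bits (ug_perm U e i) \<in> bits ` {j. j < N \<and> (j \<in> pts ! x) = (i \<in> pts ! y)})"
    using f(3) by auto
  also have "\<dots> \<longleftrightarrow> pts ! y = pull A (ug_perm U e) (pts ! x)"
    using pull_eq_iff[OF nth_sub[OF xy(2)]] p by simp
  finally have pull: "(\<forall>i\<in>set [0..<N]. edge_field (2 + i) X (replicate e True) \<in> bits ` {j. j < N \<and> (j \<in> pts ! x) = (i \<in> pts ! y)}) \<longleftrightarrow>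
      pts ! y = pull A (ug_perm U e) (pts ! x)" .
  have P: "pow_rat_code (replicate lam True @ weight_exponent X (replicate e True)) = enc_rat (of_nat (2 ^ (lam + edge_exp e)))"
    by (simp add: pow_rat_code edge_exp_def)
  have ub: "unary_to_bits (tl (replicate u' True)) = bits (u' - 1)" by (simp add: unary_to_bits)
  have c: "cwt u x u' y = (if u' - 1 = ug_left U e \<and> x = y \<or> u' - 1 = ug_right U e \<and> pts ! y = pull A (ug_perm U e) (pts ! x)
      then 2 ^ (lam + edge_exp e) else 0)"
    using True u by (auto simp: cwt_def e_def)
  have ne: "edge_of X (replicate u True) \<noteq> []" "edge_of X (replicate u' True) = []" "replicate u' True \<noteq> []"
    using True by (auto simp: edge_of_X)
  show ?thesis
    unfolding link_wt_code_def te ub f(1,2) bits_inject pull P c using ne edge_props(3)[OF e] by (auto simp: zero_code)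
qed

lemma build_X: "build X R = enc_cut_graph (graph (flag R))"
proof -
  let ?G = "graph (flag R)"
  let ?F = "\<lambda>j i. enc_rat (of_nat (cell_fun cwt j i)) @ enc_rat (of_nat (cell_fun (cdem (flag R)) j i))"
  have M: "length (cells X) = ncells" by (simp add: cells_X ncells_def)
  have dm: "(u * Q + x) div Q = u" "(u * Q + x) mod Q = x" if "x < Q" for u x
    by (rule div_nat_eqI; use that in \<open>simp add: algebra_simps\<close>) (use that in simp)
  have "enc_cut_graph ?G = enc_unary (ncells * Q) @ concat (map (\<lambda>j. concat (map (?F j) [0..<j])) [0..<ncells * Q])"
    unfolding enc_cut_graph_def verts
    by (intro arg_cong2[where f = "(@)"] arg_cong[where f = concat] map_cong refl)
      (auto simp: graph_def max_def min_def)
  also have "concat (map (\<lambda>j. concat (map (?F j) [0..<j])) [0..<ncells * Q]) = body X R"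
    unfolding concat_cells concat_below_cell body_def M
  proof (intro arg_cong[where f = concat] map_cong refl arg_cong2[where f = "(@)"])
    fix u x u' y assume "u \<in> set [0..<ncells]" "x \<in> set [0..<Q]" "u' \<in> set [0..<u]" "y \<in> set [0..<Q]"
    then have a: "u < ncells" "x < Q" "u' < u" "y < Q" by auto
    show "enc_rat (of_nat (cell_fun cwt (u * Q + x) (u' * Q + y))) = link_wt_code x y X (replicate u True) (replicate u' True)"
      using link_wt_code_X[OF a(1,3,2,4)] a by (simp add: cell_fun_def dm)
    show "enc_rat (of_nat (cell_fun (cdem (flag R)) (u * Q + x) (u' * Q + y))) = zero_code"
      using a by (simp add: cell_fun_def dm zero_code cdem_def)
  next
    fix u x y assume "u \<in> set [0..<ncells]" "x \<in> set [0..<Q]" "y \<in> set [0..<x]"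
    then have a: "u < ncells" "x < Q" "y < Q" by auto
    show "enc_rat (of_nat (cell_fun cwt (u * Q + x) (u * Q + y))) = cell_wt_code x y X (replicate u True)"
      using a by (simp add: cell_fun_def dm cell_wt_code_X)
    show "enc_rat (of_nat (cell_fun (cdem (flag R)) (u * Q + x) (u * Q + y))) = cell_dem_code x y X R (replicate u True)"
      using a by (simp add: cell_fun_def dm cell_dem_code_X)
  qed
  finally show ?thesis by (simp add: build_def verts_code M enc_unary_def)
qed

end

section \<open>Correctness of the reductions\<close>

context parsed
begin

lemma antipode: "antipode x = idx (A - pts ! x)"
  by (simp add: antipode_def idx_def)

lemma update_eq:
  "update X R S = map (\<lambda>p. flag R p \<or> (flag S 0 = flag S 1 \<and> flag S p \<noteq> flag S (p div Q * Q + antipode (p mod Q)))) [0..<ncells * Q]"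
proof -
  let ?h = "\<lambda>p. flag R p \<or> (flag S 0 = flag S 1 \<and> flag S p \<noteq> flag S (p div Q * Q + antipode (p mod Q)))"
  have dm: "(u * Q + x) div Q = u" "(u * Q + x) mod Q = x" if "x < Q" for u x
    by (rule div_nat_eqI; use that in \<open>simp add: algebra_simps\<close>) (use that in simp)
  have M: "length (cells X) = ncells" by (simp add: cells_X ncells_def)
  have "update X R S = concat (map (\<lambda>p. [?h p]) [0..<ncells * Q])"
    unfolding concat_cells update_def M
  proof (intro arg_cong[where f = concat] map_cong refl)
    fix u x assume "x \<in> set [0..<Q]"
    then have x: "x < Q" by simp
    show "(if bitat R (replicate u True) x = [] then
       if bitat S [] 0 = bitat S [] 1 then
         if bitat S (replicate u True) x = bitat S (replicate u True) (antipode x) then [False] else [True]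
       else [False]
     else [True]) = [?h (u * Q + x)]"
      unfolding bitat bitat_0 dm[OF x] by (auto split: if_splits)
  qed
  then show ?thesis by (simp add: concat_map_singleton)
qed

lemma cell_bound: "u < ncells \<Longrightarrow> x < Q \<Longrightarrow> u * Q + x < ncells * Q"
proof -
  assume a: "u < ncells" "x < Q"
  then have "u * Q + x < Suc u * Q" by simp
  also have "\<dots> \<le> ncells * Q" using a by (intro mult_le_mono1) auto
  finally show ?thesis .
qed

lemma flag_enc_cut: "flag (enc_cut (graph rem) S) p \<longleftrightarrow> p < ncells * Q \<and> p \<in> S"
  by (auto simp: flag_def enc_cut_def)

lemma gad_flag: "gad S \<longleftrightarrow> flag (enc_cut (graph rem) S) 0 \<noteq> flag (enc_cut (graph rem) S) 1"
proof -
  have "0 < ncells * Q" "1 < ncells * Q" using cell_bound[of 0 0] cell_bound[of 0 1] Q2 by (auto simp: ncells_def)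
  then show ?thesis by (simp add: flag_enc_cut gad_def)
qed

lemma flag_map: "flag (map h [0..<k]) p \<longleftrightarrow> p < k \<and> h p"
  by (auto simp: flag_def)

lemma flag_update:
  assumes u: "u < ncells" and z: "z \<subseteq> A"
  shows "flag (update X R (enc_cut (graph rem) S)) (u * Q + idx z) \<longleftrightarrow>
    flag R (u * Q + idx z) \<or> \<not> gad S \<and> ((u * Q + idx z \<in> S) \<noteq> (u * Q + idx (A - z) \<in> S))"
proof -
  let ?p = "u * Q + idx z"
  note b = idx[OF z] idx[OF Diff_subset[of A z]]
  have p: "?p < ncells * Q" "u * Q + idx (A - z) < ncells * Q" using cell_bound[OF u] b by auto
  have dm: "?p div Q = u" "?p mod Q = idx z"
    by (rule div_nat_eqI; use b in \<open>simp add: algebra_simps\<close>) (use b in simp)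
  have "flag (update X R (enc_cut (graph rem) S)) ?p \<longleftrightarrow> flag R ?p \<or>
     (flag (enc_cut (graph rem) S) 0 = flag (enc_cut (graph rem) S) 1 \<and>
      flag (enc_cut (graph rem) S) ?p \<noteq> flag (enc_cut (graph rem) S) (u * Q + idx (A - pts ! idx z)))"
    unfolding update_eq flag_map dm antipode using p(1) by (simp only: simp_thms)
  also have "pts ! idx z = z" using b by simp
  finally show ?thesis using p unfolding gad_flag[of S rem] flag_enc_cut by blast
qed

text \<open>Being separated from the antipode is a symmetric relation, so flags that are equal on
  antipodes stay so.\<close>

lemma sym_rem_update:
  assumes "sym_rem (flag R)" shows "sym_rem (flag (update X R (enc_cut (graph rem) S)))"
  unfolding sym_rem_def
proof (intro allI impI)
  fix e x assume e: "e < m" and x: "x \<subseteq> A"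
  have u: "n + 1 + e < ncells" using e by (simp add: ncells_def)
  have "A - (A - x) = x" using x by auto
  then show "flag (update X R (enc_cut (graph rem) S)) ((n + 1 + e) * Q + idx (A - x)) =
      flag (update X R (enc_cut (graph rem) S)) ((n + 1 + e) * Q + idx x)"
    unfolding flag_update[OF u x] flag_update[OF u Diff_subset]
    using assms[unfolded sym_rem_def, rule_format, OF e x] by auto
qed

lemma flag_update_pos:
  assumes "p \<in> pairs"
  shows "flag (update X R (enc_cut (graph rem) S)) (pos p) \<longleftrightarrow> flag R (pos p) \<or> \<not> gad S \<and> separates S p"
proof -
  obtain e x where p: "p = (e, x)" "e < m" "x \<subseteq> A" using assms by (auto simp: pairs_def)
  have u: "n + 1 + e < ncells" using p by (simp add: ncells_def)
  show ?thesis
    unfolding p(1) pos_def separates_def fst_conv snd_conv flag_update[OF u p(3)] edge_block_def ..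
qed

lemma val_add_cell:
  "val (add_cell X R (replicate e True) acc) = val acc + (\<Sum>x<Q. if flag R ((n + 1 + e) * Q + x) then 0 else 2 ^ edge_exp e)"
proof -
  have u: "first_count X @ True # replicate e True = replicate (n + 1 + e) True"
    by (simp add: counts_X replicate_add[symmetric] replicate_app_Cons_same flip: replicate_Suc)
  have "val (fold (\<lambda>x acc. if bitat R (replicate v True) x = [] then add_pow (weight_exponent X (replicate e True)) acc else acc) [0..<k] acc) =
      val acc + (\<Sum>x<k. if flag R (v * Q + x) then 0 else 2 ^ edge_exp e)" for k v
    by (induction k) (auto simp: bitat val_add_pow edge_exp_def)
  then show ?thesis unfolding add_cell_def u .
qed

lemma val_remaining: "real (val (remaining X R)) = 2 ^ (scale_exp + N) * Rtot (flag R)"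
proof -
  have "val (rec_nat [] (\<lambda>i acc. add_cell X R (replicate i True) acc) k) =
      (\<Sum>e<k. \<Sum>x<Q. if flag R ((n + 1 + e) * Q + x) then 0 else 2 ^ edge_exp e)" for k
    by (induction k) (auto simp: val_add_cell)
  then have "real (val (remaining X R)) = (\<Sum>e<m. \<Sum>x<Q. if flag R ((n + 1 + e) * Q + x) then 0 else 2 ^ edge_exp e)"
    by (simp add: remaining_def counts_X of_nat_sum if_distrib[of real] cong: if_cong)
  also have "\<dots> = (\<Sum>e<m. \<Sum>x<Q. (\<lambda>z. if flag R ((n + 1 + e) * Q + idx z) then 0 else 2 ^ edge_exp e) (pts ! x))"
    by (intro sum.cong refl) (simp only: idx_nth lessThan_iff)
  also have "\<dots> = (\<Sum>e<m. \<Sum>x\<in>Pow A. if flag R ((n + 1 + e) * Q + idx x) then 0 else 2 ^ edge_exp e)"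
    by (rule sum.cong[OF refl], rule sum_pts)
  also have "\<dots> = (\<Sum>(e, x)\<in>{..<m} \<times> Pow A. if flag R ((n + 1 + e) * Q + idx x) then 0 else 2 ^ edge_exp e)"
    by (rule sum.cartesian_product)
  also have "\<dots> = (\<Sum>p\<in>pairs. if \<not> flag R (pos p) then 2 ^ (scale_exp + N) * mu p else 0)"
    unfolding pairs_def by (intro sum.cong refl) (auto simp: pos_def mu_def q_def power_add)
  also have "\<dots> = (\<Sum>p\<in>{p \<in> pairs. \<not> flag R (pos p)}. 2 ^ (scale_exp + N) * mu p)"
    by (rule sum.inter_filter[symmetric]) simp
  finally show ?thesis by (simp add: Rtot_def sum_distrib_left)
qed

text \<open>In the scaled sum the threshold 1/4 is \<open>2 ^ (length X + N)\<close>, so by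
  \<open>ge_pow_iff\<close> the high bits decide.\<close>

lemma out_X: "out X R = (if 1 / 4 \<le> Rtot (flag R) then [False] else [True])"
proof -
  have "1 / 4 \<le> Rtot (flag R) \<longleftrightarrow> 2 ^ (scale_exp + N) * (1 / 4) \<le> 2 ^ (scale_exp + N) * Rtot (flag R)" by simp
  also have "2 ^ (scale_exp + N) * (1 / 4) = (2 ^ (length X + N) :: real)" by (simp add: scale_exp_def power_add)
  also have "2 ^ (length X + N) \<le> 2 ^ (scale_exp + N) * Rtot (flag R) \<longleftrightarrow> real (2 ^ (length X + N)) \<le> real (val (remaining X R))"
    unfolding val_remaining by simp
  also have "\<dots> \<longleftrightarrow> True \<in> set (drop (length X + N) (remaining X R))"
    unfolding of_nat_le_iff by (rule ge_pow_iff)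
  finally show ?thesis by (simp add: out_def has_True_def)
qed

lemma sparsest_iter:
  assumes C: "C \<ge> 1" and w: "48 * C < 2 ^ w" and f: "solves f (approx_sparsest_cut C)"
  shows "cheap_cut \<Longrightarrow> oracle_iter build verts_code update out f X = [True]"
    "no_cheap_cut C \<Longrightarrow> oracle_iter build verts_code update out f X = [False]"
proof -
  define step where "step R = update X R (take (length (build X R)) (f (build X R)))" for R
  define Rs where "Rs j = (step ^^ j) []" for j
  have good: "\<exists>S. step R = update X R (enc_cut (graph (flag R)) S) \<and> (\<not> gad S \<longrightarrow> 0 < Dr (flag R) S \<and> Wr S \<le> C * 2 ^ w * Dr (flag R) S) \<and>
    (cheap_cut \<longrightarrow> 1 / 4 \<le> Rtot (flag R) \<longrightarrow> \<not> gad S)" if "sym_rem (flag R)" for R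
  proof -
    have "f (build X R) \<in> approx_sparsest_cut C (enc_cut_graph (graph (flag R)))"
      using f by (simp add: solves_def build_X)
    from sparsest_answer[OF C w that this] obtain S where S: "f (build X R) = enc_cut (graph (flag R)) S"
      "\<not> gad S \<longrightarrow> 0 < Dr (flag R) S \<and> Wr S \<le> C * 2 ^ w * Dr (flag R) S"
      "cheap_cut \<longrightarrow> 1 / 4 \<le> Rtot (flag R) \<longrightarrow> \<not> gad S" by blast
    \<comment> \<open>A cut has one bit per vertex, and the query begins with the number of vertices
      in unary, so truncation leaves acceptable answers intact.\<close>
    have "length (enc_cut (graph (flag R)) S) \<le> length (build X R)"
      by (simp add: enc_cut_def build_X enc_cut_graph_def enc_unary_def)
    then have "step R = update X R (enc_cut (graph (flag R)) S)" by (simp add: step_def S(1))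
    then show ?thesis using S by blast
  qed
  have sym: "sym_rem (flag (Rs j))" for j
  proof (induction j)
    case 0
    show ?case by (simp add: Rs_def sym_rem_def flag_def)
  next
    case (Suc j)
    from good[OF this] obtain S where "step (Rs j) = update X (Rs j) (enc_cut (graph (flag (Rs j))) S)" by blast
    then show ?case using sym_rem_update[OF Suc] by (simp add: Rs_def)
  qed
  have "\<forall>j. \<exists>S. step (Rs j) = update X (Rs j) (enc_cut (graph (flag (Rs j))) S) \<and>
     (\<not> gad S \<longrightarrow> 0 < Dr (flag (Rs j)) S \<and> Wr S \<le> C * 2 ^ w * Dr (flag (Rs j)) S) \<and>
    (cheap_cut \<longrightarrow> 1 / 4 \<le> Rtot (flag (Rs j)) \<longrightarrow> \<not> gad S)"
    using good[OF sym] by blast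
  from choice[OF this] obtain S where S: "\<And>j. step (Rs j) = update X (Rs j) (enc_cut (graph (flag (Rs j))) (S j))"
     "\<And>j. \<not> gad (S j) \<Longrightarrow> 0 < Dr (flag (Rs j)) (S j) \<and> Wr (S j) \<le> C * 2 ^ w * Dr (flag (Rs j)) (S j)"
     "\<And>j. cheap_cut \<Longrightarrow> 1 / 4 \<le> Rtot (flag (Rs j)) \<Longrightarrow> \<not> gad (S j)" by blast
  have 0: "flag (Rs 0) = none" by (simp add: Rs_def flag_def fun_eq_iff)
  have st: "flag (Rs (Suc j)) (pos p) \<longleftrightarrow> flag (Rs j) (pos p) \<or> \<not> gad (S j) \<and> separates (S j) p" if "p \<in> pairs" for j p
  proof -
    have "Rs (Suc j) = update X (Rs j) (enc_cut (graph (flag (Rs j))) (S j))" using S(1)[of j] by (simp add: Rs_def)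
    then show ?thesis by (simp only: flag_update_pos[OF that])
  qed
  \<comment> \<open>There is one round per vertex of the cut graph. The edge cells alone have as
    many points as there are pairs, and the remaining cells make the number of rounds strictly
    larger.\<close>
  have k: "m * Q < length (verts_code X)"
  proof -
    have "0 < Q" using Q2 by linarith
    then have "m * Q < m * Q + (1 + n) * Q" by simp
    then show ?thesis by (simp add: verts_code cells_X algebra_simps)
  qed
  have eq: "oracle_iter build verts_code update out f X = out X (Rs (length (verts_code X)))"
    by (simp add: oracle_iter_def Rs_def step_def[abs_def])
  show "oracle_iter build verts_code update out f X = [True]" if cheap_cut
    using sparsest_loop(1)[where rem = "\<lambda>j. flag (Rs j)" and S = S, OF C 0 st S(2,3) k that] unfolding eq out_X by simp
  show "oracle_iter build verts_code update out f X = [False]" if "no_cheap_cut C"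
    using sparsest_loop(2)[where rem = "\<lambda>j. flag (Rs j)" and S = S, OF C 0 st S(2,3) k that] unfolding eq out_X by simp
qed

lemma balanced_iter:
  assumes C: "C \<ge> 1" and w: "48 * C < 2 ^ w" and f: "solves f (approx_balanced_edge_separator C)"
  shows "cheap_cut \<Longrightarrow> oracle_iter build_b (\<lambda>_. [True]) update_b out_b f X = [True]"
    "no_cheap_cut C \<Longrightarrow> oracle_iter build_b (\<lambda>_. [True]) update_b out_b f X = [False]"
proof -
  let ?b = "length X + N"
  have "flag [] = none" by (simp add: flag_def fun_eq_iff)
  then have build: "build_b X R = enc_cut_graph (graph none) @ enc_rat (2 ^ ?b)" for R
    by (simp add: build_b_def build_X pow_rat_code)
  have "f (build_b X []) \<in> approx_balanced_edge_separator C (enc_cut_graph (graph none) @ enc_rat (2 ^ ?b))"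
    using f unfolding solves_def build by blast
  from balanced_answer[OF C w _ this] obtain S where S: "f (build_b X []) = enc_cut (graph none) S"
    "cheap_cut \<longrightarrow> \<not> gad S" "no_cheap_cut C \<longrightarrow> gad S" by (auto simp: gad_dem_exp_def)
  have "length (enc_cut (graph none) S) \<le> length (build_b X [])"
    by (simp add: enc_cut_def build enc_cut_graph_def enc_unary_def)
  then have "oracle_iter build_b (\<lambda>_. [True]) update_b out_b f X = out_b X (update_b X [] (enc_cut (graph none) S))"
    by (simp add: oracle_iter_def S(1))
  also have "\<dots> = (if gad S then [False] else [True])"
    unfolding out_b_def update_b_def bitat_0 gad_flag[of S none] by auto
  finally show "cheap_cut \<Longrightarrow> oracle_iter build_b (\<lambda>_. [True]) update_b out_b f X = [True]"
    "no_cheap_cut C \<Longrightarrow> oracle_iter build_b (\<lambda>_. [True]) update_b out_b f X = [False]"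
    using S by auto
qed

lemma cheap_cutI:
  fixes \<eta> :: real
  shows "of_rat (ug_opt N U) \<ge> 1 - \<eta> \<Longrightarrow> 2 ^ (lam + 1) * \<eta> \<le> 1 \<Longrightarrow> cheap_cut"
  unfolding cheap_cut_def by (rule completeness)

text \<open>The hypothesis has the form of the conclusion of \<open>ug_soundness\<close>; it is
  applied to the functions that a cut induces on the cubes, for which the antipodal sum is the
  separated demand.\<close>

lemma no_cheap_cutI:
  assumes "\<And>q g f. (\<forall>e<m. 0 \<le> q e \<and> q e \<le> 2 * of_rat (ug_wt U e)) \<Longrightarrow>
     1 / 16 \<le> (\<Sum>e<m. q e * antipodal A (g e)) \<Longrightarrow>
     2 * C * 2 ^ w < (\<Sum>e<m. q e * ug_cost N U (2 ^ (lam + 1)) g f e)"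
  shows "no_cheap_cut C"
  unfolding no_cheap_cut_def
proof (intro allI impI)
  fix S assume "1 / 16 \<le> Dr none S"
  also have "Dr none S = (\<Sum>e<m. q e * antipodal A (edge_block S e))" by (simp add: Dr_alt antipodal_def)
  finally show "2 * C * 2 ^ w < Wr S"
    unfolding Wr_def by (intro assms) (use q_pos q_bounds in \<open>auto intro: less_imp_le\<close>)
qed

end

theorem theorem4p1:
  fixes C :: real
  assumes "unique_games_conjecture" and "C \<ge> 1"
  shows "NP_hard (approx_balanced_edge_separator C) \<and> NP_hard (approx_sparsest_cut C)"
proof -
  \<comment> \<open>The exponent of the deciding pair depends on \<open>C\<close> only; 48 is the
    constant required by \<open>sparsest_answer\<close>.\<close>
  obtain w where w: "48 * C < 2 ^ w" using real_arch_pow[of 2 "48 * C"] by auto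
  have "2 * C * 2 ^ w > 0" using assms(2) by simp
  have "(0 :: real) < 1 / 16" by simp
  \<comment> \<open>Soundness is instantiated with the two constants of \<open>no_cheap_cut\<close>,
    so \<Lambda>0 and \<zeta> are fixed before \<open>N\<close> is known.\<close>
  from ug_soundness[OF this \<open>2 * C * 2 ^ w > 0\<close>] obtain \<Lambda>0 \<zeta> :: real where \<zeta>: "\<zeta> > 0" and
    sound: "\<forall>\<Lambda>\<ge>\<Lambda>0. \<forall>N U q g f. N > 0 \<longrightarrow> is_unique_game N U \<longrightarrow> of_rat (ug_opt N U) \<le> \<zeta> \<longrightarrow>
     (\<forall>e<ug_edges U. 0 \<le> q e \<and> q e \<le> 2 * of_rat (ug_wt U e)) \<longrightarrow>
     1 / 16 \<le> (\<Sum>e<ug_edges U. q e * antipodal {..<N} (g e)) \<longrightarrow>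
     2 * C * 2 ^ w < (\<Sum>e<ug_edges U. q e * ug_cost N U \<Lambda> g f e)" by blast
  obtain l where l: "\<Lambda>0 < 2 ^ l" using real_arch_pow[of 2 \<Lambda>0] by auto
  have "(2 :: real) ^ l \<le> 2 ^ (l + 1)" by simp
  then have lam: "\<Lambda>0 \<le> 2 ^ (l + 1)" using l by linarith
  \<comment> \<open>Inverse to the tie factor, so that in the completeness case the violated edges
    contribute only a constant to the cost.\<close>
  define \<eta> :: real where "\<eta> = 1 / 2 ^ (l + 1)"
  have \<eta>: "\<eta> > 0" "2 ^ (l + 1) * \<eta> \<le> 1" by (simp_all add: \<eta>_def)
  obtain N where N: "N > 0" "NP_hard (gap_unique_games N \<eta> \<zeta>)"
    using assms(1) \<eta>(1) \<zeta> unfolding unique_games_conjecture_def by blast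
  obtain pts where pts: "set pts = Pow {..<N}" "distinct pts" using finite_distinct_list[of "Pow {..<N}"] by auto
  have rf: "reduction_fun N pts" by unfold_locales (use N pts in auto)
  interpret reduction_fun N l w pts by (rule rf)
  have sparsest: "solves (oracle_iter build verts_code update out f) (gap_unique_games N \<eta> \<zeta>)"
    if f: "solves f (approx_sparsest_cut C)" for f
    unfolding solves_def gap_unique_games_def
  proof (intro allI CollectI impI, elim conjE)
    fix x U assume U: "is_unique_game N U" and x: "x = enc_ug N U"
    interpret parsed N l w pts U by unfold_locales (rule U)
    show "(1 - \<eta> \<le> of_rat (ug_opt N U) \<longrightarrow> oracle_iter build verts_code update out f x = [True]) \<and>
      (of_rat (ug_opt N U) \<le> \<zeta> \<longrightarrow> oracle_iter build verts_code update out f x = [False])"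
      unfolding x X_def[symmetric]
      using sparsest_iter[OF assms(2) w f] cheap_cutI[OF _ \<eta>(2)] no_cheap_cutI[of C] sound[THEN spec, THEN mp, OF lam] N(1) U by blast
  qed
  have balanced: "solves (oracle_iter build_b (\<lambda>_. [True]) update_b out_b f) (gap_unique_games N \<eta> \<zeta>)"
    if f: "solves f (approx_balanced_edge_separator C)" for f
    unfolding solves_def gap_unique_games_def
  proof (intro allI CollectI impI, elim conjE)
    fix x U assume U: "is_unique_game N U" and x: "x = enc_ug N U"
    interpret parsed N l w pts U by unfold_locales (rule U)
    show "(1 - \<eta> \<le> of_rat (ug_opt N U) \<longrightarrow> oracle_iter build_b (\<lambda>_. [True]) update_b out_b f x = [True]) \<and>
      (of_rat (ug_opt N U) \<le> \<zeta> \<longrightarrow> oracle_iter build_b (\<lambda>_. [True]) update_b out_b f x = [False])"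
      unfolding x X_def[symmetric]
      using balanced_iter[OF assms(2) w f] cheap_cutI[OF _ \<eta>(2)] no_cheap_cutI[of C] sound[THEN spec, THEN mp, OF lam] N(1) U by blast
  qed
  have "poly_time 1 (\<lambda>e. verts_code (e 0))" by (rule pf_verts_code) (simp add: pf_var)
  from pf_size[OF this] obtain h where h: "poly_bounded h" "\<And>e. length (verts_code (e 0)) \<le> h (env_size 1 e)" by blast
  \<comment> \<open>The state has one flag per vertex of the cut graph, whatever the previous flags
    and the answers are.\<close>
  have "length (update X R S) \<le> h (length X)" for X R S
    using h(2)[of "\<lambda>_. X", unfolded env_size_numeral] by (simp add: length_update verts_code)
  then have "NP_hard (approx_sparsest_cut C)"
    by (intro turing_reduction[where k = h, OF _ \<open>poly_time 1 _\<close> pf_update pf_out h(1) _ _ sparsest N(2)])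
      (auto intro!: pf_build pf_var simp: out_def)
  moreover have "NP_hard (approx_balanced_edge_separator C)"
    by (rule turing_reduction[where k = "\<lambda>_. 1", OF pf_balanced(1) pf_const pf_balanced(2,3) pb_const _ _ balanced N(2)])
      (auto simp: update_b_def out_b_def)
  ultimately show ?thesis by blast
qed

end
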